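(* Let $0<|q|<1$, let $A,B,C,D$ be nonzero complex parameters and $z\in\mathbb{C}$, and consider the three-term recurrence (for associated continuous dual $q$-Hahn polynomials) $$X_{n+1}-(z-a_n)X_n+b_n^2X_{n-1}=0,$$ $$a_n=\Big(\tfrac1A+\tfrac1B+\tfrac1C+\tfrac1D\Big)q^n-(1+q)q^{2n-1},\qquad b_n^2=\frac{q}{ABCD}(1-Aq^{n-1})(1-Bq^{n-1})(1-Cq^{n-1})(1-Dq^{n-1}),$$ with $b_n^2\neq0$ for $n\ge1$. Let $\lambda_\pm=\tfrac12\big(z\pm\sqrt{z^2-4q/(ABCD)}\big)$. (i) Each of the following is a solution of the recurrence: $$X_n^{(1),\pm}=\frac{(A,B,C,D)_n}{(BCD\lambda_\pm,ABC\lambda_\pm)_n}(\lambda_\pm)^n\,{}_3\phi_2\left(\begin{matrix}BC\lambda_\pm,\,Bq^n,\,Cq^n\\ BCD\lambda_\pm q^n,\,ABC\lambda_\pm q^n\end{matrix};AD\lambda_\pm\right),$$ $$X_n^{(2)}=\frac{(A,B)_n}{(AB)^n}\,{}_3\phi_2\left(\begin{matrix}Aq^n,AB\lambda_+,AB\lambda_-\\ Aq/C,\,Aq/D\end{matrix};\frac{q^{1-n}}{B}\right),\qquad X_n^{(3)}=\frac{(A,B)_n}{(AB)^n}\,{}_3\phi_2\left(\begin{matrix}Bq^n,AB\lambda_+,AB\lambda_-\\ Bq/C,\,Bq/D\end{matrix};\frac{q^{1-n}}{A}\right),$$ $$X_n^{(4)}=\frac{(B,C)_n}{(BC)^n}\,{}_3\phi_2\left(\begin{matrix}Cq^n,BC\lambda_+,BC\lambda_-\\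 Cq/A,\,Cq/D\end{matrix};\frac{q^{1-n}}{B}\right),\qquad X_n^{(5)}=\frac{(B,D)_n}{(BD)^n}\,{}_3\phi_2\left(\begin{matrix}Dq^n,BD\lambda_+,BD\lambda_-\\ Dq/C,\,Dq/A\end{matrix};\frac{q^{1-n}}{B}\right).$$ (ii) These solutions $X_n^{(1),+},X_n^{(1),-},X_n^{(2)},X_n^{(3)},X_n^{(4)},X_n^{(5)}$ are pairwise linearly independent. (iii) Let $\alpha=\tfrac12\sqrt{ABCD/q}$ and $x=\alpha z\in\mathbb{C}\setminus[-1,1]$, and choose the branch of the square root so that $(\lambda_-/\lambda_+)^n\to0$ as $n\to\infty$. Then the minimal solution of the recurrence is, up to a multiplicative factor, $X_n^{(1),-}$.
   Context: Notation: $(a)_\infty=\prod_{j\ge1}(1-aq^{j-1})$, $(a)_n=(a)_\infty/(aq^n)_\infty$ for integer $n$, and $(a_1,\dots,a_m)_n=\prod_k(a_k)_n$. The basic hypergeometric function is $${}_3\phi_2\left(\begin{matrix}a,b,c\\ d,e\end{matrix};w\right)=\sum_{k\ge0}\frac{(a,b,c)_k}{(d,e,q)_k}w^k\quad(|w|<1).$$ Every ${}_3\phi_2$ here has argument $w=de/(abc)$; when $|de/(abc)|\ge1$ it is understood by analytic continuation, given by the transformations ${}_3\phi_2(a,b,c;d,e;\tfrac{de}{abc})=\frac{(e/a,\,de/bc)_\infty}{(e,\,de/abc)_\infty}{}_3\phi_2(a,d/b,d/c;d,de/bc;\tfrac ea)$ and ${}_3\phi_2(a,b,c;d,e;\tfrac{de}{abc})=\frac{(b,\,de/ab,\,de/bc)_\infty}{(d,e,\,de/abc)_\infty}{}_3\phi_2(d/b,e/b,de/abc;de/ab,de/bc;b)$.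 Parameters are such that the expressions written are defined. Note $\lambda_++\lambda_-=z$ and $\lambda_+\lambda_-=q/(ABCD)$; in terms of $x$, $\lambda_\pm=\frac1{2\alpha}(x\pm\sqrt{x^2-1})$. A minimal solution of a three-term recurrence is a nonzero solution $X_n$ such that $X_n/Y_n\to0$ as $n\to\infty$ for every solution $Y_n$ linearly independent of $X_n$; it is unique up to a constant multiple.
   Formalization: Part (ii) fails as written (A=B gives X^(2)=X^(3)); it is stated for parameters in general position: none of λ_+/λ_-, P, Pλ_±, P/Q, PQλ_± (P,Q distinct letters among A,B,C,D) is an integer power of q. *)

theory Defs
  imports "HOL-Complex_Analysis.Complex_Analysis"
begin

section \<open>Basic hypergeometric notation\<close>

text \<open>For a natural number \<open>n\<close> the quotient \<open>(a)\<^sub>\<infinity> / (a q\<^sup>n)\<^sub>\<infinity>\<close> is this finite product; the product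
  also gives the intended value when both infinite products vanish.\<close>

definition qpoch :: "complex \<Rightarrow> complex \<Rightarrow> nat \<Rightarrow> complex" where
  "qpoch q a n = (\<Prod>j<n. 1 - a * q ^ j)"

definition phi32_coeff ::
  "complex \<Rightarrow> complex \<Rightarrow> complex \<Rightarrow> complex \<Rightarrow> complex \<Rightarrow> complex \<Rightarrow> nat \<Rightarrow> complex" where
  "phi32_coeff q a b c d e k =
     (qpoch q a k * qpoch q b k * qpoch q c k) / (qpoch q d k * qpoch q e k * qpoch q q k)"

definition phi32_series ::
  "complex \<Rightarrow> complex \<Rightarrow> complex \<Rightarrow> complex \<Rightarrow> complex \<Rightarrow> complex \<Rightarrow> complex \<Rightarrow> complex" where
  "phi32_series q a b c d e w = (\<Sum>k. phi32_coeff q a b c d e k * w ^ k)"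

text \<open>The points \<open>q\<^sup>-\<^sup>k\<close>, \<open>k \<ge> 0\<close>: the possible poles of the continued function. Equivalently, the
  zeros of \<open>w \<mapsto> (w)\<^sub>\<infinity>\<close>.\<close>

definition q_poles :: "complex \<Rightarrow> complex set" where
  "q_poles q = {w. \<exists>k::nat. w * q ^ k = 1}"

text \<open>The value at \<open>w\<close> of the analytic continuation of the series, in its argument, from the unit
  disc to the connected open set \<open>- q_poles q\<close>. Existence and uniqueness of the continuation are
  \<open>phi32_holomorphic\<close>, \<open>phi32_eq_series\<close> and \<open>phi32_unique\<close> below.  On the locus \<open>w = de/(abc)\<close> both
  sides of each of the transformations
    \<open>\<phi>(a,b,c;d,e;de/abc) = (e/a, de/bc)\<^sub>\<infinity> / (e, de/abc)\<^sub>\<infinity> \<phi>(a,d/b,d/c;d,de/bc;e/a)\<close> and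
    \<open>\<phi>(a,b,c;d,e;de/abc) = (b, de/ab, de/bc)\<^sub>\<infinity> / (d, e, de/abc)\<^sub>\<infinity> \<phi>(d/b,e/b,de/abc;de/ab,de/bc;b)\<close>
  depend analytically on the parameters, so the continuation they provide is this one.\<close>

definition phi32 ::
  "complex \<Rightarrow> complex \<Rightarrow> complex \<Rightarrow> complex \<Rightarrow> complex \<Rightarrow> complex \<Rightarrow> complex \<Rightarrow> complex" where
  "phi32 q a b c d e w =
     (THE y. \<exists>f. f holomorphic_on (- q_poles q) \<and>
                 (\<forall>u. norm u < 1 \<longrightarrow> f u = phi32_series q a b c d e u) \<and> y = f w)"

text \<open>No denominator factor of the series vanishes, and the argument is not a pole.\<close>

definition phi32_defined :: "complex \<Rightarrow> complex \<Rightarrow> complex \<Rightarrow> complex \<Rightarrow> bool" where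
  "phi32_defined q d e w \<longleftrightarrow> d \<notin> q_poles q \<and> e \<notin> q_poles q \<and> w \<notin> q_poles q"

context
  fixes q a b c d e :: complex
  assumes q: "0 < norm q" "norm q < 1"
    and de: "d \<notin> q_poles q" "e \<notin> q_poles q"
begin

abbreviation (input) cf :: "nat \<Rightarrow> complex" where "cf \<equiv> phi32_coeff q a b c d e"
abbreviation (input) sr :: "complex \<Rightarrow> complex" where "sr \<equiv> phi32_series q a b c d e"

lemma phi32_den_nonzero: "1 - d * q ^ k \<noteq> 0" "1 - e * q ^ k \<noteq> 0" "1 - q * q ^ k \<noteq> 0"
proof -
  show "1 - d * q ^ k \<noteq> 0" "1 - e * q ^ k \<noteq> 0"
    using de unfolding q_poles_def by auto
  have "norm (q ^ Suc k) < 1"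
    using q by (simp only: norm_power power_less_one_iff) (simp add: power_Suc_less_one)
  thus "1 - q * q ^ k \<noteq> 0" by auto
qed

lemma phi32_coeff_Suc:
  "cf (Suc k) = cf k * ((1 - a * q^k) * (1 - b * q^k) * (1 - c * q^k) /
     ((1 - d * q^k) * (1 - e * q^k) * (1 - q * q^k)))"
  by (simp add: phi32_coeff_def qpoch_def mult_ac)

lemma phi32_summable:
  assumes w: "norm w < 1"
  shows "summable (\<lambda>k. cf k * w ^ k)"
proof -
  define \<rho> where "\<rho> k = (1 - a * q^k) * (1 - b * q^k) * (1 - c * q^k) /
     ((1 - d * q^k) * (1 - e * q^k) * (1 - q * q^k))" for k
  have q0: "(\<lambda>k. q ^ k) \<longlonglongrightarrow> 0"
    using q by (intro LIMSEQ_power_zero) auto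
  have "(\<lambda>k. norm (\<rho> k * w)) \<longlonglongrightarrow>
     norm ((1 - a * 0) * (1 - b * 0) * (1 - c * 0) / ((1 - d * 0) * (1 - e * 0) * (1 - q * 0)) * w)"
    unfolding \<rho>_def by (intro tendsto_intros q0) auto
  hence "(\<lambda>k. norm (\<rho> k * w)) \<longlonglongrightarrow> norm w" by simp
  hence "\<forall>\<^sub>F k in sequentially. norm (\<rho> k * w) < (norm w + 1) / 2"
    by (rule order_tendstoD) (use w in auto)
  then obtain N where N: "\<And>k. k \<ge> N \<Longrightarrow> norm (\<rho> k * w) < (norm w + 1) / 2"
    by (auto simp: eventually_sequentially)
  show ?thesis
  proof (rule summable_ratio_test[where c = "(norm w + 1) / 2" and N = N])
    fix k assume "N \<le> k"
    have "norm (cf (Suc k) * w ^ Suc k) = norm (\<rho> k * w) * norm (cf k * w ^ k)"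
      unfolding phi32_coeff_Suc \<rho>_def[symmetric] by (simp add: norm_mult mult_ac)
    also have "\<dots> \<le> (norm w + 1) / 2 * norm (cf k * w ^ k)"
      using N[OF \<open>N \<le> k\<close>] by (intro mult_right_mono) auto
    finally show "norm (cf (Suc k) * w ^ Suc k) \<le> (norm w + 1) / 2 * norm (cf k * w ^ k)" .
  qed (use w in auto)
qed

lemma phi32_sums: "norm w < 1 \<Longrightarrow> (\<lambda>k. cf k * w ^ k) sums sr w"
  unfolding phi32_series_def by (intro summable_sums phi32_summable)

lemma norm_mult_q_power_le: "norm (w * q ^ i) \<le> norm w"
proof -
  have "norm q ^ i \<le> 1" using q by (intro power_le_one) auto
  thus ?thesis by (simp add: norm_mult norm_power mult_left_le)
qed

definition phi32_e1 :: "complex \<Rightarrow> complex" where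
  "phi32_e1 w = (1 + d/q + e/q) - w * (a + b + c)"
definition phi32_e2 :: "complex \<Rightarrow> complex" where
  "phi32_e2 w = w * (a*b + b*c + a*c) - (d/q + e/q + d/q * (e/q))"
definition phi32_e3 :: "complex \<Rightarrow> complex" where
  "phi32_e3 w = d/q * (e/q) - w * (a*b*c)"

definition phi32_step :: "(complex \<Rightarrow> complex) \<Rightarrow> complex \<Rightarrow> complex" where
  "phi32_step G w = (phi32_e1 w * G (w * q) + phi32_e2 w * G (w * q^2) + phi32_e3 w * G (w * q^3)) / (1 - w)"

lemma phi32_series_step:
  assumes w: "norm w < 1"
  shows "phi32_step sr w = sr w"
proof -
  have S: "(\<lambda>k. cf k * (w * q ^ i) ^ k) sums sr (w * q ^ i)" for i
    using norm_mult_q_power_le[of w i] w by (intro phi32_sums) auto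
  define g where "g k = cf k * (1 - q^k) * (1 - d/q * q^k) * (1 - e/q * q^k) * w^k" for k
  define h where "h k = cf k * (1 - a * q^k) * (1 - b * q^k) * (1 - c * q^k) * w^k" for k
  have "(\<lambda>k. cf k * (w * q ^ 0) ^ k - (1 + d/q + e/q) * (cf k * (w * q ^ 1) ^ k)
          + (d/q + e/q + d/q * (e/q)) * (cf k * (w * q ^ 2) ^ k)
          - d/q * (e/q) * (cf k * (w * q ^ 3) ^ k)) sums
        (sr (w * q ^ 0) - (1 + d/q + e/q) * sr (w * q ^ 1)
          + (d/q + e/q + d/q * (e/q)) * sr (w * q ^ 2) - d/q * (e/q) * sr (w * q ^ 3))"
    (is "?l sums ?G")
    by (intro sums_add sums_diff sums_mult S)
  also have "?l = g"
  proof
    fix k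
    have p: "(w * q ^ i) ^ k = w ^ k * (q ^ k) ^ i" for i
      by (simp add: power_mult_distrib flip: power_mult) (simp add: mult.commute)
    have "P * (W * Q ^ 0) - (1 + x + y) * (P * (W * Q ^ 1)) + (x + y + x * y) * (P * (W * Q ^ 2))
        - x * y * (P * (W * Q ^ 3)) = P * (1 - Q) * (1 - x * Q) * (1 - y * Q) * W"
      for P W Q x y :: complex
      by (simp add: algebra_simps power2_eq_square power3_eq_cube)
    thus "?l k = g k" unfolding g_def p .
  qed
  finally have G: "g sums ?G" .
  have "(\<lambda>k. cf k * (w * q ^ 0) ^ k - (a + b + c) * (cf k * (w * q ^ 1) ^ k)
          + (a*b + b*c + a*c) * (cf k * (w * q ^ 2) ^ k)
          - a*b*c * (cf k * (w * q ^ 3) ^ k)) sums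
        (sr (w * q ^ 0) - (a + b + c) * sr (w * q ^ 1)
          + (a*b + b*c + a*c) * sr (w * q ^ 2) - a*b*c * sr (w * q ^ 3))"
    (is "?m sums ?H")
    by (intro sums_add sums_diff sums_mult S)
  also have "?m = h"
  proof
    fix k
    have p: "(w * q ^ i) ^ k = w ^ k * (q ^ k) ^ i" for i
      by (simp add: power_mult_distrib flip: power_mult) (simp add: mult.commute)
    show "?m k = h k" unfolding h_def p
      by (simp add: algebra_simps power2_eq_square power3_eq_cube)
  qed
  finally have H: "h sums ?H" .
  have qn: "q \<noteq> 0" using q by auto
  have gs: "g (Suc k) = w * h k" for k
  proof -
    have "cf (Suc k) * ((1 - d * q^k) * (1 - e * q^k) * (1 - q * q^k)) =
          cf k * ((1 - a * q^k) * (1 - b * q^k) * (1 - c * q^k))"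
      unfolding phi32_coeff_Suc using phi32_den_nonzero[of k] by simp
    hence "(cf (Suc k) * ((1 - d * q^k) * (1 - e * q^k) * (1 - q * q^k))) * w ^ Suc k =
          (cf k * ((1 - a * q^k) * (1 - b * q^k) * (1 - c * q^k))) * w ^ Suc k" by simp
    thus ?thesis unfolding g_def h_def using qn by (simp add: mult_ac)
  qed
  have "(\<lambda>k. g (Suc k)) sums (w * ?H)"
    unfolding gs by (intro sums_mult H)
  hence "g sums (w * ?H + g 0)" by (simp only: sums_Suc_iff)
  hence "g sums (w * ?H)" by (simp add: g_def)
  hence eq: "?G = w * ?H" using G sums_unique2 by blast
  have "phi32_e1 w * sr (w * q) + phi32_e2 w * sr (w * q^2) + phi32_e3 w * sr (w * q^3) = (1 - w) * sr w"
    using eq unfolding phi32_e1_def phi32_e2_def phi32_e3_def by (simp add: algebra_simps)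
  moreover have "1 - w \<noteq> 0" using w by auto
  ultimately show ?thesis by (simp add: phi32_step_def)
qed

primrec phi32_cont :: "nat \<Rightarrow> complex \<Rightarrow> complex" where
  "phi32_cont 0 = sr"
| "phi32_cont (Suc n) = phi32_step (phi32_cont n)"

definition phi32_dom :: "nat \<Rightarrow> complex set" where
  "phi32_dom n = {w. norm w * norm q ^ n < 1} - q_poles q"

lemma phi32_step_cong:
  assumes "\<And>i. i \<in> {1,2,3} \<Longrightarrow> F (w * q ^ i) = G (w * q ^ i)"
  shows "phi32_step F w = phi32_step G w"
  using assms[of 1] assms[of 2] assms[of 3] by (simp add: phi32_step_def)

lemma phi32_dom_shift:
  assumes "w \<in> phi32_dom (Suc n)" "i \<in> {1,2,3::nat}"
  shows "w * q ^ i \<in> phi32_dom n"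
proof -
  have "norm (w * q ^ i) * norm q ^ n = norm w * norm q ^ (i + n)"
    by (simp add: norm_mult norm_power power_add)
  also have "\<dots> \<le> norm w * norm q ^ Suc n"
    using assms(2) q by (intro mult_left_mono power_decreasing) auto
  also have "\<dots> < 1" using assms(1) by (simp add: phi32_dom_def)
  finally have "norm (w * q ^ i) * norm q ^ n < 1" .
  moreover have "w * q ^ i \<notin> q_poles q"
    using assms(1) by (auto simp: phi32_dom_def q_poles_def mult.assoc simp flip: power_add)
  ultimately show ?thesis by (simp add: phi32_dom_def)
qed

lemma phi32_dom_mono: "n \<le> m \<Longrightarrow> phi32_dom n \<subseteq> phi32_dom m"
proof -
  assume "n \<le> m"
  hence "norm w * norm q ^ m \<le> norm w * norm q ^ n" for w :: complex
    using q by (intro mult_left_mono power_decreasing) auto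
  thus "phi32_dom n \<subseteq> phi32_dom m" unfolding phi32_dom_def by (auto intro: le_less_trans)
qed

lemma norm_less_one_phi32_dom: "norm w < 1 \<Longrightarrow> w \<in> phi32_dom 0"
proof -
  assume w: "norm w < 1"
  have "w * q ^ k \<noteq> 1" for k
    using norm_mult_q_power_le[of w k] w by auto
  thus ?thesis using w by (auto simp: phi32_dom_def q_poles_def)
qed

lemma phi32_cont_Suc_eq: "w \<in> phi32_dom n \<Longrightarrow> phi32_cont (Suc n) w = phi32_cont n w"
proof (induction n arbitrary: w)
  case 0
  thus ?case using phi32_series_step[of w] by (simp add: phi32_dom_def)
next
  case (Suc n)
  have "phi32_step (phi32_cont (Suc n)) w = phi32_step (phi32_cont n) w"
    using Suc.IH phi32_dom_shift[OF Suc.prems] by (intro phi32_step_cong) auto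
  thus ?case by simp
qed

lemma phi32_cont_eq: "n \<le> m \<Longrightarrow> w \<in> phi32_dom n \<Longrightarrow> phi32_cont m w = phi32_cont n w"
proof (induction m rule: dec_induct)
  case (step m)
  have "w \<in> phi32_dom m" using phi32_dom_mono[OF step.hyps(1)] step.prems by auto
  thus ?case using phi32_cont_Suc_eq[of w m] step by simp
qed auto

lemma open_phi32_dom: "open (phi32_dom n)"
proof -
  have "phi32_dom n = {w. norm w * norm q ^ n < 1} \<inter> (\<Inter>k<n. {w. w * q ^ k \<noteq> 1})"
  proof (intro equalityI subsetI)
    fix w assume w: "w \<in> {w. norm w * norm q ^ n < 1} \<inter> (\<Inter>k<n. {w. w * q ^ k \<noteq> 1})"
    have "w * q ^ k \<noteq> 1" for k
    proof (cases "k < n")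
      case False
      hence "norm w * norm q ^ k \<le> norm w * norm q ^ n"
        using q by (intro mult_left_mono power_decreasing) auto
      hence "norm (w * q ^ k) < 1" using w by (auto simp: norm_mult norm_power)
      thus ?thesis by auto
    qed (use w in auto)
    thus "w \<in> phi32_dom n" using w by (auto simp: phi32_dom_def q_poles_def)
  qed (auto simp: phi32_dom_def q_poles_def)
  also have "open \<dots>"
    by (intro open_Int open_INT open_Collect_less ballI finite_lessThan open_Collect_neq
          continuous_intros)
  finally show ?thesis .
qed

lemma Un_phi32_dom: "(\<Union>n. phi32_dom n) = - q_poles q"
proof -
  have "\<exists>n. norm w * norm q ^ n < 1" for w :: complex
  proof -
    have "(\<lambda>n. norm w * norm q ^ n) \<longlonglongrightarrow> norm w * 0"
      using q by (intro tendsto_intros LIMSEQ_power_zero) auto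
    hence "\<forall>\<^sub>F n in sequentially. norm w * norm q ^ n < 1"
      by (intro order_tendstoD(2)[where y = "norm w * 0"]) auto
    thus ?thesis by (auto simp: eventually_sequentially)
  qed
  thus ?thesis by (auto simp: phi32_dom_def)
qed

lemma phi32_series_holomorphic: "sr holomorphic_on ball 0 1"
  by (rule power_series_holomorphic[where a = cf]) (use phi32_sums in auto)

lemma phi32_cont_holomorphic: "phi32_cont n holomorphic_on phi32_dom n"
proof (induction n)
  case 0
  have "phi32_dom 0 \<subseteq> ball 0 1" by (auto simp: phi32_dom_def)
  thus ?case using holomorphic_on_subset[OF phi32_series_holomorphic] by simp
next
  case (Suc n)
  have H: "(\<lambda>w. phi32_cont n (w * q ^ i)) holomorphic_on phi32_dom (Suc n)" if "i \<in> {1,2,3}" for i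
  proof -
    have "(\<lambda>w. w * q ^ i) ` phi32_dom (Suc n) \<subseteq> phi32_dom n"
      using phi32_dom_shift that by blast
    moreover have "(\<lambda>w. w * q ^ i) holomorphic_on phi32_dom (Suc n)"
      by (intro holomorphic_intros)
    ultimately show ?thesis
      using holomorphic_on_compose_gen[OF _ Suc] by (auto simp: o_def)
  qed
  have "w \<noteq> 1" if "w \<in> phi32_dom (Suc n)" for w
    using that by (auto simp: phi32_dom_def q_poles_def dest: spec[of _ 0])
  thus ?case
    unfolding phi32_cont.simps phi32_step_def[abs_def] phi32_e1_def phi32_e2_def phi32_e3_def
    using H[of 1] H[of 2] H[of 3] by (auto intro!: holomorphic_intros)
qed

lemma phi32_continuation_exists:
  "\<exists>f. f holomorphic_on (- q_poles q) \<and> (\<forall>u. norm u < 1 \<longrightarrow> f u = sr u)"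
proof -
  define f where "f w = phi32_cont (LEAST n. w \<in> phi32_dom n) w" for w
  have f: "f w = phi32_cont n w" if "w \<in> phi32_dom n" for n w
    unfolding f_def using that by (metis LeastI Least_le phi32_cont_eq)
  have "f holomorphic_on (\<Union>n\<in>UNIV. phi32_dom n)"
  proof (rule holomorphic_on_UN_open)
    show "f holomorphic_on phi32_dom n" for n
      using phi32_cont_holomorphic[of n] f by (subst holomorphic_cong[OF refl, of _ f "phi32_cont n"]) auto
  qed (rule open_phi32_dom)
  moreover have "f u = sr u" if "norm u < 1" for u
    using f[OF norm_less_one_phi32_dom[OF that]] by simp
  ultimately show ?thesis using Un_phi32_dom by auto
qed

lemma phi32_continuation_unique:
  assumes "f holomorphic_on (- q_poles q)" "\<And>u. norm u < 1 \<Longrightarrow> f u = sr u"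
    and "g holomorphic_on (- q_poles q)" "\<And>u. norm u < 1 \<Longrightarrow> g u = sr u"
    and "w \<notin> q_poles q"
  shows "f w = g w"
proof -
  have qn: "q \<noteq> 0" using q by auto
  have "q_poles q = range (\<lambda>k. inverse (q ^ k))"
    using qn by (auto simp: q_poles_def field_simps)
  hence "countable (q_poles q)" by simp
  hence con: "connected (- q_poles q)"
    using connected_open_diff_countable[of UNIV "q_poles q"]
    by (simp add: Compl_eq_Diff_UNIV connected_UNIV)
  have op: "open (- q_poles q)"
    unfolding Un_phi32_dom[symmetric] by (intro open_UN ballI open_phi32_dom)
  have sub: "ball 0 1 \<subseteq> - q_poles q"
    using norm_less_one_phi32_dom by (force simp: phi32_dom_def)
  show ?thesis
    by (rule analytic_continuation_open[where s = "ball 0 1" and s' = "- q_poles q"])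
       (use assms con op sub in auto)
qed

lemma phi32_unique:
  assumes "f holomorphic_on (- q_poles q)" "\<And>u. norm u < 1 \<Longrightarrow> f u = sr u" "w \<notin> q_poles q"
  shows "phi32 q a b c d e w = f w"
  unfolding phi32_def
proof (rule the_equality)
  show "\<exists>g. g holomorphic_on - q_poles q \<and> (\<forall>u. cmod u < 1 \<longrightarrow> g u = sr u) \<and> f w = g w"
    using assms by blast
next
  fix y assume "\<exists>g. g holomorphic_on - q_poles q \<and> (\<forall>u. cmod u < 1 \<longrightarrow> g u = sr u) \<and> y = g w"
  then obtain g where "g holomorphic_on - q_poles q" "\<And>u. cmod u < 1 \<Longrightarrow> g u = sr u" "y = g w"
    by blast
  thus "y = f w" using phi32_continuation_unique[of g f w] assms by simp
qed

theorem phi32_holomorphic: "phi32 q a b c d e holomorphic_on (- q_poles q)"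
proof -
  obtain f where f: "f holomorphic_on - q_poles q" "\<And>u. norm u < 1 \<Longrightarrow> f u = sr u"
    using phi32_continuation_exists by blast
  show ?thesis
    using f phi32_unique[OF f] by (subst holomorphic_cong[OF refl, of _ _ f]) auto
qed

theorem phi32_eq_series:
  assumes "norm w < 1"
  shows "phi32 q a b c d e w = phi32_series q a b c d e w"
proof -
  obtain f where f: "f holomorphic_on - q_poles q" "\<And>u. norm u < 1 \<Longrightarrow> f u = sr u"
    using phi32_continuation_exists by blast
  have "w \<notin> q_poles q" using norm_less_one_phi32_dom[OF assms] by (simp add: phi32_dom_def)
  thus ?thesis using f phi32_unique[OF f] assms by simp
qed

end

section \<open>The recurrence\<close>

definition rec_a :: "complex \<Rightarrow> complex \<Rightarrow> complex \<Rightarrow> complex \<Rightarrow> complex \<Rightarrow> nat \<Rightarrow> complex" where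
  "rec_a q A B C D n =
     (1/A + 1/B + 1/C + 1/D) * q ^ n - (1 + q) * q powi (2 * int n - 1)"

definition rec_b2 :: "complex \<Rightarrow> complex \<Rightarrow> complex \<Rightarrow> complex \<Rightarrow> complex \<Rightarrow> nat \<Rightarrow> complex" where
  "rec_b2 q A B C D n =
     q / (A * B * C * D) *
     (1 - A * q powi (int n - 1)) * (1 - B * q powi (int n - 1)) *
     (1 - C * q powi (int n - 1)) * (1 - D * q powi (int n - 1))"

definition is_solution ::
  "complex \<Rightarrow> complex \<Rightarrow> complex \<Rightarrow> complex \<Rightarrow> complex \<Rightarrow> complex \<Rightarrow> (nat \<Rightarrow> complex) \<Rightarrow> bool" where
  "is_solution q A B C D z X \<longleftrightarrow>
     (\<forall>n\<ge>1. X (n + 1) - (z - rec_a q A B C D n) * X n + rec_b2 q A B C D n * X (n - 1) = 0)"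

definition lin_indep2 :: "(nat \<Rightarrow> complex) \<Rightarrow> (nat \<Rightarrow> complex) \<Rightarrow> bool" where
  "lin_indep2 X Y \<longleftrightarrow> (\<forall>c d. (\<forall>n. c * X n + d * Y n = 0) \<longrightarrow> c = 0 \<and> d = 0)"

text \<open>As division by zero is total, it is stated separately that the quotients \<open>X\<^sub>n / Y\<^sub>n\<close> make sense
  for large \<open>n\<close>.\<close>

definition is_minimal ::
  "complex \<Rightarrow> complex \<Rightarrow> complex \<Rightarrow> complex \<Rightarrow> complex \<Rightarrow> complex \<Rightarrow> (nat \<Rightarrow> complex) \<Rightarrow> bool" where
  "is_minimal q A B C D z X \<longleftrightarrow>
     is_solution q A B C D z X \<and> (\<exists>n. X n \<noteq> 0) \<and>
     (\<forall>Y. is_solution q A B C D z Y \<and> lin_indep2 X Y \<longrightarrow>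
        (\<forall>\<^sub>F n in sequentially. Y n \<noteq> 0) \<and> (\<lambda>n. X n / Y n) \<longlonglongrightarrow> 0)"

section \<open>The solutions\<close>

text \<open>The argument \<open>s\<close> is a square root of \<open>z\<^sup>2 - 4q/(ABCD)\<close>, of either branch.\<close>

definition lam_plus :: "complex \<Rightarrow> complex \<Rightarrow> complex" where
  "lam_plus z s = (z + s) / 2"

definition lam_minus :: "complex \<Rightarrow> complex \<Rightarrow> complex" where
  "lam_minus z s = (z - s) / 2"

definition X1 ::
  "complex \<Rightarrow> complex \<Rightarrow> complex \<Rightarrow> complex \<Rightarrow> complex \<Rightarrow> complex \<Rightarrow> nat \<Rightarrow> complex" where
  "X1 q A B C D l n =
     (qpoch q A n * qpoch q B n * qpoch q C n * qpoch q D n) /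
     (qpoch q (B*C*D*l) n * qpoch q (A*B*C*l) n) * l ^ n *
     phi32 q (B*C*l) (B * q^n) (C * q^n) (B*C*D*l * q^n) (A*B*C*l * q^n) (A*D*l)"

definition X2 ::
  "complex \<Rightarrow> complex \<Rightarrow> complex \<Rightarrow> complex \<Rightarrow> complex \<Rightarrow> complex \<Rightarrow> complex \<Rightarrow> nat \<Rightarrow> complex" where
  "X2 q A B C D lp lm n =
     (qpoch q A n * qpoch q B n) / (A*B) ^ n *
     phi32 q (A * q^n) (A*B*lp) (A*B*lm) (A*q/C) (A*q/D) (q powi (1 - int n) / B)"

definition X3 ::
  "complex \<Rightarrow> complex \<Rightarrow> complex \<Rightarrow> complex \<Rightarrow> complex \<Rightarrow> complex \<Rightarrow> complex \<Rightarrow> nat \<Rightarrow> complex" where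
  "X3 q A B C D lp lm n =
     (qpoch q A n * qpoch q B n) / (A*B) ^ n *
     phi32 q (B * q^n) (A*B*lp) (A*B*lm) (B*q/C) (B*q/D) (q powi (1 - int n) / A)"

definition X4 ::
  "complex \<Rightarrow> complex \<Rightarrow> complex \<Rightarrow> complex \<Rightarrow> complex \<Rightarrow> complex \<Rightarrow> complex \<Rightarrow> nat \<Rightarrow> complex" where
  "X4 q A B C D lp lm n =
     (qpoch q B n * qpoch q C n) / (B*C) ^ n *
     phi32 q (C * q^n) (B*C*lp) (B*C*lm) (C*q/A) (C*q/D) (q powi (1 - int n) / B)"

definition X5 ::
  "complex \<Rightarrow> complex \<Rightarrow> complex \<Rightarrow> complex \<Rightarrow> complex \<Rightarrow> complex \<Rightarrow> complex \<Rightarrow> nat \<Rightarrow> complex" where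
  "X5 q A B C D lp lm n =
     (qpoch q B n * qpoch q D n) / (B*D) ^ n *
     phi32 q (D * q^n) (B*D*lp) (B*D*lm) (D*q/C) (D*q/A) (q powi (1 - int n) / B)"

text \<open>The conditions under which the above expressions are defined for all \<open>n\<close>. In the first one,
  the instance \<open>n = 0\<close> also makes \<open>(BCD\<lambda>, ABC\<lambda>)\<^sub>n\<close> nonzero.\<close>

definition X1_defined ::
  "complex \<Rightarrow> complex \<Rightarrow> complex \<Rightarrow> complex \<Rightarrow> complex \<Rightarrow> complex \<Rightarrow> bool" where
  "X1_defined q A B C D l \<longleftrightarrow>
     (\<forall>n::nat. phi32_defined q (B*C*D*l * q^n) (A*B*C*l * q^n) (A*D*l))"

definition X2_defined :: "complex \<Rightarrow> complex \<Rightarrow> complex \<Rightarrow> complex \<Rightarrow> complex \<Rightarrow> bool" where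
  "X2_defined q A B C D \<longleftrightarrow> (\<forall>n::nat. phi32_defined q (A*q/C) (A*q/D) (q powi (1 - int n) / B))"

definition X3_defined :: "complex \<Rightarrow> complex \<Rightarrow> complex \<Rightarrow> complex \<Rightarrow> complex \<Rightarrow> bool" where
  "X3_defined q A B C D \<longleftrightarrow> (\<forall>n::nat. phi32_defined q (B*q/C) (B*q/D) (q powi (1 - int n) / A))"

definition X4_defined :: "complex \<Rightarrow> complex \<Rightarrow> complex \<Rightarrow> complex \<Rightarrow> complex \<Rightarrow> bool" where
  "X4_defined q A B C D \<longleftrightarrow> (\<forall>n::nat. phi32_defined q (C*q/A) (C*q/D) (q powi (1 - int n) / B))"

definition X5_defined :: "complex \<Rightarrow> complex \<Rightarrow> complex \<Rightarrow> complex \<Rightarrow> complex \<Rightarrow> bool" where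
  "X5_defined q A B C D \<longleftrightarrow> (\<forall>n::nat. phi32_defined q (D*q/C) (D*q/A) (q powi (1 - int n) / B))"

text \<open>General position of the parameters. The six solutions need not be pairwise independent
  otherwise: for instance \<open>X2 = X3\<close> if \<open>A = B\<close>, and the two solutions \<open>X1\<close> coincide if
  \<open>\<lambda>\<^sub>+ = \<lambda>\<^sub>-\<close>. Up to nonvanishing factors, with \<open>\<theta>(x) = (x, q/x)\<^sub>\<infinity>\<close>, the Casoratians are
    \<open>(\<lambda>\<^sub>+ - \<lambda>\<^sub>-) (q\<lambda>\<^sub>+/\<lambda>\<^sub>-, q\<lambda>\<^sub>-/\<lambda>\<^sub>+)\<^sub>\<infinity>\<close> for the two \<open>X1\<close>,
    \<open>(PQ\<lambda>\<^sub>\<plusminus>, PR\<lambda>\<^sub>\<plusminus>, PS\<lambda>\<^sub>\<plusminus>)\<^sub>\<infinity> \<theta>(P\<lambda>\<^sub>\<mp>)\<close> for \<open>X1\<close> and the solution attached to \<open>P\<close>, and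
    \<open>(PQ\<lambda>\<^sub>+, PQ\<lambda>\<^sub>-)\<^sub>\<infinity> \<theta>(P/Q) \<theta>(R) \<theta>(S)\<close> for the solutions attached to \<open>P\<close> and \<open>Q\<close>,
  where \<open>{P, Q, R, S} = {A, B, C, D}\<close> and \<open>X2, X3, X4, X5\<close> are attached to \<open>A, B, C, D\<close>.
  As \<open>(PQ\<lambda>\<^sub>+)(RS\<lambda>\<^sub>-) = q\<close>, all of them are nonzero exactly under the following condition.\<close>

definition general_position ::
  "complex \<Rightarrow> complex \<Rightarrow> complex \<Rightarrow> complex \<Rightarrow> complex \<Rightarrow> complex \<Rightarrow> complex \<Rightarrow> bool" where
  "general_position q A B C D lp lm \<longleftrightarrow>
     (let qZ = range (\<lambda>k::int. q powi k); P = [A, B, C, D] in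
        lp / lm \<notin> qZ \<and>
        (\<forall>i<4. P!i \<notin> qZ \<and> P!i * lp \<notin> qZ \<and> P!i * lm \<notin> qZ) \<and>
        (\<forall>i<4. \<forall>j<4. i \<noteq> j \<longrightarrow>
           P!i / P!j \<notin> qZ \<and> P!i * P!j * lp \<notin> qZ \<and> P!i * P!j * lm \<notin> qZ))"

end

theory Submission
  imports Defs
begin

text \<open>In the variable \<open>u = q\<^sup>n\<close> the recurrence is a \<open>q\<close>-difference equation. It has the solutions
  \<open>\<lambda>\<^sub>\<plusminus>\<^sup>n g(u)\<close>, up to \<open>q\<close>-shifted factorials, with \<open>g\<close> entire (these are the \<open>X1\<close>), and the
  solutions \<open>q\<^bsup>n(n-1)\<^esup> k(1/u)\<close> with \<open>k\<close> entire (these are \<open>X2, ..., X5\<close>). All of them are given by one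
  function \<open>psi\<close>, the \<open>\<^sub>3\<phi>\<^sub>2\<close> multiplied by its denominators, which is entire in all parameters; so the
  recurrences need only be verified for small argument, where they are telescoping sums.

  Independence is read off from the Casoratians as functions of \<open>u\<close>. For two solutions \<open>k\<close> the
  Casoratian is an explicit product times a constant, and the constant is found at \<open>u = q/P\<close>, where the
  solution attached to the parameter \<open>P\<close> vanishes and the others are evaluated at their pole. For \<open>g\<close>
  against \<open>k\<close> the Casoratian is a theta function with two zeros modulo \<open>q\<^sup>\<int>\<close>, one of them known, and
  again it is nonzero at an explicit point.

  For minimality, \<open>X1\<close> with \<open>\<lambda>\<^sub>-\<close> behaves like \<open>\<lambda>\<^sub>-\<^sup>n\<close> and Casoratians behave like
  \<open>(\<lambda>\<^sub>+ \<lambda>\<^sub>-)\<^sup>n\<close>; hence every independent solution behaves like \<open>\<lambda>\<^sub>+\<^sup>n\<close>.\<close>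

text \<open>\<open>phi32\<close> is continued in its argument alone, whereas the recurrences shift
  the parameters as well, and in \<open>X2\<close>, ..., \<open>X5\<close> the argument (such as
  q^(1-n)/B) leaves the unit disc as n grows. No single convergent series therefore represents all
  terms of a relation for all n. Multiplication by (d, e, w)_inf removes every pole, and the
  identity theorem in one complex variable carries a relation from small arguments to all others.

  The three kinds of Casoratian need three different arguments, because the solutions are analytic
  at opposite ends. Both \<open>X1\<close> belong to u = 0 and are compared by growth: a linear
  relation would make the powers of \<lambda>_+/\<lambda>_- converge to a nonzero limit, which
  forces \<lambda>_+ = \<lambda>_-. Two solutions belonging to u = infinity have a Casoratian that
  obeys a first-order equation, solved by iterating towards that end. In the mixed case neither end
  gives the constant, and zeros have to be counted instead.\<close>

lemma entire_eqI:
  fixes f g :: "complex \<Rightarrow> complex"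
  assumes "f holomorphic_on UNIV" "g holomorphic_on UNIV" "0 < r"
    and "\<And>t. norm t < r \<Longrightarrow> f t = g t"
  shows "f t = g t"
proof (rule analytic_continuation_open[where s = "ball 0 r" and s' = UNIV and f = f and g = g])
  show "f z = g z" if "z \<in> ball 0 r" for z
    using assms(4) that by simp
qed (use assms in auto)

text \<open>The inequality 1 + t \<le> exp t turns the product into a geometric series. The bound is
  free of \<open>k\<close>, so it serves finite shifted factorials and, in the limit, infinite
  ones.\<close>

lemma prod_one_plus_power_le:
  fixes r M :: real
  assumes "0 \<le> r" "r < 1" "0 \<le> M"
  shows "(\<Prod>j<k. 1 + M * r ^ j) \<le> exp (M / (1 - r))"
proof -
  have "(\<Prod>j<k. 1 + M * r ^ j) \<le> (\<Prod>j<k. exp (M * r ^ j))"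
    using assms by (intro prod_mono conjI exp_ge_add_one_self) (auto intro!: add_nonneg_nonneg)
  also have "\<dots> = exp (M * (\<Sum>j<k. r ^ j))"
    by (simp add: exp_sum sum_distrib_left)
  also have "(\<Sum>j<k. r ^ j) \<le> (\<Sum>j. r ^ j)"
    using assms by (intro sum_le_suminf summable_geometric) auto
  hence "(\<Sum>j<k. r ^ j) \<le> 1 / (1 - r)"
    using assms by (simp add: suminf_geometric)
  hence "exp (M * (\<Sum>j<k. r ^ j)) \<le> exp (M * (1 / (1 - r)))"
    using mult_left_mono[OF _ assms(3)] by (simp only: exp_le_cancel_iff)
  finally show ?thesis by simp
qed

locale q_base =
  fixes q :: complex
  assumes q_pos: "0 < norm q" and q_less: "norm q < 1"
begin

lemma q_nonzero [simp]: "q \<noteq> 0"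
  using q_pos by auto

lemma q_power_tendsto_0: "(\<lambda>n. q ^ n) \<longlonglongrightarrow> 0"
  using q_less by (intro LIMSEQ_power_zero) auto

lemma mult_q_power_tendsto_0: "(\<lambda>n. a * q ^ n) \<longlonglongrightarrow> 0"
  using tendsto_mult_left[OF q_power_tendsto_0, of a] by simp

lemma q_power_Suc_neq_1: "1 - q ^ Suc j \<noteq> 0"
proof -
  have "norm (q ^ Suc j) < 1"
    using q_pos q_less by (simp only: norm_power power_less_one_iff) (simp add: power_Suc_less_one)
  thus ?thesis by auto
qed

lemma ex_norm_mult_q_power_less_1: "\<exists>n. norm (w::complex) * norm q ^ n < 1"
proof -
  have "(\<lambda>n. norm (w * q ^ n)) \<longlonglongrightarrow> norm (0::complex)"
    by (intro tendsto_norm mult_q_power_tendsto_0)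
  hence "\<forall>\<^sub>F n in sequentially. norm (w * q ^ n) < 1"
    by (intro order_tendstoD(2)[where y = "norm (0::complex)"]) auto
  thus ?thesis by (auto simp: eventually_sequentially norm_mult norm_power)
qed

subsection \<open>The infinite shifted factorial\<close>

text \<open>Euler's expansion of \<open>(a)\<^sub>\<infinity>\<close>.\<close>

definition qinf :: "complex \<Rightarrow> complex" where
  "qinf a = (\<Sum>k. (\<Prod>j<k. - (q ^ j) / (1 - q ^ Suc j)) * a ^ k)"

lemma qinf_summable: "summable (\<lambda>k. (\<Prod>j<k. - (q ^ j) / (1 - q ^ Suc j)) * a ^ k)"
proof -
  have "(\<lambda>k. norm (- (q ^ k) / (1 - q ^ Suc k) * a)) \<longlonglongrightarrow> norm (- 0 / (1 - 0) * a)"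
    by (intro tendsto_intros q_power_tendsto_0 LIMSEQ_Suc[OF q_power_tendsto_0]) auto
  hence "\<forall>\<^sub>F k in sequentially. norm (- (q ^ k) / (1 - q ^ Suc k) * a) < 1 / 2"
    by (rule order_tendstoD) auto
  then obtain N where N: "\<And>k. k \<ge> N \<Longrightarrow> norm (- (q ^ k) / (1 - q ^ Suc k) * a) < 1 / 2"
    by (auto simp: eventually_sequentially)
  show ?thesis
  proof (rule summable_ratio_test[where c = "1 / 2" and N = N])
    fix k assume "N \<le> k"
    define t where "t = (\<Prod>j<k. - (q ^ j) / (1 - q ^ Suc j)) * a ^ k"
    have "norm ((\<Prod>j<Suc k. - (q ^ j) / (1 - q ^ Suc j)) * a ^ Suc k) =
      norm (- (q ^ k) / (1 - q ^ Suc k) * a) * norm t"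
      unfolding norm_mult [symmetric] t_def by (simp add: mult_ac)
    also have "\<dots> \<le> 1 / 2 * norm t"
      using N[OF \<open>N \<le> k\<close>] by (intro mult_right_mono) auto
    finally show "norm ((\<Prod>j<Suc k. - (q ^ j) / (1 - q ^ Suc j)) * a ^ Suc k) \<le>
      1 / 2 * norm ((\<Prod>j<k. - (q ^ j) / (1 - q ^ Suc j)) * a ^ k)" by (simp only: t_def)
  qed auto
qed

lemma qinf_sums: "(\<lambda>k. (\<Prod>j<k. - (q ^ j) / (1 - q ^ Suc j)) * a ^ k) sums qinf a"
  unfolding qinf_def by (intro summable_sums qinf_summable)

lemma qinf_holomorphic_UNIV: "qinf holomorphic_on UNIV"
proof -
  have "qinf holomorphic_on ball 0 r" for r
    by (rule power_series_holomorphic[where a = "\<lambda>k. \<Prod>j<k. - (q ^ j) / (1 - q ^ Suc j)"])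
       (simp only: diff_zero qinf_sums)
  hence "qinf holomorphic_on (\<Union>n. ball 0 (real n))"
    by (intro holomorphic_on_UN_open open_ball)
  also have "(\<Union>n. ball 0 (real n)) = (UNIV :: complex set)"
    by (auto intro: reals_Archimedean2)
  finally show ?thesis .
qed

lemma qinf_holomorphic [holomorphic_intros]:
  "f holomorphic_on S \<Longrightarrow> (\<lambda>t. qinf (f t)) holomorphic_on S"
  using holomorphic_on_compose_gen[OF _ qinf_holomorphic_UNIV, of f S] by (simp add: o_def)

lemma isCont_qinf: "isCont qinf a"
  using holomorphic_on_imp_continuous_on[OF qinf_holomorphic_UNIV]
  by (simp add: continuous_on_eq_continuous_at)

lemma qinf_0 [simp]: "qinf 0 = 1"
proof -
  have "(\<lambda>k. (\<Prod>j<k. - (q ^ j) / (1 - q ^ Suc j)) * 0 ^ k) sums ((\<Prod>j<0. - (q ^ j) / (1 - q ^ Suc j)))"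
    by (rule powser_sums_zero)
  from sums_unique2[OF qinf_sums[of 0] this] show ?thesis by simp
qed

text \<open>Passing from \<open>a\<close> to \<open>a * q\<close> produces the factor 1 - q^(k+1),
  which cancels the last denominator of the coefficient and shifts the series by one index.\<close>

lemma qinf_step: "qinf a = (1 - a) * qinf (a * q)"
proof -
  define c where "c k = (\<Prod>j<k. - (q ^ j) / (1 - q ^ Suc j))" for k
  have S: "(\<lambda>k. c k * x ^ k) sums qinf x" for x
    unfolding c_def by (rule qinf_sums)
  have *: "c (Suc k) * a ^ Suc k - c (Suc k) * (a * q) ^ Suc k = - a * (c k * (a * q) ^ k)" for k
  proof -
    have "c (Suc k) * (1 - q ^ Suc k) = c k * (- (q ^ k))"
      using q_power_Suc_neq_1[of k] by (simp add: c_def)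
    hence "c (Suc k) * (1 - q ^ Suc k) * a ^ Suc k = c k * (- (q ^ k)) * a ^ Suc k" by simp
    thus ?thesis by (simp add: algebra_simps power_mult_distrib)
  qed
  have "(\<lambda>k. c k * a ^ k - c k * (a * q) ^ k) sums (qinf a - qinf (a * q))"
    by (intro sums_diff S)
  hence "(\<lambda>k. c (Suc k) * a ^ Suc k - c (Suc k) * (a * q) ^ Suc k) sums (qinf a - qinf (a * q))"
    by (subst sums_Suc_iff) simp
  hence "(\<lambda>k. - a * (c k * (a * q) ^ k)) sums (qinf a - qinf (a * q))"
    by (simp only: *)
  moreover have "(\<lambda>k. - a * (c k * (a * q) ^ k)) sums (- a * qinf (a * q))"
    by (intro sums_mult S)
  ultimately have "qinf a - qinf (a * q) = - a * qinf (a * q)"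
    using sums_unique2 by blast
  thus ?thesis by (simp add: algebra_simps)
qed

lemma qinf_eq_qpoch: "qinf a = qpoch q a n * qinf (a * q ^ n)"
proof (induction n)
  case (Suc n)
  have "qinf (a * q ^ n) = (1 - a * q ^ n) * qinf (a * q ^ Suc n)"
    using qinf_step[of "a * q ^ n"] by (simp only: mult.assoc power_Suc2)
  with Suc show ?case by (simp only: qpoch_def prod.lessThan_Suc mult.assoc)
qed (simp add: qpoch_def)

lemma qinf_1 [simp]: "qinf 1 = 0"
  using qinf_step[of 1] by simp

lemma qinf_mult_q_power_tendsto_1: "(\<lambda>n. qinf (a * q ^ n)) \<longlonglongrightarrow> 1"
  using isCont_tendsto_compose[OF isCont_qinf mult_q_power_tendsto_0] by simp

text \<open>Iterating \<open>qinf_step\<close> moves the argument towards 0, where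
  \<open>qinf\<close> is close to 1; a zero can then only come from the finite product split off on
  the way.\<close>

lemma qinf_eq_0_iff: "qinf a = 0 \<longleftrightarrow> a \<in> q_poles q"
proof
  assume "qinf a = 0"
  have "\<forall>\<^sub>F n in sequentially. qinf (a * q ^ n) \<noteq> 0"
    using qinf_mult_q_power_tendsto_1 by (rule tendsto_imp_eventually_ne) simp
  then obtain n where "qinf (a * q ^ n) \<noteq> 0" by (auto simp: eventually_sequentially)
  hence "qpoch q a n = 0" using qinf_eq_qpoch[of a n] \<open>qinf a = 0\<close> by simp
  thus "a \<in> q_poles q" by (auto simp: qpoch_def q_poles_def)
next
  assume "a \<in> q_poles q"
  then obtain n where "a * q ^ n = 1" by (auto simp: q_poles_def)
  thus "qinf a = 0" using qinf_eq_qpoch[of a n] by simp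
qed

text \<open>This identifies the Euler series with the infinite product.\<close>

lemma qpoch_tendsto: "(\<lambda>n. qpoch q a n) \<longlonglongrightarrow> qinf a"
proof (rule Lim_transform_eventually)
  show "(\<lambda>n. qinf a / qinf (a * q ^ n)) \<longlonglongrightarrow> qinf a"
    using tendsto_divide[OF tendsto_const qinf_mult_q_power_tendsto_1, of "qinf a" a] by simp
  have "\<forall>\<^sub>F n in sequentially. qinf (a * q ^ n) \<noteq> 0"
    using qinf_mult_q_power_tendsto_1 by (rule tendsto_imp_eventually_ne) simp
  thus "\<forall>\<^sub>F n in sequentially. qinf a / qinf (a * q ^ n) = qpoch q a n"
    by eventually_elim (metis nonzero_mult_div_cancel_right qinf_eq_qpoch)
qed

lemma q_not_pole: "q \<notin> q_poles q"
  using q_power_Suc_neq_1 by (auto simp: q_poles_def)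

lemma qinf_q_nonzero [simp]: "qinf q \<noteq> 0"
  by (simp add: qinf_eq_0_iff q_not_pole)

lemma qpoch_Suc: "qpoch q a (Suc n) = qpoch q a n * (1 - a * q ^ n)"
  by (simp add: qpoch_def)

lemma qpoch_q_nonzero [simp]: "qpoch q q n \<noteq> 0"
  using qinf_eq_qpoch[of q n] qinf_q_nonzero by auto

lemma norm_qpoch_le:
  assumes "norm a \<le> M"
  shows "norm (qpoch q a n) \<le> exp (M / (1 - norm q))"
proof -
  have "0 \<le> M" using assms norm_ge_zero order_trans by blast
  have "norm (qpoch q a n) \<le> (\<Prod>j<n. 1 + M * norm q ^ j)"
    unfolding qpoch_def prod_norm [symmetric]
  proof (intro prod_mono conjI)
    fix j
    have "norm (1 - a * q ^ j) \<le> norm (1::complex) + norm (a * q ^ j)" by (rule norm_triangle_ineq4)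
    also have "\<dots> \<le> 1 + M * norm q ^ j"
      using assms by (simp add: norm_mult norm_power mult_right_mono)
    finally show "norm (1 - a * q ^ j) \<le> 1 + M * norm q ^ j" .
  qed auto
  also have "\<dots> \<le> exp (M / (1 - norm q))"
    using q_less \<open>0 \<le> M\<close> by (intro prod_one_plus_power_le) auto
  finally show ?thesis .
qed

lemma norm_qinf_le:
  assumes "norm a \<le> M"
  shows "norm (qinf a) \<le> exp (M / (1 - norm q))"
  by (rule Lim_bounded[OF tendsto_norm[OF qpoch_tendsto], where M = 0])
     (use norm_qpoch_le[OF assms] in auto)


subsection \<open>The entire form of the series\<close>

text \<open>The homogeneous form of w^k (a)_k, with x = w and y = a w.\<close>

definition psi_prod :: "complex \<Rightarrow> complex \<Rightarrow> nat \<Rightarrow> complex" where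
  "psi_prod x y k = (\<Prod>j<k. x - y * q ^ j)"

text \<open>The k-th term of (d, e)_inf times the series: \<open>qinf (d * q ^ k)\<close> is
  (d)_inf/(d)_k written without a division, and likewise for \<open>e\<close>.\<close>

definition psi_term ::
  "complex \<Rightarrow> complex \<Rightarrow> complex \<Rightarrow> complex \<Rightarrow> complex \<Rightarrow> complex \<Rightarrow> nat \<Rightarrow> complex" where
  "psi_term b c d e x y k = psi_prod x y k * qpoch q b k * qpoch q c k *
     qinf (d * q ^ k) * qinf (e * q ^ k) / qpoch q q k"

text \<open>The third-order q-difference equation of the series in its argument, multiplied by (x
  q)_inf. The factors \<open>1 - x*q\<close> and \<open>1 - x*q^2\<close> compensate the different
  products (x q^i)_inf, and (x)_inf = (1 - x)(x q)_inf absorbs the division by 1 - x.\<close>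

definition psi_step ::
  "complex \<Rightarrow> complex \<Rightarrow> complex \<Rightarrow> complex \<Rightarrow>
     (complex \<Rightarrow> complex \<Rightarrow> complex) \<Rightarrow> complex \<Rightarrow> complex \<Rightarrow> complex" where
  "psi_step b c d e G x y =
     (1 + d/q + e/q - (y + x*(b + c))) * G (x*q) (y*q)
     + (y*(b + c) + x*b*c - (d/q + e/q + d*e/q^2)) * (1 - x*q) * G (x*q^2) (y*q^2)
     + (d*e/q^2 - y*b*c) * (1 - x*q) * (1 - x*q^2) * G (x*q^3) (y*q^3)"

text \<open>One step uses only the arguments multiplied by q, q^2, q^3, so the n-th function is
  meaningful for |x| |q|^n < 1.\<close>

primrec psi_ext ::
  "nat \<Rightarrow> complex \<Rightarrow> complex \<Rightarrow> complex \<Rightarrow> complex \<Rightarrow> complex \<Rightarrow> complex \<Rightarrow> complex" where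
  "psi_ext 0 b c d e = (\<lambda>x y. qinf x * (\<Sum>k. psi_term b c d e x y k))"
| "psi_ext (Suc n) b c d e = psi_step b c d e (psi_ext n b c d e)"

text \<open>\<open>psi b c d e w (a w)\<close> is \<open>(d, e, w)\<^sub>\<infinity>\<close> times the continuation of \<open>\<phi>(a,b,c;d,e;w)\<close>. The homogeneous
  pair \<open>(w, a w)\<close> also covers the confluent case \<open>w \<rightarrow> 0\<close> with \<open>a w\<close> fixed. The sequence in the limit
  is eventually constant.\<close>

definition psi ::
  "complex \<Rightarrow> complex \<Rightarrow> complex \<Rightarrow> complex \<Rightarrow> complex \<Rightarrow> complex \<Rightarrow> complex" where
  "psi b c d e x y = lim (\<lambda>n. psi_ext n b c d e x y)"

lemma psi_prod_Suc: "psi_prod x y (Suc k) = psi_prod x y k * (x - y * q ^ k)"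
  by (simp add: psi_prod_def)

lemma psi_prod_scale: "psi_prod (x * s) (y * s) k = s ^ k * psi_prod x y k"
  by (induction k) (simp_all add: psi_prod_def algebra_simps)

lemma psi_term_scale: "psi_term b c d e (x * s) (y * s) k = s ^ k * psi_term b c d e x y k"
  by (simp add: psi_term_def psi_prod_scale)

lemma psi_term_Suc:
  "psi_term b c d e x y (Suc k) * ((1 - q ^ Suc k) * (1 - d * q ^ k) * (1 - e * q ^ k)) =
   psi_term b c d e x y k * ((x - y * q ^ k) * (1 - b * q ^ k) * (1 - c * q ^ k))"
proof -
  have 1: "qinf (d * q ^ k) = (1 - d * q ^ k) * qinf (d * q ^ Suc k)" for d
    using qinf_step[of "d * q ^ k"] by (simp only: mult.assoc power_Suc2)
  have 2: "qpoch q q (Suc k) = qpoch q q k * (1 - q ^ Suc k)" by (simp add: qpoch_Suc)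
  show ?thesis
    unfolding psi_term_def psi_prod_Suc 1[of d] 1[of e] 2 qpoch_Suc[of b] qpoch_Suc[of c]
    using q_power_Suc_neq_1[of k] by (simp add: divide_simps)
qed

lemma norm_psi_prod_le:
  assumes "0 < \<rho>" "norm x \<le> \<rho>" "norm y \<le> M"
  shows "norm (psi_prod x y k) \<le> exp (M / \<rho> / (1 - norm q)) * \<rho> ^ k"
proof -
  have M: "0 \<le> M" using assms(3) norm_ge_zero order_trans by blast
  have "norm (psi_prod x y k) \<le> (\<Prod>j<k. \<rho> * (1 + M / \<rho> * norm q ^ j))"
    unfolding psi_prod_def prod_norm [symmetric]
  proof (intro prod_mono conjI)
    fix j
    have "norm (x - y * q ^ j) \<le> norm x + norm (y * q ^ j)" by (rule norm_triangle_ineq4)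
    also have "\<dots> \<le> \<rho> + M * norm q ^ j"
      using assms by (simp add: norm_mult norm_power mult_right_mono add_mono)
    also have "\<dots> = \<rho> * (1 + M / \<rho> * norm q ^ j)" using assms(1) by (simp add: field_simps)
    finally show "norm (x - y * q ^ j) \<le> \<rho> * (1 + M / \<rho> * norm q ^ j)" .
  qed auto
  also have "\<dots> = \<rho> ^ k * (\<Prod>j<k. 1 + M / \<rho> * norm q ^ j)"
    by (simp add: prod.distrib)
  also have "\<dots> \<le> \<rho> ^ k * exp (M / \<rho> / (1 - norm q))"
    using assms(1) M q_less by (intro mult_left_mono prod_one_plus_power_le) auto
  finally show ?thesis by (simp add: mult_ac)
qed

lemma inverse_qpoch_q_bounded: "\<exists>K>0. \<forall>k. norm (inverse (qpoch q q k)) \<le> K"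
proof -
  have "(\<lambda>k. inverse (qpoch q q k)) \<longlonglongrightarrow> inverse (qinf q)"
    by (intro tendsto_inverse qpoch_tendsto qinf_q_nonzero)
  hence "Bseq (\<lambda>k. inverse (qpoch q q k))"
    using convergentI convergent_imp_Bseq by blast
  thus ?thesis by (simp only: Bseq_def)
qed

text \<open>One constant for all parameters in bounded ranges, as the M-test requires when the
  parameters are themselves functions of a complex variable.\<close>

lemma psi_term_bound:
  assumes "0 < \<rho>" "0 \<le> M"
  shows "\<exists>K. \<forall>b c d e x y k. norm x \<le> \<rho> \<longrightarrow> norm y \<le> M \<longrightarrow> norm b \<le> M \<longrightarrow> norm c \<le> M \<longrightarrow>
    norm d \<le> M \<longrightarrow> norm e \<le> M \<longrightarrow> norm (psi_term b c d e x y k) \<le> K * \<rho> ^ k"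
proof -
  obtain K0 where K0: "K0 > 0" "\<And>k. norm (inverse (qpoch q q k)) \<le> K0"
    using inverse_qpoch_q_bounded by blast
  define E where "E = exp (M / (1 - norm q))"
  define E' where "E' = exp (M / \<rho> / (1 - norm q))"
  have "norm (psi_term b c d e x y k) \<le> (E' * E * E * E * E * K0) * \<rho> ^ k"
    if h: "norm x \<le> \<rho>" "norm y \<le> M" "norm b \<le> M" "norm c \<le> M" "norm d \<le> M" "norm e \<le> M"
    for b c d e x y k
  proof -
    have *: "norm (d * q ^ k) \<le> M" if "norm d \<le> M" for d
    proof -
      have "norm q ^ k \<le> 1" using q_less by (intro power_le_one) auto
      hence "norm (d * q ^ k) \<le> norm d" by (simp add: norm_mult norm_power mult_left_le)
      thus ?thesis using that by simp
    qed
    have "norm (psi_term b c d e x y k) = norm (psi_prod x y k) * norm (qpoch q b k) *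
        norm (qpoch q c k) * norm (qinf (d * q ^ k)) * norm (qinf (e * q ^ k)) *
        norm (inverse (qpoch q q k))"
      by (simp add: psi_term_def norm_mult norm_inverse norm_divide divide_inverse)
    also have "\<dots> \<le> (E' * \<rho> ^ k) * E * E * E * E * K0"
      unfolding E_def E'_def using h assms(1)
      by (intro mult_mono norm_psi_prod_le norm_qpoch_le norm_qinf_le * K0(2))
         (auto intro!: mult_nonneg_nonneg)
    finally show ?thesis by (simp add: mult_ac)
  qed
  thus ?thesis by blast
qed

lemma psi_term_summable:
  assumes "norm x < 1"
  shows "summable (psi_term b c d e x y)"
proof -
  obtain \<rho> where \<rho>: "norm x < \<rho>" "\<rho> < 1" using dense assms by blast
  have "0 < \<rho>" using \<rho>(1) norm_ge_zero le_less_trans by blast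
  define M where "M = norm y + norm b + norm c + norm d + norm e"
  have "0 \<le> M" by (simp add: M_def)
  from psi_term_bound[OF \<open>0 < \<rho>\<close> this] obtain K where
    K: "\<And>b c d e x y k. norm x \<le> \<rho> \<Longrightarrow> norm y \<le> M \<Longrightarrow> norm b \<le> M \<Longrightarrow> norm c \<le> M \<Longrightarrow>
    norm d \<le> M \<Longrightarrow> norm e \<le> M \<Longrightarrow> norm (psi_term b c d e x y k) \<le> K * \<rho> ^ k" by blast
  show ?thesis
  proof (rule summable_comparison_test)
    show "\<exists>N. \<forall>k\<ge>N. norm (psi_term b c d e x y k) \<le> K * \<rho> ^ k"
      using \<rho> by (intro exI[of _ 0] allI impI K) (auto simp: M_def)
    show "summable (\<lambda>k. K * \<rho> ^ k)"
      using \<rho> \<open>0 < \<rho>\<close> by (intro summable_mult summable_geometric) auto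
  qed
qed

text \<open>Scaling (x, y) by q^i multiplies the k-th term by (q^k)^i, so polynomials in q^k become
  combinations of shifted sums. The sequence \<open>g\<close> carries the factors of the lower
  parameters; it vanishes at 0 because of 1 - q^k, and by \<open>psi_term_Suc\<close> its shift
  carries the factors of the upper parameters. Hence both combinations have the same sum.\<close>

lemma psi_series_step:
  assumes x: "norm x < 1"
  shows "psi_ext (Suc 0) b c d e x y = psi_ext 0 b c d e x y"
proof -
  define t where "t = psi_term b c d e x y"
  define s where "s i = (\<Sum>k. psi_term b c d e (x * q ^ i) (y * q ^ i) k)" for i
  have S: "(\<lambda>k. (q ^ k) ^ i * t k) sums s i" for i
  proof -
    have "norm q ^ i \<le> 1" using q_less by (intro power_le_one) auto
    hence "norm (x * q ^ i) \<le> norm x" by (simp add: norm_mult norm_power mult_left_le)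
    hence "psi_term b c d e (x * q ^ i) (y * q ^ i) sums s i"
      unfolding s_def using x by (intro summable_sums psi_term_summable) auto
    also have "psi_term b c d e (x * q ^ i) (y * q ^ i) = (\<lambda>k. (q ^ k) ^ i * t k)"
      by (simp add: fun_eq_iff psi_term_scale t_def power_mult [symmetric] mult.commute)
    finally show ?thesis .
  qed
  define g where "g k = t k * ((1 - q ^ k) * (1 - d/q * q ^ k) * (1 - e/q * q ^ k))" for k
  have "(\<lambda>k. (q ^ k) ^ 0 * t k - (1 + d/q + e/q) * ((q ^ k) ^ 1 * t k)
      + (d/q + e/q + d*e/q^2) * ((q ^ k) ^ 2 * t k) - d*e/q^2 * ((q ^ k) ^ 3 * t k)) sums
     (s 0 - (1 + d/q + e/q) * s 1 + (d/q + e/q + d*e/q^2) * s 2 - d*e/q^2 * s 3)" (is "?l sums ?G")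
    by (intro sums_add sums_diff sums_mult S)
  also have "?l = g"
    by (simp add: fun_eq_iff g_def field_simps power2_eq_square power3_eq_cube)
  finally have G: "g sums ?G" .
  have "(\<lambda>k. x * ((q ^ k) ^ 0 * t k) - (y + x*(b + c)) * ((q ^ k) ^ 1 * t k)
      + (y*(b + c) + x*b*c) * ((q ^ k) ^ 2 * t k) - y*b*c * ((q ^ k) ^ 3 * t k)) sums
     (x * s 0 - (y + x*(b + c)) * s 1 + (y*(b + c) + x*b*c) * s 2 - y*b*c * s 3)" (is "?m sums ?H")
    by (intro sums_add sums_diff sums_mult S)
  also have "?m = (\<lambda>k. t k * ((x - y * q ^ k) * (1 - b * q ^ k) * (1 - c * q ^ k)))"
    by (simp add: fun_eq_iff algebra_simps power2_eq_square power3_eq_cube)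
  also have "\<dots> = (\<lambda>k. g (Suc k))"
  proof
    fix k
    show "t k * ((x - y * q ^ k) * (1 - b * q ^ k) * (1 - c * q ^ k)) = g (Suc k)"
      using psi_term_Suc[of b c d e x y k] by (simp add: g_def t_def)
  qed
  finally have "(\<lambda>k. g (Suc k)) sums ?H" .
  hence "g sums (?H + g 0)" by (simp only: sums_Suc_iff)
  hence "g sums ?H" by (simp add: g_def)
  with G have eq: "?G = ?H" using sums_unique2 by blast
  have P: "psi_ext 0 b c d e (x * q ^ i) (y * q ^ i) = qinf (x * q ^ i) * s i" for i
    by (simp add: s_def)
  have Q: "qinf x = (1 - x) * qinf (x * q)" "qinf (x * q) = (1 - x * q) * qinf (x * q^2)"
     "qinf (x * q^2) = (1 - x * q^2) * qinf (x * q^3)"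
    using qinf_step[of x] qinf_step[of "x * q"] qinf_step[of "x * q^2"]
    by (simp_all only: power2_eq_square power3_eq_cube mult.assoc)
  have lin: "\<alpha> * g1 + \<beta> * u * g2 + \<gamma> * u * v * g3 = w * (\<alpha> * s1 + \<beta> * s2 + \<gamma> * s3)"
    if "g1 = w * s1" "u * g2 = w * s2" "u * v * g3 = w * s3"
    for \<alpha> \<beta> \<gamma> g1 g2 g3 u v w s1 s2 s3 :: complex
    using that by algebra
  have "psi_ext (Suc 0) b c d e x y = qinf (x * q) *
     ((1 + d/q + e/q - (y + x*(b + c))) * s 1
     + (y*(b + c) + x*b*c - (d/q + e/q + d*e/q^2)) * s 2
     + (d*e/q^2 - y*b*c) * s 3)"
    unfolding psi_ext.simps(2) psi_step_def
  proof (rule lin)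
    show "psi_ext 0 b c d e (x * q) (y * q) = qinf (x * q) * s 1"
      using P[of 1] by (simp only: power_one_right)
    show "(1 - x * q) * psi_ext 0 b c d e (x * q^2) (y * q^2) = qinf (x * q) * s 2"
      by (simp only: P[of 2] Q(2) mult.assoc)
    show "(1 - x * q) * (1 - x * q^2) * psi_ext 0 b c d e (x * q^3) (y * q^3) = qinf (x * q) * s 3"
      by (simp only: P[of 3] Q(2) Q(3) mult.assoc)
  qed
  also have "(1 + d/q + e/q - (y + x*(b + c))) * s 1
     + (y*(b + c) + x*b*c - (d/q + e/q + d*e/q^2)) * s 2
     + (d*e/q^2 - y*b*c) * s 3 = (1 - x) * s 0"
    using eq by (simp add: algebra_simps)
  also have "qinf (x * q) * ((1 - x) * s 0) = qinf x * s 0" by (subst Q(1)) (simp only: mult_ac)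
  finally show ?thesis using P[of 0] by (simp only: power_0 mult_1_right)
qed

lemma psi_step_cong:
  assumes "\<And>i. i \<in> {1,2,3} \<Longrightarrow> F (x * q ^ i) (y * q ^ i) = G (x * q ^ i) (y * q ^ i)"
  shows "psi_step b c d e F x y = psi_step b c d e G x y"
  using assms[of 1] assms[of 2] assms[of 3] by (simp add: psi_step_def)

lemma norm_shift_less:
  assumes "norm x * norm q ^ Suc n < 1" "i \<in> {1,2,3::nat}"
  shows "norm (x * q ^ i) * norm q ^ n < 1"
proof -
  have "norm (x * q ^ i) * norm q ^ n = norm x * norm q ^ (i + n)"
    by (simp add: norm_mult norm_power power_add)
  also have "\<dots> \<le> norm x * norm q ^ Suc n"
    using assms(2) q_less by (intro mult_left_mono power_decreasing) auto
  finally show ?thesis using assms(1) by (rule le_less_trans)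
qed

lemma psi_ext_Suc_eq:
  "norm x * norm q ^ n < 1 \<Longrightarrow> psi_ext (Suc n) b c d e x y = psi_ext n b c d e x y"
proof (induction n arbitrary: x y)
  case 0
  thus ?case using psi_series_step[of x] by simp
next
  case (Suc n)
  have "psi_step b c d e (psi_ext (Suc n) b c d e) x y = psi_step b c d e (psi_ext n b c d e) x y"
    using Suc.IH norm_shift_less[OF Suc.prems] by (intro psi_step_cong) auto
  thus ?case by simp
qed

lemma psi_eq_psi_ext:
  assumes "norm x * norm q ^ n < 1"
  shows "psi b c d e x y = psi_ext n b c d e x y"
proof -
  have "psi_ext m b c d e x y = psi_ext n b c d e x y" if "m \<ge> n" for m
    using that
  proof (induction m rule: dec_induct)
    case (step m)
    have "norm x * norm q ^ m \<le> norm x * norm q ^ n"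
      using step q_less by (intro mult_left_mono power_decreasing) auto
    thus ?case using psi_ext_Suc_eq[of x m] step assms by simp
  qed auto
  hence "\<forall>\<^sub>F m in sequentially. psi_ext n b c d e x y = psi_ext m b c d e x y"
    unfolding eventually_sequentially by metis
  hence "(\<lambda>m. psi_ext m b c d e x y) \<longlonglongrightarrow> psi_ext n b c d e x y"
    by (rule Lim_transform_eventually[OF tendsto_const])
  thus ?thesis unfolding psi_def by (rule limI)
qed

lemma psi_eq_series:
  assumes "norm x < 1"
  shows "psi b c d e x y = qinf x * (\<Sum>k. psi_term b c d e x y k)"
  using psi_eq_psi_ext[of x 0] assms by simp

lemma psi_rec: "psi b c d e x y = psi_step b c d e (psi b c d e) x y"
proof -
  obtain n where "norm x * norm q ^ n < 1" using ex_norm_mult_q_power_less_1 by blast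
  moreover have "norm x * norm q ^ Suc n \<le> norm x * norm q ^ n"
    using q_less by (intro mult_left_mono power_decreasing) auto
  ultimately have n: "norm x * norm q ^ Suc n < 1" by simp
  have "psi b c d e x y = psi_step b c d e (psi_ext n b c d e) x y"
    using psi_eq_psi_ext[OF n] by simp
  also have "\<dots> = psi_step b c d e (psi b c d e) x y"
    by (intro psi_step_cong psi_eq_psi_ext[OF norm_shift_less[OF n], symmetric])
  finally show ?thesis .
qed

text \<open>Weierstrass test on small closed discs: there \<open>x\<close> stays below some \<rho> <
  1, and the other parameter functions are bounded by compactness.\<close>

lemma psi_series_holomorphic:
  assumes U: "open U"
    and hol: "b holomorphic_on U" "c holomorphic_on U" "d holomorphic_on U" "e holomorphic_on U"
      "x holomorphic_on U" "y holomorphic_on U"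
    and x: "\<And>t. t \<in> U \<Longrightarrow> norm (x t) < 1"
  shows "(\<lambda>t. \<Sum>k. psi_term (b t) (c t) (d t) (e t) (x t) (y t) k) holomorphic_on U"
proof (rule holomorphic_uniform_sequence[OF U])
  show "(\<lambda>t. \<Sum>k<n. psi_term (b t) (c t) (d t) (e t) (x t) (y t) k) holomorphic_on U" for n
    unfolding psi_term_def psi_prod_def qpoch_def
    by (intro holomorphic_intros hol) (use q_power_Suc_neq_1 in auto)
next
  fix t assume t: "t \<in> U"
  obtain \<rho> where \<rho>: "norm (x t) < \<rho>" "\<rho> < 1" using dense x[OF t] by blast
  have "0 < \<rho>" using \<rho>(1) norm_ge_zero le_less_trans by blast
  have "open (U \<inter> x -` ball 0 \<rho>)"
    by (intro continuous_open_preimage holomorphic_on_imp_continuous_on hol U open_ball)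
  moreover have "t \<in> U \<inter> x -` ball 0 \<rho>" using t \<rho> by simp
  ultimately obtain r where r: "r > 0" "cball t r \<subseteq> U \<inter> x -` ball 0 \<rho>"
    using open_contains_cball by blast
  have bd: "\<exists>M\<ge>0. \<forall>s\<in>cball t r. norm (f s) \<le> M" if "f holomorphic_on U" for f :: "complex \<Rightarrow> complex"
  proof -
    have "continuous_on (cball t r) f"
      using that r(2) by (meson continuous_on_subset holomorphic_on_imp_continuous_on le_inf_iff)
    hence "bounded (f ` cball t r)"
      by (intro compact_imp_bounded compact_continuous_image) auto
    then obtain M where "M > 0" "\<forall>s\<in>cball t r. norm (f s) \<le> M"
      by (auto simp: bounded_pos)
    thus ?thesis by (intro exI[of _ M]) auto
  qed
  obtain M1 where M1: "M1 \<ge> 0" "\<And>s. s \<in> cball t r \<Longrightarrow> norm (b s) \<le> M1"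
    using bd[OF hol(1)] by blast
  obtain M2 where M2: "M2 \<ge> 0" "\<And>s. s \<in> cball t r \<Longrightarrow> norm (c s) \<le> M2"
    using bd[OF hol(2)] by blast
  obtain M3 where M3: "M3 \<ge> 0" "\<And>s. s \<in> cball t r \<Longrightarrow> norm (d s) \<le> M3"
    using bd[OF hol(3)] by blast
  obtain M4 where M4: "M4 \<ge> 0" "\<And>s. s \<in> cball t r \<Longrightarrow> norm (e s) \<le> M4"
    using bd[OF hol(4)] by blast
  obtain M5 where M5: "M5 \<ge> 0" "\<And>s. s \<in> cball t r \<Longrightarrow> norm (y s) \<le> M5"
    using bd[OF hol(6)] by blast
  note M = M1(1) M2(1) M3(1) M4(1) M5(1) M1(2) M2(2) M3(2) M4(2) M5(2)
  define M where "M = M1 + M2 + M3 + M4 + M5"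
  have "0 \<le> M" using M(1-5) by (simp add: M_def)
  from psi_term_bound[OF \<open>0 < \<rho>\<close> this] obtain K where
    K: "\<And>b c d e x y k. norm x \<le> \<rho> \<Longrightarrow> norm y \<le> M \<Longrightarrow> norm b \<le> M \<Longrightarrow> norm c \<le> M \<Longrightarrow>
    norm d \<le> M \<Longrightarrow> norm e \<le> M \<Longrightarrow> norm (psi_term b c d e x y k) \<le> K * \<rho> ^ k" by blast
  have "uniform_limit (cball t r)
    (\<lambda>n t. \<Sum>k<n. psi_term (b t) (c t) (d t) (e t) (x t) (y t) k)
    (\<lambda>t. \<Sum>k. psi_term (b t) (c t) (d t) (e t) (x t) (y t) k) sequentially"
  proof (rule Weierstrass_m_test)
    fix k s assume s: "s \<in> cball t r"
    have "norm (x s) \<le> \<rho>" using r(2) s by auto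
    thus "norm (psi_term (b s) (c s) (d s) (e s) (x s) (y s) k) \<le> K * \<rho> ^ k"
      using M(1-5) M(6-10)[OF s] by (intro K) (simp_all add: M_def)
  next
    show "summable (\<lambda>k. K * \<rho> ^ k)"
      using \<rho> \<open>0 < \<rho>\<close> by (intro summable_mult summable_geometric) auto
  qed
  thus "\<exists>r>0. cball t r \<subseteq> U \<and> uniform_limit (cball t r)
    (\<lambda>n t. \<Sum>k<n. psi_term (b t) (c t) (d t) (e t) (x t) (y t) k)
    (\<lambda>t. \<Sum>k. psi_term (b t) (c t) (d t) (e t) (x t) (y t) k) sequentially"
    using r by blast
qed

lemma psi_ext_holomorphic:
  assumes "open U"
    and hol: "b holomorphic_on U" "c holomorphic_on U" "d holomorphic_on U" "e holomorphic_on U"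
    and "x holomorphic_on U" "y holomorphic_on U" "\<And>t. t \<in> U \<Longrightarrow> norm (x t) * norm q ^ n < 1"
  shows "(\<lambda>t. psi_ext n (b t) (c t) (d t) (e t) (x t) (y t)) holomorphic_on U"
  using assms(6-)
proof (induction n arbitrary: x y)
  case 0
  thus ?case using psi_series_holomorphic[OF assms(1) hol, of x y]
    by (auto intro!: holomorphic_intros)
next
  case (Suc n)
  have H: "(\<lambda>t. psi_ext n (b t) (c t) (d t) (e t) (x t * q ^ i) (y t * q ^ i)) holomorphic_on U"
    if "i \<in> {1,2,3}" for i
    using norm_shift_less[OF Suc.prems(3) that] Suc.prems(1,2)
    by (intro Suc.IH holomorphic_intros) auto
  have H1: "(\<lambda>t. psi_ext n (b t) (c t) (d t) (e t) (x t * q) (y t * q)) holomorphic_on U"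
    using H[of 1] by simp
  show ?case unfolding psi_ext.simps psi_step_def
    by (intro holomorphic_intros hol Suc.prems H H1) auto
qed

text \<open>On \<open>V n\<close> the function is the n-th extension; these open sets exhaust
  \<open>U\<close> because |q|^n tends to 0.\<close>

lemma psi_holomorphic [holomorphic_intros]:
  assumes "open U"
    and hol: "b holomorphic_on U" "c holomorphic_on U" "d holomorphic_on U" "e holomorphic_on U"
      "x holomorphic_on U" "y holomorphic_on U"
  shows "(\<lambda>t. psi (b t) (c t) (d t) (e t) (x t) (y t)) holomorphic_on U"
proof -
  define V where "V n = U \<inter> x -` ball 0 (1 / norm q ^ n)" for n
  have V: "norm (x t) * norm q ^ n < 1" if "t \<in> V n" for t n
    using that q_pos by (simp add: V_def field_simps)
  have op: "open (V n)" for n unfolding V_def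
    by (intro continuous_open_preimage holomorphic_on_imp_continuous_on assms open_ball)
  have "(\<lambda>t. psi (b t) (c t) (d t) (e t) (x t) (y t)) holomorphic_on V n" for n
  proof -
    have "(\<lambda>t. psi_ext n (b t) (c t) (d t) (e t) (x t) (y t)) holomorphic_on V n"
      by (intro psi_ext_holomorphic op V hol[THEN holomorphic_on_subset]) (auto simp: V_def)
    thus ?thesis
      by (rule holomorphic_transform) (simp add: psi_eq_psi_ext[OF V])
  qed
  hence "(\<lambda>t. psi (b t) (c t) (d t) (e t) (x t) (y t)) holomorphic_on (\<Union>n. V n)"
    by (intro holomorphic_on_UN_open op)
  also have "(\<Union>n. V n) = U"
    using ex_norm_mult_q_power_less_1 q_pos by (auto simp: V_def field_simps)
  finally show ?thesis .
qed

end

text \<open>Split s into the constant L and s - L. The constant contributes exactly L by the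
  geometric series; of the rest, the first \<open>N\<close> terms are made small by the factor 1 - t
  and the tail contributes at most half of \<epsilon>.\<close>

lemma abel_summation_tendsto:
  fixes s :: "nat \<Rightarrow> complex"
  assumes s: "s \<longlonglongrightarrow> L"
  shows "((\<lambda>t::real. (1 - of_real t) * (\<Sum>k. of_real t ^ k * s k)) \<longlongrightarrow> L) (at_left 1)"
proof (rule tendstoI)
  fix \<epsilon> :: real assume \<epsilon>: "\<epsilon> > 0"
  from s have "(\<lambda>k. norm (s k - L)) \<longlonglongrightarrow> 0"
    by (simp add: LIM_zero tendsto_norm_zero)
  then obtain N where N: "\<And>k. k \<ge> N \<Longrightarrow> norm (s k - L) < \<epsilon> / 2"
    using order_tendstoD(2)[of _ 0 sequentially "\<epsilon> / 2"] \<epsilon>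
    by (auto simp: eventually_sequentially)
  define C where "C = (\<Sum>k<N. norm (s k - L))"
  have C: "C \<ge> 0" unfolding C_def by (intro sum_nonneg) auto
  have "\<forall>\<^sub>F t in at_left (1::real). t > max 0 (1 - \<epsilon> / (2 * C + 2)) \<and> t < 1"
    using eventually_at_left_real[of "max 0 (1 - \<epsilon> / (2 * C + 2))" 1] \<epsilon> C by (simp add: field_simps)
  thus "\<forall>\<^sub>F t in at_left (1::real). dist ((1 - of_real t) * (\<Sum>k. of_real t ^ k * s k)) L < \<epsilon>"
  proof eventually_elim
    fix t :: real assume t: "t > max 0 (1 - \<epsilon> / (2 * C + 2)) \<and> t < 1"
    define r where "r k = of_real t ^ k * (s k - L)" for k
    have geo: "(\<lambda>k. t ^ k) sums (1 / (1 - t))" using t by (intro geometric_sums) auto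
    define B where "B k = (if k < N then norm (s k - L) else 0) + \<epsilon> / 2 * t ^ k" for k
    have "(\<lambda>k. if k < N then norm (s k - L) else 0) sums C"
      using sums_If_finite[of "\<lambda>k. k < N" "\<lambda>k. norm (s k - L)"] by (simp add: C_def lessThan_def)
    hence B: "B sums (C + \<epsilon> / 2 * (1 / (1 - t)))"
      unfolding B_def by (intro sums_add sums_mult geo)
    have rB: "norm (r k) \<le> B k" for k
    proof (cases "k < N")
      case True
      have "t ^ k \<le> 1" using t by (intro power_le_one) auto
      hence "norm (r k) \<le> norm (s k - L)"
        using t by (simp add: r_def norm_mult norm_power mult_left_le_one_le)
      thus ?thesis using True \<epsilon> t by (simp add: B_def add_increasing2)
    next
      case False
      have "norm (r k) = t ^ k * norm (s k - L)" using t by (simp add: r_def norm_mult norm_power)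
      also have "\<dots> \<le> t ^ k * (\<epsilon> / 2)" using N[of k] False t by (intro mult_left_mono) auto
      finally show ?thesis using False by (simp add: B_def mult_ac)
    qed
    have sr: "summable r"
      using B rB by (intro summable_comparison_test[of r B] exI[of _ 0]) (auto simp: sums_iff)
    have "norm (\<Sum>k. r k) \<le> C + \<epsilon> / 2 * (1 / (1 - t))"
      using norm_suminf_le[of r B, OF rB] B by (simp add: sums_iff)
    hence le: "(1 - t) * norm (\<Sum>k. r k) \<le> (1 - t) * C + \<epsilon> / 2"
      using t by (simp add: field_simps)
    have gL: "(\<lambda>k. of_real t ^ k * L) sums (1 / (1 - of_real t) * L)"
      using t by (intro sums_mult2 geometric_sums) simp
    have "(\<lambda>k. r k + of_real t ^ k * L) sums ((\<Sum>k. r k) + 1 / (1 - of_real t) * L)"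
      by (intro sums_add gL summable_sums sr)
    also have "(\<lambda>k. r k + of_real t ^ k * L) = (\<lambda>k. of_real t ^ k * s k)"
      by (simp add: r_def algebra_simps)
    finally have "(\<Sum>k. of_real t ^ k * s k) = (\<Sum>k. r k) + 1 / (1 - of_real t) * L"
      by (simp add: sums_iff)
    moreover have "(1 - of_real t :: complex) \<noteq> 0" using t by auto
    ultimately have "(1 - of_real t) * (\<Sum>k. of_real t ^ k * s k) - L = of_real (1 - t) * (\<Sum>k. r k)"
      by (simp add: field_simps)
    hence "dist ((1 - of_real t) * (\<Sum>k. of_real t ^ k * s k)) L = (1 - t) * norm (\<Sum>k. r k)"
      using t by (simp only: dist_norm norm_mult norm_of_real) auto
    also note le
    also have "(1 - t) * C < \<epsilon> / 2"
    proof -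
      have "(1 - t) * C \<le> (1 - t) * (C + 1)" using t C by (intro mult_left_mono) auto
      also have "1 - t < \<epsilon> / (2 * C + 2)" using t by auto
      hence "(1 - t) * (C + 1) < \<epsilon> / (2 * C + 2) * (C + 1)" using C by (intro mult_strict_right_mono) auto
      also have "\<dots> = \<epsilon> / 2" using C by (simp add: field_simps)
      finally show ?thesis .
    qed
    finally show "dist ((1 - of_real t) * (\<Sum>k. of_real t ^ k * s k)) L < \<epsilon>" by simp
  qed
qed

context q_base
begin

section \<open>Special values of the entire function and its relation to the continued
  series\<close>

lemma norm_less_1_not_pole:
  assumes "norm u < 1"
  shows "u \<notin> q_poles q"
proof
  assume "u \<in> q_poles q"
  then obtain k where "u * q ^ k = 1" by (auto simp: q_poles_def)
  hence "norm u * norm q ^ k = 1" by (metis norm_mult norm_one norm_power)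
  moreover have "norm u * norm q ^ k \<le> norm u"
    using q_less by (intro mult_left_le power_le_one) auto
  ultimately show False using assms by simp
qed

lemma norm_mult_less_1:
  fixes t x :: complex
  assumes "norm t < 1 / (norm x + 1)"
  shows "norm (t * x) < 1"
proof -
  have "norm t * (norm x + 1) < 1" using assms by (simp add: field_simps add_pos_nonneg)
  moreover have "norm (t * x) \<le> norm t * (norm x + 1)"
    unfolding norm_mult by (intro mult_left_mono) auto
  ultimately show ?thesis by simp
qed

text \<open>Multiplying both coordinates by t keeps a = y/x. For small t the series is available,
  and the identity theorem in t reaches t = 1.\<close>

lemma psi_eqI:
  assumes h: "h holomorphic_on UNIV"
    and eq: "\<And>t. norm (t * x) < 1 \<Longrightarrow> psi b c d e (t * x) (t * y) = h t"
  shows "psi b c d e x y = h 1"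
proof -
  have "(\<lambda>t. psi b c d e (t * x) (t * y)) holomorphic_on UNIV"
    by (intro holomorphic_intros) auto
  hence "psi b c d e (t * x) (t * y) = h t" for t
    by (rule entire_eqI[OF _ h, of _ "1 / (norm x + 1)"])
       (use norm_mult_less_1 eq in \<open>auto simp: add_nonneg_pos\<close>)
  from this[of 1] show ?thesis by simp
qed

lemma psi_series_terminating:
  assumes "norm x < 1" "\<And>k. psi_term b c d e x y (Suc k) = 0"
  shows "psi b c d e x y = qinf x * (qinf d * qinf e)"
proof -
  have "(\<Sum>k. psi_term b c d e x y k) = (\<Sum>k\<in>{0}. psi_term b c d e x y k)"
    by (rule suminf_finite) (use assms(2) gr0_conv_Suc in auto)
  also have "\<dots> = qinf d * qinf e" by (simp add: psi_term_def psi_prod_def qpoch_def)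
  finally show ?thesis using psi_eq_series[OF assms(1)] by simp
qed

text \<open>This is the case a = 1, in which the factor x - y q^0 removes all terms but the
  first.\<close>

lemma psi_same: "psi b c d e x x = qinf x * (qinf d * qinf e)"
proof -
  have "psi b c d e x x = (\<lambda>t. qinf (t * x) * (qinf d * qinf e)) 1"
  proof (rule psi_eqI)
    fix t assume "norm (t * x) < 1"
    thus "psi b c d e (t * x) (t * x) = qinf (t * x) * (qinf d * qinf e)"
      by (rule psi_series_terminating) (simp add: psi_term_def psi_prod_def prod.lessThan_Suc_shift del: prod.lessThan_Suc)
  qed (intro holomorphic_intros)
  thus ?thesis by simp
qed

lemma psi_1_left: "psi 1 c d e x y = qinf x * (qinf d * qinf e)"
proof -
  have "psi 1 c d e x y = (\<lambda>t. qinf (t * x) * (qinf d * qinf e)) 1"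
  proof (rule psi_eqI)
    fix t assume "norm (t * x) < 1"
    thus "psi 1 c d e (t * x) (t * y) = qinf (t * x) * (qinf d * qinf e)"
      by (rule psi_series_terminating) (simp add: psi_term_def qpoch_def prod.lessThan_Suc_shift del: prod.lessThan_Suc)
  qed (intro holomorphic_intros)
  thus ?thesis by simp
qed

lemma psi_commute: "psi b c d e x y = psi c b d e x y"
proof -
  have "psi_ext n b c d e = psi_ext n c b d e" for n
  proof (induction n)
    case 0
    show ?case by (simp add: psi_term_def mult_ac)
  next
    case (Suc n)
    thus ?case by (simp add: psi_step_def fun_eq_iff add_ac mult_ac)
  qed
  thus ?thesis by (simp add: psi_def)
qed

lemma psi_prod_1: "psi_prod 1 y k = qpoch q y k"
  by (simp add: psi_prod_def qpoch_def)

text \<open>The argument \<open>1\<close> is the first pole of \<open>\<phi>\<close>; the value of \<open>psi\<close> there is its residue up to a factor,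
  found as the limit of the coefficients by Abelian summation.\<close>

lemma psi_at_1: "psi b c d e 1 y = qinf y * qinf b * qinf c"
proof -
  define s where "s = psi_term b c d e 1 y"
  define L where "L = qinf y * qinf b * qinf c * 1 * 1 / qinf q"
  have s: "s \<longlonglongrightarrow> L"
    unfolding s_def L_def psi_term_def psi_prod_1
    by (intro tendsto_intros qpoch_tendsto qinf_mult_q_power_tendsto_1 qinf_q_nonzero)
  define f where "f = (\<lambda>t. psi b c d e t (t * y))"
  have "isCont f 1"
  proof -
    have "f holomorphic_on UNIV" unfolding f_def by (intro holomorphic_intros) auto
    thus ?thesis
      using holomorphic_on_imp_continuous_on continuous_on_eq_continuous_at by blast
  qed
  moreover have "((\<lambda>t::real. complex_of_real t) \<longlongrightarrow> of_real 1) (at_left 1)"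
    by (intro tendsto_intros)
  ultimately have lim1: "((\<lambda>t::real. f (of_real t)) \<longlongrightarrow> f 1) (at_left 1)"
    using isCont_tendsto_compose[of 1 f] by simp
  have "isCont (\<lambda>t::real. qinf (of_real t * q)) 1"
    by (intro isCont_o2[OF _ isCont_qinf] continuous_intros)
  hence "((\<lambda>t::real. qinf (of_real t * q)) \<longlongrightarrow> qinf (of_real 1 * q)) (at_left 1)"
    by (simp add: isCont_def filterlim_at_split)
  hence lim2: "((\<lambda>t::real. qinf (of_real t * q) * ((1 - of_real t) * (\<Sum>k. of_real t ^ k * s k)))
      \<longlongrightarrow> qinf (of_real 1 * q) * L) (at_left 1)"
    by (intro tendsto_mult abel_summation_tendsto s)
  have "\<forall>\<^sub>F t in at_left (1::real). t > 0 \<and> t < 1"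
    using eventually_at_left_real[of 0 1] by simp
  hence "\<forall>\<^sub>F t in at_left (1::real). f (of_real t) =
      qinf (of_real t * q) * ((1 - of_real t) * (\<Sum>k. of_real t ^ k * s k))"
  proof eventually_elim
    fix t :: real assume t: "t > 0 \<and> t < 1"
    have "psi_term b c d e (of_real t) (of_real t * y) = (\<lambda>k. of_real t ^ k * s k)"
      using psi_term_scale[of b c d e 1 "of_real t" y] by (simp add: s_def mult.commute fun_eq_iff)
    hence "f (of_real t) = qinf (of_real t) * (\<Sum>k. of_real t ^ k * s k)"
      unfolding f_def using t by (subst psi_eq_series) (simp_all only: norm_of_real abs_of_pos)
    also have "qinf (of_real t) = qinf (of_real t * q) * (1 - of_real t)"
      using qinf_step[of "of_real t"] by (simp only: mult.commute)
    finally show "f (of_real t) =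
      qinf (of_real t * q) * ((1 - of_real t) * (\<Sum>k. of_real t ^ k * s k))" by (simp only: mult.assoc)
  qed
  from Lim_transform_eventually[OF lim1 this] lim2 have "f 1 = qinf (of_real 1 * q) * L"
    by (intro tendsto_unique[of "at_left (1::real)"]) auto
  thus ?thesis by (simp add: f_def L_def)
qed

text \<open>The q-binomial theorem. With the other parameters 0 the third-order equation collapses
  to a first-order one, whose iteration ends at x = y = 0 with the value 1.\<close>

lemma psi_confluent: "psi 0 0 0 0 x y = qinf y"
proof -
  define f where "f = (\<lambda>t. psi 0 0 0 0 (t * x) (t * y))"
  have step: "psi 0 0 0 0 x y = (1 - y) * psi 0 0 0 0 (x * q) (y * q)" for x y
    using psi_rec[of 0 0 0 0 x y] by (simp add: psi_step_def)
  have it: "f 1 = qpoch q y n * f (q ^ n)" for n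
  proof (induction n)
    case (Suc n)
    have "f (q ^ n) = (1 - y * q ^ n) * f (q ^ Suc n)"
      unfolding f_def using step[of "q ^ n * x" "q ^ n * y"] by (simp add: mult_ac)
    with Suc show ?case by (simp only: qpoch_Suc mult.assoc)
  qed (simp add: qpoch_def)
  have "isCont f 0"
  proof -
    have "f holomorphic_on UNIV" unfolding f_def by (intro holomorphic_intros) auto
    thus ?thesis
      using holomorphic_on_imp_continuous_on continuous_on_eq_continuous_at by blast
  qed
  hence "(\<lambda>n. f (q ^ n)) \<longlonglongrightarrow> f 0"
    using isCont_tendsto_compose q_power_tendsto_0 by blast
  moreover have "f 0 = 1" by (simp add: f_def psi_same)
  ultimately have "(\<lambda>n. qpoch q y n * f (q ^ n)) \<longlonglongrightarrow> qinf y * 1"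
    by (intro tendsto_mult qpoch_tendsto) simp
  hence "(\<lambda>n::nat. f 1) \<longlonglongrightarrow> qinf y * 1"
    by (simp only: it[symmetric])
  hence "f 1 = qinf y" by (simp add: LIMSEQ_const_iff)
  thus ?thesis by (simp add: f_def)
qed

text \<open>The right-hand side is holomorphic off the poles, so by uniqueness of the continuation
  only power series inside the unit disc have to be compared.\<close>

lemma phi32_eq_psi:
  assumes "d \<notin> q_poles q" "e \<notin> q_poles q" "w \<notin> q_poles q"
  shows "phi32 q a b c d e w = psi b c d e w (a * w) / (qinf d * qinf e * qinf w)"
proof (rule phi32_unique[where f = "\<lambda>w. psi b c d e w (a * w) / (qinf d * qinf e * qinf w)"])
  have de: "qinf d \<noteq> 0" "qinf e \<noteq> 0" using assms by (simp_all add: qinf_eq_0_iff)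
  have "(\<lambda>w. psi b c d e w (a * w)) holomorphic_on UNIV"
    by (intro holomorphic_intros) auto
  hence "(\<lambda>w. psi b c d e w (a * w)) holomorphic_on (- q_poles q)"
    by (rule holomorphic_on_subset) auto
  thus "(\<lambda>w. psi b c d e w (a * w) / (qinf d * qinf e * qinf w)) holomorphic_on - q_poles q"
    using de by (intro holomorphic_on_divide holomorphic_on_mult holomorphic_on_const qinf_holomorphic
      holomorphic_on_ident) (auto simp: qinf_eq_0_iff)
  fix u :: complex assume u: "norm u < 1"
  have "psi_term b c d e u (a * u) k = qinf d * qinf e * (phi32_coeff q a b c d e k * u ^ k)" for k
  proof -
    have "psi_prod u (a * u) k = u ^ k * qpoch q a k"
      using psi_prod_scale[of 1 u a k] by (simp add: psi_prod_1)
    moreover have "qpoch q d k \<noteq> 0" "qpoch q e k \<noteq> 0"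
      using de qinf_eq_qpoch[of d k] qinf_eq_qpoch[of e k] by auto
    ultimately show ?thesis
      unfolding psi_term_def phi32_coeff_def qinf_eq_qpoch[of d k] qinf_eq_qpoch[of e k]
      by (simp add: divide_simps)
  qed
  hence "(\<Sum>k. psi_term b c d e u (a * u) k) = (\<Sum>k. qinf d * qinf e * (phi32_coeff q a b c d e k * u ^ k))"
    by simp
  also have "\<dots> = qinf d * qinf e * phi32_series q a b c d e u"
    unfolding phi32_series_def using assms q_pos q_less u
    by (intro suminf_mult phi32_summable) auto
  finally have "psi b c d e u (a * u) = qinf u * (qinf d * qinf e * phi32_series q a b c d e u)"
    using psi_eq_series[OF u] by simp
  moreover have "qinf u \<noteq> 0"
    using norm_less_1_not_pole[OF u] by (simp add: qinf_eq_0_iff)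
  ultimately show "psi b c d e u (a * u) / (qinf d * qinf e * qinf u) = phi32_series q a b c d e u"
    using de by simp
qed (use assms q_pos q_less in auto)


subsection \<open>Contiguous relations\<close>

lemma psi_prod_tendsto_0:
  assumes "norm x < 1"
  shows "psi_prod x y \<longlonglongrightarrow> 0"
proof -
  obtain \<rho> where \<rho>: "norm x < \<rho>" "\<rho> < 1" using dense assms by blast
  have "0 < \<rho>" using \<rho>(1) norm_ge_zero le_less_trans by blast
  have "(\<lambda>k. exp (norm y / \<rho> / (1 - norm q)) * \<rho> ^ k) \<longlonglongrightarrow> exp (norm y / \<rho> / (1 - norm q)) * 0"
    using \<rho> \<open>0 < \<rho>\<close> by (intro tendsto_intros LIMSEQ_power_zero) auto
  hence "(\<lambda>k. exp (norm y / \<rho> / (1 - norm q)) * \<rho> ^ k) \<longlonglongrightarrow> 0" by (simp only: mult_zero_right)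
  moreover have "norm (psi_prod x y k) \<le> exp (norm y / \<rho> / (1 - norm q)) * \<rho> ^ k" for k
    using \<rho> \<open>0 < \<rho>\<close> by (intro norm_psi_prod_le) auto
  ultimately show ?thesis
    by (rule Lim_null_comparison[OF always_eventually, OF allI, rotated])
qed

lemma qinf_Suc: "qinf (a * q ^ n) = (1 - a * q ^ n) * qinf (a * q ^ Suc n)"
  using qinf_step[of "a * q ^ n"] by (simp only: mult.assoc power_Suc2)

lemma psi_prod_Suc_left: "psi_prod x y (Suc k) = (x - y) * psi_prod x (y * q) k"
  by (simp add: psi_prod_def prod.lessThan_Suc_shift mult_ac del: prod.lessThan_Suc)

lemma telescoping_sums_0:
  fixes G :: "nat \<Rightarrow> complex"
  assumes "G \<longlonglongrightarrow> 0" "G 0 = 0"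
  shows "(\<lambda>k. G (Suc k) - G k) sums 0"
  using telescope_sums[OF assms(1)] assms(2) by simp

text \<open>The termwise identity for \<open>psi_x_relation_series\<close>, with N = q^n. The two
  sides differ by a multiple of d e - b c q Y, which vanishes precisely when the argument is
  de/(abc), since here a times the argument is q Y.\<close>

lemma psi_x_relation_aux:
  fixes X Y N b c d e :: complex
  assumes Y: "Y \<noteq> 0" and de: "d * e = b * c * q * Y"
  shows "- (1 / Y) * (1 - X) * (X - Y * (q * N)) * (X - Y * N)
    - ((b + c) * X^2 / Y - X * (1 + 1/Y + (d + e) / (q * Y)) + (1 + q) / q) * (q * N) * (X - Y * N)
    + (1 - d * X / Y) * (1 - e * X / Y) / q * (q * N^2 * (q * X - Y)) =
    ((1 - b * (q * N)) * (1 - c * (q * N)) * (X - Y * N) - (1 - q * N) * (1 - d * N) * (1 - e * N)) * X^2 / Y"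
    (is "?L = ?R")
proof -
  have "?L - ?R = q * N^2 * X^2 * (X / Y - N) * (d * e - b * c * q * Y) / Y"
    using Y by (simp add: field_simps power2_eq_square)
  thus ?thesis using de by simp
qed

text \<open>With y = Y q fixed, the step from x to x q divides a by q: this is the shift from n to n
  - 1 in \<open>X2\<close>, ..., \<open>X5\<close>. The corresponding combination of k-th terms is a
  difference G(k+1) - G(k).\<close>

lemma psi_x_relation_series:
  assumes X: "norm X < 1" and Y: "Y \<noteq> 0" and de: "d * e = b * c * q * Y"
  shows "(1 - X / Y) * psi b c d e X (Y * q)
    - ((b + c) * X^2 / Y - X * (1 + 1/Y + (d + e) / (q * Y)) + (1 + q) / q) * psi b c d e (X * q) (Y * q)
    + (1 - X * q) * (1 - d * X / Y) * (1 - e * X / Y) / q * psi b c d e (X * q^2) (Y * q) = 0"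
proof -
  define cc where "cc m = qpoch q b m * qpoch q c m * qinf (d * q ^ m) * qinf (e * q ^ m) / qpoch q q m" for m
  define p where "p = psi_prod X Y"
  define T where "T = (b + c) * X^2 / Y - X * (1 + 1/Y + (d + e) / (q * Y)) + (1 + q) / q"
  define U where "U = (1 - d * X / Y) * (1 - e * X / Y) / q"
  define t0 where "t0 = psi_term b c d e X (Y * q)"
  define t1 where "t1 = psi_term b c d e (X * q) (Y * q)"
  define t2 where "t2 = psi_term b c d e (X * q^2) (Y * q)"
  \<comment> \<open>The telescoping certificate. Its index is shifted by one so that
    \<open>G 0 = 0\<close>, and with \<open>G\<close> tending to 0 the differences sum to 0.\<close>
  define G where "G m = (case m of 0 \<Rightarrow> 0 | Suc n \<Rightarrow>
    cc n * p n * (1 - b * q ^ n) * (1 - c * q ^ n) * X^2 / Y)" for m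
  have cc_Suc: "cc (Suc n) * ((1 - q ^ Suc n) * (1 - d * q ^ n) * (1 - e * q ^ n)) =
     cc n * ((1 - b * q ^ n) * (1 - c * q ^ n))" for n
  proof -
    have 2: "qpoch q q (Suc n) = qpoch q q n * (1 - q ^ Suc n)" by (simp add: qpoch_Suc)
    show ?thesis
      unfolding cc_def qinf_Suc[of d n] qinf_Suc[of e n] 2 qpoch_Suc[of b] qpoch_Suc[of c]
      using q_power_Suc_neq_1[of n] by (simp add: divide_simps)
  qed
  have nX: "norm (X * q ^ i) < 1" for i
  proof -
    have "norm q ^ i \<le> 1" using q_less by (intro power_le_one) auto
    hence "norm (X * q ^ i) \<le> norm X" by (simp add: norm_mult norm_power mult_left_le)
    thus ?thesis using X by simp
  qed
  have S: "t0 sums (\<Sum>k. t0 k)" "t1 sums (\<Sum>k. t1 k)" "t2 sums (\<Sum>k. t2 k)"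
    unfolding t0_def t1_def t2_def using nX[of 0] nX[of 1] nX[of 2]
    by (auto intro!: summable_sums psi_term_summable)
  have "G \<longlonglongrightarrow> 0"
  proof (rule LIMSEQ_imp_Suc)
    have "(\<lambda>n. cc n * p n * (1 - b * q ^ n) * (1 - c * q ^ n) * X^2 / Y) \<longlonglongrightarrow>
       (qinf b * qinf c * 1 * 1 / qinf q) * 0 * (1 - 0) * (1 - 0) * X^2 / Y"
      unfolding cc_def p_def
      by (intro tendsto_intros qpoch_tendsto qinf_mult_q_power_tendsto_1 qinf_q_nonzero Y
        psi_prod_tendsto_0 X mult_q_power_tendsto_0)
    thus "(\<lambda>n. G (Suc n)) \<longlonglongrightarrow> 0" by (simp add: G_def)
  qed
  hence GS: "(\<lambda>k. G (Suc k) - G k) sums 0" by (rule telescoping_sums_0) (simp add: G_def)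
  \<comment> \<open>The factor 1 - X/Y = \<kappa> (X - Y) turns the product for y = Y q into the one
    for y = Y with one more factor, so that all terms are expressed through
    \<open>p\<close>.\<close>
  define \<kappa> where "\<kappa> = - (1 / Y)"
  have tt: "(1 - X / Y) * t0 m = \<kappa> * (cc m * (p m * (X - Y * q ^ m)))"
     "t1 m = q ^ m * (cc m * p m)" for m
  proof -
    have "(X - Y) * psi_prod X (Y * q) m = p m * (X - Y * q ^ m)"
      using psi_prod_Suc_left[of X Y m] by (simp add: p_def psi_prod_Suc)
    moreover have "(1 - X / Y) = \<kappa> * (X - Y)" using Y by (simp add: \<kappa>_def field_simps)
    ultimately show "(1 - X / Y) * t0 m = \<kappa> * (cc m * (p m * (X - Y * q ^ m)))"
      by (simp add: t0_def psi_term_def cc_def mult_ac)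
    show "t1 m = q ^ m * (cc m * p m)"
      unfolding t1_def psi_term_scale by (simp add: psi_term_def cc_def p_def)
  qed
  have t2_Suc: "t2 (Suc n) = cc (Suc n) * (q * (q ^ n)^2 * (q * X - Y) * p n)" for n
  proof -
    have "psi_prod (X * q^2) (Y * q) (Suc n) = q ^ Suc n * psi_prod (X * q) Y (Suc n)"
      using psi_prod_scale[of "X * q" q Y "Suc n"] by (simp add: power2_eq_square mult.assoc)
    also have "psi_prod (X * q) Y (Suc n) = (q * X - Y) * (q ^ n * p n)"
      unfolding psi_prod_Suc_left p_def psi_prod_scale by (simp add: mult.commute)
    finally show ?thesis
      by (simp add: t2_def psi_term_def cc_def power2_eq_square mult_ac)
  qed
  have "(1 - X) * ((1 - X / Y) * t0 m) - T * t1 m + U * t2 m = G (Suc m) - G m" for m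
  proof (cases m)
    case 0
    have "- (1 / Y) * (1 - X) * (X - Y) - T + U = (1 - b) * (1 - c) * X^2 / Y
        + (d * e - b * c * q * Y) * X^2 / (q * Y^2)"
      using Y unfolding T_def U_def by (simp add: field_simps power2_eq_square)
    hence *: "\<kappa> * (1 - X) * (X - Y) - T + U = (1 - b) * (1 - c) * X^2 / Y"
      using de by (simp add: \<kappa>_def)
    have "t2 0 = cc 0" "p 0 = 1" by (simp_all add: t2_def psi_term_def cc_def psi_prod_def p_def)
    hence "(1 - X) * ((1 - X / Y) * t0 0) - T * t1 0 + U * t2 0 =
        cc 0 * (\<kappa> * (1 - X) * (X - Y) - T + U)"
      unfolding tt by (simp add: algebra_simps)
    thus ?thesis unfolding * by (simp add: 0 G_def \<open>p 0 = 1\<close>)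
  next
    case (Suc n)
    have p_Suc: "p (Suc n) = p n * (X - Y * q ^ n)" by (simp add: p_def psi_prod_Suc)
    have "(1 - X) * ((1 - X / Y) * t0 m) - T * t1 m + U * t2 m =
       cc m * p n * (\<kappa> * (1 - X) * (X - Y * (q * q ^ n)) * (X - Y * q ^ n)
        - T * (q * q ^ n) * (X - Y * q ^ n) + U * (q * (q ^ n)^2 * (q * X - Y)))"
      unfolding tt Suc t2_Suc p_Suc by (simp add: algebra_simps)
    also have "\<dots> = cc m * p n * (((1 - b * (q * q ^ n)) * (1 - c * (q * q ^ n)) * (X - Y * q ^ n)
         - (1 - q * q ^ n) * (1 - d * q ^ n) * (1 - e * q ^ n)) * X^2 / Y)"
      unfolding T_def U_def \<kappa>_def psi_x_relation_aux[OF Y de] ..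
    also have "\<dots> = G (Suc m) - cc m * ((1 - q ^ Suc n) * (1 - d * q ^ n) * (1 - e * q ^ n)) * p n * X^2 / Y"
    proof -
      have "k * P * ((\<beta> * \<gamma> * w - \<delta>) * Z / Y) = k * (P * w) * \<beta> * \<gamma> * Z / Y - k * \<delta> * P * Z / Y"
        for k P \<beta> \<gamma> w \<delta> Z :: complex
        by (simp add: diff_divide_distrib algebra_simps)
      thus ?thesis by (simp only: G_def Suc p_Suc nat.case power_Suc)
    qed
    also have "cc m * ((1 - q ^ Suc n) * (1 - d * q ^ n) * (1 - e * q ^ n)) * p n * X^2 / Y = G m"
      unfolding Suc cc_Suc by (simp add: G_def mult_ac)
    finally show ?thesis .
  qed
  moreover have "(\<lambda>m. (1 - X) * ((1 - X / Y) * t0 m) - T * t1 m + U * t2 m) sums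
      ((1 - X) * ((1 - X / Y) * (\<Sum>k. t0 k)) - T * (\<Sum>k. t1 k) + U * (\<Sum>k. t2 k))"
    by (intro sums_add sums_diff sums_mult S)
  ultimately have "(1 - X) * ((1 - X / Y) * (\<Sum>k. t0 k)) - T * (\<Sum>k. t1 k) + U * (\<Sum>k. t2 k) = 0"
    using GS sums_unique2 by (metis (no_types, lifting) sums_cong)
  hence eq: "w * ((1 - X) * ((1 - X / Y) * (\<Sum>k. t0 k)) - T * (\<Sum>k. t1 k) + U * (\<Sum>k. t2 k)) = 0" for w
    by simp
  have Q: "qinf X = (1 - X) * qinf (X * q)" "qinf (X * q) = (1 - X * q) * qinf (X * q^2)"
    using qinf_step[of X] qinf_step[of "X * q"] by (simp_all only: power2_eq_square mult.assoc)
  have P: "psi b c d e X (Y * q) = qinf X * (\<Sum>k. t0 k)"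
     "psi b c d e (X * q) (Y * q) = qinf (X * q) * (\<Sum>k. t1 k)"
     "psi b c d e (X * q^2) (Y * q) = qinf (X * q^2) * (\<Sum>k. t2 k)"
    unfolding t0_def t1_def t2_def using nX[of 0] nX[of 1] nX[of 2]
    by (auto intro!: psi_eq_series)
  have "(1 - X / Y) * psi b c d e X (Y * q) - T * psi b c d e (X * q) (Y * q)
     + (1 - X * q) * (1 - d * X / Y) * (1 - e * X / Y) / q * psi b c d e (X * q^2) (Y * q) =
    qinf (X * q) * ((1 - X) * ((1 - X / Y) * (\<Sum>k. t0 k)) - T * (\<Sum>k. t1 k) + U * (\<Sum>k. t2 k))"
  proof -
    have "k * ((w * g) * S0) - T * (g * S1) + v * u1 * u2 / q * (h * S2) =
        g * (w * (k * S0) - T * S1 + u1 * u2 / q * S2)" if "g = v * h"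
      for k w g S0 S1 S2 v u1 u2 h :: complex
      unfolding that by (simp add: algebra_simps)
    from this[OF Q(2)] show ?thesis by (simp only: P Q(1) U_def)
  qed
  also have "\<dots> = 0" by (rule eq)
  finally show ?thesis unfolding T_def .
qed

lemma psi_x_relation:
  assumes Y: "Y \<noteq> 0" and de: "d * e = b * c * q * Y"
  shows "(1 - X / Y) * psi b c d e X (Y * q)
    - ((b + c) * X^2 / Y - X * (1 + 1/Y + (d + e) / (q * Y)) + (1 + q) / q) * psi b c d e (X * q) (Y * q)
    + (1 - X * q) * (1 - d * X / Y) * (1 - e * X / Y) / q * psi b c d e (X * q^2) (Y * q) = 0"
    (is "?f X = 0")
proof (rule entire_eqI[where f = ?f and g = "\<lambda>_. 0"])
  show "?f holomorphic_on UNIV"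
    by (intro holomorphic_intros) (use Y in auto)
  show "?f X = 0" if "norm X < 1" for X
    using psi_x_relation_series[OF that assms] .
qed auto


text \<open>The polynomial part, in Q = q^k, of the certificate that telescopes the relation
  shifting b, c, d, e.\<close>

definition bc_poly :: "complex \<Rightarrow> complex \<Rightarrow> complex \<Rightarrow> complex \<Rightarrow> complex \<Rightarrow> complex \<Rightarrow> complex" where
  "bc_poly \<beta> \<gamma> \<alpha> \<delta> x Q = q*\<beta>*\<gamma>*(x - \<alpha> - \<delta>) + \<beta> + \<gamma> - \<beta>*\<gamma>
     + (q*(\<beta>*\<gamma>)^2*(\<alpha> + \<delta>) + q^2*(\<beta>*\<gamma>)^2*\<alpha>*\<delta> - \<beta>*\<gamma> - q*\<beta>*\<gamma>*x*(\<beta> + \<gamma>)) * Q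
     + q*(\<beta>*\<gamma>)^2*(x - q*\<beta>*\<gamma>*\<alpha>*\<delta>) * Q^2"

text \<open>The case M = 1 of \<open>bc_poly_identity\<close> with the common factor (1 - \<beta>)(1
  - \<gamma>) cancelled. It is proved on its own because \<beta> = 1 or \<gamma> = 1 is
  allowed.\<close>

lemma bc_poly_identity_0:
  "q*\<beta>*\<gamma>*(\<alpha>*\<delta> - x*\<alpha> - x*\<delta> + x^2)*(1-q*\<beta>)*(1-q*\<gamma>)
    + (1-q*\<beta>*\<gamma>*\<delta>)*(1-q^2*\<beta>*\<gamma>*\<delta>)*(1-q*\<beta>*\<gamma>*\<alpha>)*(1-q^2*\<beta>*\<gamma>*\<alpha>)
    - (q*\<beta>*\<gamma>*\<alpha>*\<delta> + 1 - q*\<beta>*\<gamma>*(\<alpha>+\<delta>) - x*(\<beta>+\<gamma>) + x*\<beta>*\<gamma>*(1+q))*(1-q^2*\<beta>*\<gamma>*\<delta>)*(1-q^2*\<beta>*\<gamma>*\<alpha>) =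
    (x - q^2*\<beta>*\<gamma>*\<alpha>*\<delta>) * bc_poly \<beta> \<gamma> \<alpha> \<delta> x q"
  unfolding bc_poly_def by algebra

lemma bc_poly_identity:
  "q*\<beta>*\<gamma>*(\<alpha>*\<delta> - x*\<alpha> - x*\<delta> + x^2)*(1-\<beta>*M)*(1-q*\<beta>*M)*(1-\<gamma>*M)*(1-q*\<gamma>*M)
    + (1-\<beta>)*(1-\<gamma>)*(1-q*\<beta>*\<gamma>*\<delta>*M)*(1-q^2*\<beta>*\<gamma>*\<delta>*M)*(1-q*\<beta>*\<gamma>*\<alpha>*M)*(1-q^2*\<beta>*\<gamma>*\<alpha>*M)
    - (q*\<beta>*\<gamma>*\<alpha>*\<delta> + 1 - q*\<beta>*\<gamma>*(\<alpha>+\<delta>) - x*(\<beta>+\<gamma>) + x*\<beta>*\<gamma>*(1+q))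
       *(1-\<beta>*M)*(1-\<gamma>*M)*(1-q^2*\<beta>*\<gamma>*\<delta>*M)*(1-q^2*\<beta>*\<gamma>*\<alpha>*M) =
    (1-\<beta>*M)*(1-\<gamma>*M)*(x - q^2*\<beta>*\<gamma>*\<alpha>*\<delta>*M) * bc_poly \<beta> \<gamma> \<alpha> \<delta> x (q*M)
    - (1-q^2*\<beta>*\<gamma>*\<delta>*M)*(1-q^2*\<beta>*\<gamma>*\<alpha>*M)*(1-M) * bc_poly \<beta> \<gamma> \<alpha> \<delta> x M"
  unfolding bc_poly_def by algebra


text \<open>Here x and y stay fixed while b, c, d, e are multiplied by q, which is the shift of n in
  \<open>X1\<close>. The parametrization by \<alpha>, \<beta>, \<gamma>, \<delta> solves the
  balancing condition y = de/(bc) without divisions.\<close>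

lemma psi_bc_relation_series:
  fixes \<beta> \<gamma> \<alpha> \<delta> x :: complex
  assumes x: "norm x < 1"
  defines "b \<equiv> q*\<beta>" and "c \<equiv> q*\<gamma>" and "d \<equiv> q^2*\<beta>*\<gamma>*\<delta>" and "e \<equiv> q^2*\<beta>*\<gamma>*\<alpha>"
    and "y \<equiv> q^2*\<beta>*\<gamma>*\<alpha>*\<delta>"
  shows "q*\<beta>*\<gamma>*(\<alpha>*\<delta> - x*\<alpha> - x*\<delta> + x^2)*(1-b)*(1-c) * psi (b*q) (c*q) (d*q) (e*q) x y
    + psi \<beta> \<gamma> (q*\<beta>*\<gamma>*\<delta>) (q*\<beta>*\<gamma>*\<alpha>) x y
    - (q*\<beta>*\<gamma>*\<alpha>*\<delta> + 1 - q*\<beta>*\<gamma>*(\<alpha>+\<delta>) - x*(\<beta>+\<gamma>) + x*\<beta>*\<gamma>*(1+q)) * psi b c d e x y = 0"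
proof -
  define K where "K = q*\<beta>*\<gamma>*(\<alpha>*\<delta> - x*\<alpha> - x*\<delta> + x^2)"
  define T where "T = q*\<beta>*\<gamma>*\<alpha>*\<delta> + 1 - q*\<beta>*\<gamma>*(\<alpha>+\<delta>) - x*(\<beta>+\<gamma>) + x*\<beta>*\<gamma>*(1+q)"
  define H where "H = bc_poly \<beta> \<gamma> \<alpha> \<delta> x"
  define p where "p = psi_prod x y"
  define D where "D n = qinf (d * q ^ n)" for n
  define E where "E n = qinf (e * q ^ n)" for n
  define t0 where "t0 = psi_term (b*q) (c*q) (d*q) (e*q) x y"
  define t1 where "t1 = psi_term \<beta> \<gamma> (q*\<beta>*\<gamma>*\<delta>) (q*\<beta>*\<gamma>*\<alpha>) x y"
  define t2 where "t2 = psi_term b c d e x y"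
  define g where "g n = p n * qpoch q b n * qpoch q c n * D (Suc n) * E (Suc n) / qpoch q q n" for n
  \<comment> \<open>The certificate, again with value 0 at index 0. Its argument q q^n is the power
    of q belonging to the index n + 1.\<close>
  define G where "G m = (case m of 0 \<Rightarrow> 0 | Suc n \<Rightarrow> g n * (x - y * q ^ n) * H (q * q ^ n))" for m
  have S: "t0 sums (\<Sum>k. t0 k)" "t1 sums (\<Sum>k. t1 k)" "t2 sums (\<Sum>k. t2 k)"
    unfolding t0_def t1_def t2_def using x by (auto intro!: summable_sums psi_term_summable)
  have "G \<longlonglongrightarrow> 0"
  proof (rule LIMSEQ_imp_Suc)
    have "isCont H 0"
      unfolding H_def bc_poly_def by (intro continuous_intros)
    hence "(\<lambda>n. H (q * q ^ n)) \<longlonglongrightarrow> H 0"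
      using mult_q_power_tendsto_0 by (rule isCont_tendsto_compose)
    hence "(\<lambda>n. g n * (x - y * q ^ n) * H (q * q ^ n)) \<longlonglongrightarrow>
       (0 * qinf b * qinf c * 1 * 1 / qinf q) * (x - 0) * H 0"
      unfolding g_def p_def D_def E_def
      by (intro tendsto_mult tendsto_divide tendsto_diff tendsto_const qpoch_tendsto
        LIMSEQ_Suc[OF qinf_mult_q_power_tendsto_1] qinf_q_nonzero
        psi_prod_tendsto_0 x mult_q_power_tendsto_0)
    thus "(\<lambda>n. G (Suc n)) \<longlonglongrightarrow> 0" by (simp add: G_def)
  qed
  hence GS: "(\<lambda>k. G (Suc k) - G k) sums 0" by (rule telescoping_sums_0) (simp add: G_def)
  have qp: "(1 - a) * qpoch q (a * q) n = qpoch q a (Suc n)" for a n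
    by (simp add: qpoch_def prod.lessThan_Suc_shift mult_ac del: prod.lessThan_Suc)
  have D_Suc: "D n = (1 - d * q ^ n) * D (Suc n)" "E n = (1 - e * q ^ n) * E (Suc n)" for n
    unfolding D_def E_def by (rule qinf_Suc)+
  have d0: "qinf (q*\<beta>*\<gamma>*\<delta> * q ^ n) = (1 - q*\<beta>*\<gamma>*\<delta> * q ^ n) * (1 - d * q ^ n) * D (Suc n)" for n
  proof -
    have "q*\<beta>*\<gamma>*\<delta> * q ^ Suc n = d * q ^ n" by (simp add: d_def power2_eq_square)
    thus ?thesis using qinf_Suc[of "q*\<beta>*\<gamma>*\<delta>" n] D_Suc(1)[of n] by (simp only: D_def mult.assoc)
  qed
  have e0: "qinf (q*\<beta>*\<gamma>*\<alpha> * q ^ n) = (1 - q*\<beta>*\<gamma>*\<alpha> * q ^ n) * (1 - e * q ^ n) * E (Suc n)" for n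
  proof -
    have "q*\<beta>*\<gamma>*\<alpha> * q ^ Suc n = e * q ^ n" by (simp add: e_def power2_eq_square)
    thus ?thesis using qinf_Suc[of "q*\<beta>*\<gamma>*\<alpha>" n] D_Suc(2)[of n] by (simp only: E_def mult.assoc)
  qed
  have t0: "(1 - b) * (1 - c) * t0 n =
      p n * qpoch q b (Suc n) * qpoch q c (Suc n) * D (Suc n) * E (Suc n) / qpoch q q n" for n
  proof -
    have "D (Suc n) = qinf (d * q * q ^ n)" "E (Suc n) = qinf (e * q * q ^ n)"
      by (simp_all add: D_def E_def mult_ac)
    thus ?thesis by (simp add: t0_def psi_term_def p_def qp[symmetric] mult_ac)
  qed
  have t1: "t1 n = p n * qpoch q \<beta> n * qpoch q \<gamma> n *
      ((1 - q*\<beta>*\<gamma>*\<delta> * q ^ n) * (1 - d * q ^ n) * D (Suc n)) *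
      ((1 - q*\<beta>*\<gamma>*\<alpha> * q ^ n) * (1 - e * q ^ n) * E (Suc n)) / qpoch q q n" for n
    unfolding t1_def psi_term_def d0 e0 p_def ..
  have t2: "t2 n = p n * qpoch q b n * qpoch q c n * ((1 - d * q ^ n) * D (Suc n)) *
      ((1 - e * q ^ n) * E (Suc n)) / qpoch q q n" for n
    unfolding t2_def psi_term_def p_def D_Suc[symmetric] by (simp only: D_def E_def)
  have "K * ((1 - b) * (1 - c) * t0 m) + t1 m - T * t2 m = G (Suc m) - G m" for m
  proof (cases m)
    case 0
    have "K * ((1 - b) * (1 - c) * t0 0) + t1 0 - T * t2 0 = D 1 * E 1 *
      (K*(1-q*\<beta>)*(1-q*\<gamma>)
    + (1-q*\<beta>*\<gamma>*\<delta>)*(1-q^2*\<beta>*\<gamma>*\<delta>)*(1-q*\<beta>*\<gamma>*\<alpha>)*(1-q^2*\<beta>*\<gamma>*\<alpha>)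
    - T*(1-q^2*\<beta>*\<gamma>*\<delta>)*(1-q^2*\<beta>*\<gamma>*\<alpha>))"
      unfolding t0 t1 t2
      by (simp add: p_def psi_prod_def qpoch_def b_def c_def d_def e_def) (simp add: ring_distribs mult_ac)
    also have "\<dots> = D 1 * E 1 * ((x - q^2*\<beta>*\<gamma>*\<alpha>*\<delta>) * H q)"
      unfolding K_def T_def H_def bc_poly_identity_0 ..
    finally show ?thesis
      by (simp add: 0 G_def g_def p_def psi_prod_def qpoch_def y_def mult_ac)
  next
    case (Suc n)
    define M where "M = q ^ m"
    have M: "q ^ m = M" "q * q ^ n = M" "b * q ^ n = \<beta> * M" "c * q ^ n = \<gamma> * M"
      by (simp_all add: M_def Suc b_def c_def)
    define F where "F = p m * qpoch q b n * qpoch q c n * D (Suc m) * E (Suc m) / qpoch q q m"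
    have qb: "qpoch q b m = qpoch q b n * (1 - \<beta> * M)" "qpoch q c m = qpoch q c n * (1 - \<gamma> * M)"
      unfolding Suc qpoch_Suc M by simp_all
    have qb2: "qpoch q b (Suc m) = qpoch q b n * (1 - \<beta> * M) * (1 - q*\<beta>*M)"
      "qpoch q c (Suc m) = qpoch q c n * (1 - \<gamma> * M) * (1 - q*\<gamma>*M)"
      unfolding qpoch_Suc qb M by (simp_all add: b_def c_def mult_ac)
    have qb0: "qpoch q \<beta> m = (1 - \<beta>) * qpoch q b n" "qpoch q \<gamma> m = (1 - \<gamma>) * qpoch q c n"
      unfolding Suc qp[symmetric] by (simp_all add: b_def c_def mult.commute)
    have "K * ((1 - b) * (1 - c) * t0 m) + t1 m - T * t2 m = F *
      (K*(1-\<beta>*M)*(1-q*\<beta>*M)*(1-\<gamma>*M)*(1-q*\<gamma>*M)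
    + (1-\<beta>)*(1-\<gamma>)*(1-q*\<beta>*\<gamma>*\<delta>*M)*(1-d*M)*(1-q*\<beta>*\<gamma>*\<alpha>*M)*(1-e*M)
    - T*(1-\<beta>*M)*(1-\<gamma>*M)*(1-d*M)*(1-e*M))"
    proof -
      have alg: "K * (P*(B*b1*b2)*(C*c1*c2)*D'*E'/Q) + P*(u*B)*(w*C)*(d1*d2*D')*(e1*e2*E')/Q
        - T * (P*(B*b1)*(C*c1)*(d2*D')*(e2*E')/Q) =
        (P*B*C*D'*E'/Q) * (K*b1*b2*c1*c2 + u*w*d1*d2*e1*e2 - T*b1*c1*d2*e2)"
        for P B C D' E' Q b1 b2 c1 c2 u w d1 d2 e1 e2 :: complex
        by (simp add: diff_divide_distrib add_divide_distrib algebra_simps)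
      show ?thesis unfolding t0 t1 t2 qb2 qb0 unfolding qb M F_def by (rule alg)
    qed
    also have "\<dots> = F * ((1-\<beta>*M)*(1-\<gamma>*M)*(x - y*M) * H (q*M) - (1-d*M)*(1-e*M)*(1-M) * H M)"
      unfolding K_def T_def H_def d_def e_def y_def bc_poly_identity ..
    also have "\<dots> = F * ((1-\<beta>*M)*(1-\<gamma>*M)*(x - y*M) * H (q*M)) - F * ((1-d*M)*(1-e*M)*(1-M)) * H M"
    proof -
      have "F * (u - v * w) = F * u - F * v * w" for u v w by (simp add: right_diff_distrib)
      thus ?thesis .
    qed
    also have "F * ((1-\<beta>*M)*(1-\<gamma>*M)*(x - y*M) * H (q*M)) = G (Suc m)"
      unfolding G_def nat.case g_def qb M F_def by (simp add: mult_ac)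
    also have "F * ((1-d*M)*(1-e*M)*(1-M)) = g n * (x - y * q ^ n)"
    proof -
      have "1 - M \<noteq> 0" using q_power_Suc_neq_1[of n] by (simp add: M_def Suc)
      moreover have "qpoch q q m = qpoch q q n * (1 - M)" unfolding Suc qpoch_Suc M by simp
      moreover have "p m = p n * (x - y * q ^ n)" by (simp add: Suc p_def psi_prod_Suc)
      moreover have "D (Suc n) = (1 - d * M) * D (Suc m)" "E (Suc n) = (1 - e * M) * E (Suc m)"
        using D_Suc[of m] by (simp_all only: Suc M_def)
      ultimately show ?thesis unfolding F_def g_def by (simp add: divide_simps)
    qed
    also have "g n * (x - y * q ^ n) * H M = G m" by (simp only: G_def Suc nat.case M(2))
    finally show ?thesis .
  qed
  moreover have "(\<lambda>m. K * ((1 - b) * (1 - c) * t0 m) + t1 m - T * t2 m) sums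
      (K * ((1 - b) * (1 - c) * (\<Sum>k. t0 k)) + (\<Sum>k. t1 k) - T * (\<Sum>k. t2 k))"
    by (intro sums_add sums_diff sums_mult S)
  ultimately have "K * ((1 - b) * (1 - c) * (\<Sum>k. t0 k)) + (\<Sum>k. t1 k) - T * (\<Sum>k. t2 k) = 0"
    using GS sums_unique2 by (metis (no_types, lifting) sums_cong)
  hence eq: "w * (K * ((1 - b) * (1 - c) * (\<Sum>k. t0 k)) + (\<Sum>k. t1 k) - T * (\<Sum>k. t2 k)) = 0" for w
    by simp
  have "K*(1-b)*(1-c) * psi (b*q) (c*q) (d*q) (e*q) x y
    + psi \<beta> \<gamma> (q*\<beta>*\<gamma>*\<delta>) (q*\<beta>*\<gamma>*\<alpha>) x y - T * psi b c d e x y =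
    qinf x * (K * ((1 - b) * (1 - c) * (\<Sum>k. t0 k)) + (\<Sum>k. t1 k) - T * (\<Sum>k. t2 k))"
  proof -
    have "K * u * w * (g * S0) + g * S1 - T * (g * S2) = g * (K * (u * w * S0) + S1 - T * S2)"
      for u w g S0 S1 S2 by (simp add: algebra_simps)
    thus ?thesis unfolding t0_def t1_def t2_def psi_eq_series[OF x] .
  qed
  also have "\<dots> = 0" by (rule eq)
  finally show ?thesis unfolding K_def T_def .
qed

lemma psi_bc_relation:
  fixes \<beta> \<gamma> \<alpha> \<delta> x y :: complex
  assumes y: "y = q^2*\<beta>*\<gamma>*\<alpha>*\<delta>"
  shows "q*\<beta>*\<gamma>*(\<alpha>*\<delta> - x*\<alpha> - x*\<delta> + x^2)*(1-q*\<beta>)*(1-q*\<gamma>)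
      * psi (q*\<beta>*q) (q*\<gamma>*q) (q^2*\<beta>*\<gamma>*\<delta>*q) (q^2*\<beta>*\<gamma>*\<alpha>*q) x y
    + psi \<beta> \<gamma> (q*\<beta>*\<gamma>*\<delta>) (q*\<beta>*\<gamma>*\<alpha>) x y
    - (q*\<beta>*\<gamma>*\<alpha>*\<delta> + 1 - q*\<beta>*\<gamma>*(\<alpha>+\<delta>) - x*(\<beta>+\<gamma>) + x*\<beta>*\<gamma>*(1+q))
      * psi (q*\<beta>) (q*\<gamma>) (q^2*\<beta>*\<gamma>*\<delta>) (q^2*\<beta>*\<gamma>*\<alpha>) x y = 0" (is "?f x = 0")
proof (rule entire_eqI[where f = ?f and g = "\<lambda>_. 0"])
  show "?f holomorphic_on UNIV"
    by (intro holomorphic_intros) auto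
  show "?f x = 0" if "norm x < 1" for x
    using psi_bc_relation_series[OF that, of \<beta> \<gamma> \<alpha> \<delta>] unfolding y .
qed auto

end

text \<open>At a simple zero of \<open>g\<close> the quotient tends to the ratio of the derivatives,
  so the singularity is removable.\<close>

lemma holomorphic_quotient_simple_zeros:
  assumes S: "open S" and f: "f holomorphic_on S" and g: "g holomorphic_on S"
    and zeros: "\<And>z. z \<in> S \<Longrightarrow> g z = 0 \<Longrightarrow> f z = 0 \<and> (\<exists>D. D \<noteq> 0 \<and> (g has_field_derivative D) (at z))"
  obtains h where "h holomorphic_on S" "\<And>z. z \<in> S \<Longrightarrow> f z = g z * h z"
proof -
  define h where "h z = (if g z = 0 then deriv f z / deriv g z else f z / g z)" for z
  have "h field_differentiable at z" if z: "z \<in> S" for z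
  proof (cases "g z = 0")
    case False
    have "continuous_on S g" using g by (rule holomorphic_on_imp_continuous_on)
    hence "open (S \<inter> g -` (- {0}))"
      by (intro continuous_open_preimage S) auto
    moreover have "z \<in> S \<inter> g -` (- {0})" using z False by simp
    moreover have "h holomorphic_on (S \<inter> g -` (- {0}))"
    proof -
      have "(\<lambda>w. f w / g w) holomorphic_on (S \<inter> g -` (- {0}))"
        by (intro holomorphic_on_divide holomorphic_on_subset[OF f] holomorphic_on_subset[OF g]) auto
      thus ?thesis by (rule holomorphic_transform) (simp add: h_def)
    qed
    ultimately show ?thesis by (rule holomorphic_on_imp_differentiable_at[rotated])
  next
    case True
    then obtain D where D: "D \<noteq> 0" "(g has_field_derivative D) (at z)" and fz: "f z = 0"
      using zeros[OF z] by blast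
    obtain F where F: "(f has_field_derivative F) (at z)"
      using holomorphic_on_imp_differentiable_at[OF f S z] by (auto simp: field_differentiable_def)
    have lg: "((\<lambda>w. g w / (w - z)) \<longlongrightarrow> D) (at z)" and lf: "((\<lambda>w. f w / (w - z)) \<longlongrightarrow> F) (at z)"
      using D(2) F by (simp_all add: has_field_derivative_iff True fz)
    have "\<forall>\<^sub>F w in at z. g w / (w - z) \<noteq> 0"
      using lg D(1) by (rule tendsto_imp_eventually_ne)
    hence ev: "\<forall>\<^sub>F w in at z. g w \<noteq> 0"
      by eventually_elim auto
    then obtain r where r: "r > 0" "\<And>w. w \<noteq> z \<Longrightarrow> dist w z < r \<Longrightarrow> g w \<noteq> 0"
      by (auto simp: eventually_at)
    obtain r' where r': "r' > 0" "ball z r' \<subseteq> S" using S z open_contains_ball by blast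
    define U where "U = ball z (min r r')"
    have U: "open U" "z \<in> U" "U \<subseteq> S" "\<And>w. w \<in> U - {z} \<Longrightarrow> g w \<noteq> 0"
      using r r' by (auto simp: U_def dist_commute)
    have "((\<lambda>w. (f w / (w - z)) / (g w / (w - z))) \<longlongrightarrow> F / D) (at z)"
      by (intro tendsto_divide lf lg D(1))
    moreover have "\<forall>\<^sub>F w in at z. (f w / (w - z)) / (g w / (w - z)) = f w / g w"
      by (auto simp: eventually_at intro!: exI[of _ 1])
    ultimately have "((\<lambda>w. f w / g w) \<longlongrightarrow> F / D) (at z)"
      by (rule Lim_transform_eventually)
    moreover have "(\<lambda>w. f w / g w) holomorphic_on U - {z}"
      using U by (intro holomorphic_on_divide holomorphic_on_subset[OF f] holomorphic_on_subset[OF g]) auto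
    ultimately have "(\<lambda>w. if w = z then F / D else f w / g w) holomorphic_on U"
      using U(1) by (intro removable_singularity)
    hence "h holomorphic_on U"
    proof (rule holomorphic_transform)
      fix w assume "w \<in> U"
      thus "(if w = z then F / D else f w / g w) = h w"
        using U(4)[of w] True DERIV_imp_deriv[OF F] DERIV_imp_deriv[OF D(2)] by (auto simp: h_def)
    qed
    thus ?thesis using U by (intro holomorphic_on_imp_differentiable_at)
  qed
  hence "h holomorphic_on S" using S by (simp add: holomorphic_on_def field_differentiable_at_within)
  moreover have "f z = g z * h z" if "z \<in> S" for z
    using zeros[OF that] by (auto simp: h_def)
  ultimately show ?thesis by (rule that)
qed

context q_base
begin

subsection \<open>Theta functions\<close>

definition q_lattice :: "complex set" where
  "q_lattice = range (\<lambda>k::int. q powi k)"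

lemma q_power_in_lattice [simp]: "q ^ n \<in> q_lattice" "1 / q ^ n \<in> q_lattice"
  using rangeI[of "\<lambda>k. q powi k" "int n"] rangeI[of "\<lambda>k. q powi k" "- int n"]
  by (simp_all add: q_lattice_def power_int_minus inverse_eq_divide)

lemma q_poles_subset_lattice: "q_poles q \<subseteq> q_lattice"
proof
  fix w assume "w \<in> q_poles q"
  then obtain k where "w * q ^ k = 1" by (auto simp: q_poles_def)
  hence "w = 1 / q ^ k" by (simp add: field_simps)
  thus "w \<in> q_lattice" by simp
qed

lemma q_lattice_mult [intro]: "a \<in> q_lattice \<Longrightarrow> b \<in> q_lattice \<Longrightarrow> a * b \<in> q_lattice"
  by (auto simp: q_lattice_def power_int_add[symmetric])

lemma q_lattice_inverse [intro]: "a \<in> q_lattice \<Longrightarrow> 1 / a \<in> q_lattice"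
  by (auto simp: q_lattice_def inverse_eq_divide[symmetric] power_int_minus[symmetric])

lemma q_in_lattice [simp]: "q \<in> q_lattice" "1 \<in> q_lattice"
  using q_power_in_lattice(1)[of 1] q_power_in_lattice(1)[of 0] by simp_all

lemma zero_notin_lattice [simp]: "0 \<notin> q_lattice"
  by (auto simp: q_lattice_def)

lemma qinf_nonzero: "a \<notin> q_lattice \<Longrightarrow> qinf a \<noteq> 0"
  using q_poles_subset_lattice by (auto simp: qinf_eq_0_iff)

text \<open>The Jacobi theta function in multiplicative form, up to the constant (q)_inf.\<close>

definition theta :: "complex \<Rightarrow> complex" where
  "theta u = qinf u * qinf (q / u)"

lemma theta_eq_0D:
  assumes "theta u = 0" "u \<noteq> 0"
  shows "(\<exists>n. u = 1 / q ^ n) \<or> (\<exists>n. u = q ^ n)"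
proof -
  have "u \<in> q_poles q \<or> q / u \<in> q_poles q"
    using assms by (auto simp: theta_def qinf_eq_0_iff)
  thus ?thesis
  proof
    assume "u \<in> q_poles q"
    thus ?thesis by (auto simp: q_poles_def field_simps)
  next
    assume "q / u \<in> q_poles q"
    then obtain k where "q / u * q ^ k = 1" by (auto simp: q_poles_def)
    hence "u = q ^ Suc k" using assms(2) by (simp add: field_simps)
    thus ?thesis by blast
  qed
qed

lemma theta_nonzero: "u \<noteq> 0 \<Longrightarrow> u \<notin> q_lattice \<Longrightarrow> theta u \<noteq> 0"
  using theta_eq_0D by fastforce

lemma theta_holomorphic: "theta holomorphic_on - {0}"
  unfolding theta_def by (intro holomorphic_intros) auto

lemma theta_shift:
  assumes "u \<noteq> 0"
  shows "theta (q * u) = - theta u / u"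
proof (cases "u = 1")
  case True
  thus ?thesis by (simp add: theta_def)
next
  case False
  have 1: "qinf u = (1 - u) * qinf (q * u)" "qinf (1 / u) = (1 - 1 / u) * qinf (q / u)"
    using qinf_step[of u] qinf_step[of "1 / u"] by (simp_all add: mult.commute)
  have "theta (q * u) = qinf (q * u) * ((1 - 1 / u) * qinf (q / u))"
    by (simp add: theta_def 1(2))
  also have "(1 - 1 / u) = - (1 - u) / u" using assms by (simp add: field_simps)
  also have "qinf (q * u) * (- (1 - u) / u * qinf (q / u)) = - theta u / u"
    unfolding theta_def 1(1) by (simp add: mult_ac del: minus_diff_eq)
  finally show ?thesis .
qed

text \<open>At u = 1 the factor 1 - u splits off with the cofactor (q)_inf^2, which is nonzero. The
  functional equation \<open>theta_shift\<close> then transports a nonzero derivative to all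
  integral powers of q, upwards and downwards.\<close>

lemma theta_simple_zero:
  assumes "theta u = 0" "u \<noteq> 0"
  shows "\<exists>D. D \<noteq> 0 \<and> (theta has_field_derivative D) (at u)"
proof -
  define Z where "Z u \<longleftrightarrow> theta u = 0 \<and> (\<exists>D. D \<noteq> 0 \<and> (theta has_field_derivative D) (at u))" for u
  have Z1: "Z 1"
  proof -
    define w where "w u = qinf (q * u) * qinf (q / u)" for u
    have "w holomorphic_on - {0}" unfolding w_def by (intro holomorphic_intros) auto
    hence "w field_differentiable at 1"
      by (rule holomorphic_on_imp_differentiable_at) auto
    then obtain w' where "(w has_field_derivative w') (at 1)" by (auto simp: field_differentiable_def)
    hence "((\<lambda>u. (1 - u) * w u) has_field_derivative (1 - 1) * w' + (0 - 1) * w 1) (at 1)"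
      by (intro derivative_eq_intros) (auto intro: derivative_intros)
    moreover have "(\<lambda>u. (1 - u) * w u) = theta"
    proof
      fix u show "(1 - u) * w u = theta u"
        using qinf_step[of u] by (simp add: theta_def w_def mult.commute)
    qed
    ultimately have "(theta has_field_derivative - (qinf q * qinf q)) (at 1)"
      by (simp add: w_def)
    moreover have "theta 1 = 0" by (simp add: theta_def)
    ultimately show ?thesis unfolding Z_def by (intro conjI exI[of _ "- (qinf q * qinf q)"]) auto
  qed
  have up: "Z (q * u)" if "Z u" "u \<noteq> 0" for u
  proof -
    obtain D where D: "D \<noteq> 0" "(theta has_field_derivative D) (at u)" and 0: "theta u = 0"
      using \<open>Z u\<close> by (auto simp: Z_def)
    have "((\<lambda>w. theta (w / q)) has_field_derivative D * (1 / q)) (at (q * u))"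
      by (rule DERIV_chain2[where g = "\<lambda>w. w / q"]) (use D in \<open>auto intro!: derivative_eq_intros\<close>)
    hence "((\<lambda>w. - theta (w / q) * q / w) has_field_derivative
        ((- (D * (1 / q)) * q) * (q * u) - (- theta (q * u / q) * q) * 1) / ((q * u) * (q * u))) (at (q * u))"
      using \<open>u \<noteq> 0\<close> by (intro DERIV_divide DERIV_cmult_right DERIV_minus DERIV_ident) auto
    hence "((\<lambda>w. - theta (w / q) * q / w) has_field_derivative (- D / (q * u))) (at (q * u))"
      using \<open>u \<noteq> 0\<close> 0 by simp
    hence "(theta has_field_derivative (- D / (q * u))) (at (q * u))"
    proof (rule has_field_derivative_transform_within_open)
      fix w :: complex assume "w \<in> - {0}"
      thus "- theta (w / q) * q / w = theta w" using theta_shift[of "w / q"] by simp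
    qed (use \<open>u \<noteq> 0\<close> in auto)
    moreover have "theta (q * u) = 0" using theta_shift[OF \<open>u \<noteq> 0\<close>] 0 by simp
    ultimately show ?thesis using D(1) \<open>u \<noteq> 0\<close> unfolding Z_def
      by (intro conjI exI[of _ "- D / (q * u)"]) auto
  qed
  have down: "Z (u / q)" if "Z u" "u \<noteq> 0" for u
  proof -
    obtain D where D: "D \<noteq> 0" "(theta has_field_derivative D) (at u)" and 0: "theta u = 0"
      using \<open>Z u\<close> by (auto simp: Z_def)
    have "((\<lambda>w. theta (q * w)) has_field_derivative D * q) (at (u / q))"
      by (rule DERIV_chain2[where g = "\<lambda>w. q * w"]) (use D in \<open>auto intro!: derivative_eq_intros\<close>)
    hence "((\<lambda>w. - w * theta (q * w)) has_field_derivative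
        (-1) * theta (q * (u / q)) + D * q * (- (u / q))) (at (u / q))"
      by (intro DERIV_mult DERIV_minus DERIV_ident)
    hence "((\<lambda>w. - w * theta (q * w)) has_field_derivative (- D * u)) (at (u / q))"
      using 0 by simp
    hence "(theta has_field_derivative (- D * u)) (at (u / q))"
    proof (rule has_field_derivative_transform_within_open)
      fix w :: complex assume "w \<in> - {0}"
      thus "- w * theta (q * w) = theta w" using theta_shift[of w] by simp
    qed (use \<open>u \<noteq> 0\<close> in auto)
    moreover have "theta (u / q) = 0" using theta_shift[of "u / q"] 0 \<open>u \<noteq> 0\<close> by simp
    ultimately show ?thesis using D(1) \<open>u \<noteq> 0\<close> unfolding Z_def
      by (intro conjI exI[of _ "- D * u"]) auto
  qed
  have "Z (q ^ n)" for n
  proof (induction n)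
    case (Suc n)
    thus ?case using up[of "q ^ n"] by simp
  qed (use Z1 in simp)
  moreover have "Z (1 / q ^ n)" for n
  proof (induction n)
    case (Suc n)
    thus ?case using down[of "1 / q ^ n"] by (simp add: mult.commute)
  qed (use Z1 in simp)
  ultimately show ?thesis using theta_eq_0D[OF assms] by (auto simp: Z_def)
qed

lemma theta_factor:
  assumes N: "N holomorphic_on - {0}" and p: "p \<noteq> 0"
    and zeros: "\<And>w. w \<in> q_lattice \<Longrightarrow> N (p * w) = 0"
  obtains N' where "N' holomorphic_on - {0}" "\<And>u. u \<noteq> 0 \<Longrightarrow> N u = theta (u / p) * N' u"
proof (rule holomorphic_quotient_simple_zeros[of "- {0}" N "\<lambda>u. theta (u / p)"])
  have "(\<lambda>u. u / p) ` (- {0}) \<subseteq> - {0}" using p by auto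
  thus "(\<lambda>u. theta (u / p)) holomorphic_on - {0}"
    using p by (intro holomorphic_on_compose_gen[OF _ theta_holomorphic, unfolded o_def] holomorphic_intros) auto
  fix u assume u: "u \<in> - {0}" "theta (u / p) = 0"
  have "u / p \<in> q_lattice" using theta_nonzero[of "u / p"] u p by auto
  hence "N u = 0" using zeros[of "u / p"] p by simp
  moreover obtain D where D: "D \<noteq> 0" "(theta has_field_derivative D) (at (u / p))"
    using theta_simple_zero[OF u(2)] u(1) p by auto
  have "((\<lambda>u. theta (u / p)) has_field_derivative D * (1 / p)) (at u)"
    by (rule DERIV_chain2[where g = "\<lambda>u. u / p"]) (use D p in \<open>auto intro!: derivative_eq_intros\<close>)
  ultimately show "N u = 0 \<and> (\<exists>D. D \<noteq> 0 \<and> ((\<lambda>u. theta (u / p)) has_field_derivative D) (at u))"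
    using D(1) p by (intro conjI exI[of _ "D * (1 / p)"]) auto
qed (use N that in auto)

text \<open>With n the last exponent for which |u| \<le> |q|^n, division by q^n moves u into a
  compact annulus, a fundamental domain for multiplication by q.\<close>

lemma annulus_reduction:
  assumes "0 < norm u" "norm u \<le> 1"
  obtains n w where "u = q ^ n * w" "norm q \<le> norm w" "norm w \<le> 1"
proof -
  define P where "P n \<longleftrightarrow> norm u \<le> norm q ^ n" for n
  have "\<exists>n. \<not> P n"
  proof -
    have "(\<lambda>n. norm q ^ n) \<longlonglongrightarrow> 0" using q_less by (intro LIMSEQ_power_zero) auto
    hence "\<forall>\<^sub>F n in sequentially. norm q ^ n < norm u" using assms(1) by (rule order_tendstoD)
    thus ?thesis by (auto simp: eventually_sequentially P_def not_le)
  qed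
  moreover have "P 0" using assms by (simp add: P_def)
  ultimately obtain n where n: "P n" "\<not> P (Suc n)"
    by (metis nat_induct)
  have "norm q ^ n > 0" using q_pos by simp
  hence "norm q \<le> norm (u / q ^ n)" "norm (u / q ^ n) \<le> 1"
    using n by (simp_all add: P_def norm_divide norm_power field_simps)
  thus ?thesis by (intro that[of n "u / q ^ n"]) auto
qed

text \<open>A suitable power of \<open>u\<close> makes the multiplier contracting, so that the singularity at \<open>0\<close> becomes
  removable; the Taylor coefficients at \<open>0\<close> then vanish one by one.\<close>

lemma multiplicative_eq_0:
  assumes hol: "E holomorphic_on - {0}" and mult: "\<And>u. u \<noteq> 0 \<Longrightarrow> E (q * u) = c * E u"
    and c: "c \<notin> q_lattice" and u: "u \<noteq> 0"
  shows "E u = 0"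
proof -
  obtain m where m: "norm c * norm q ^ m < 1" using ex_norm_mult_q_power_less_1 by blast
  define \<gamma> where "\<gamma> = c * q ^ m"
  define f where "f u = u ^ m * E u" for u
  have f_mult: "f (q * u) = \<gamma> * f u" if "u \<noteq> 0" for u
    using mult[OF that] by (simp add: f_def \<gamma>_def power_mult_distrib)
  have f_hol: "f holomorphic_on - {0}" unfolding f_def by (intro holomorphic_intros hol)
  define K where "K = cball 0 1 - ball (0::complex) (norm q)"
  have "compact K" unfolding K_def by (intro compact_diff) auto
  moreover have "K \<subseteq> - {0}" using q_pos by (auto simp: K_def)
  hence "continuous_on K f" using f_hol holomorphic_on_imp_continuous_on continuous_on_subset by blast
  ultimately have "bounded (f ` K)" by (intro compact_imp_bounded compact_continuous_image)
  then obtain B where B: "\<And>w. w \<in> K \<Longrightarrow> norm (f w) \<le> B" by (auto simp: bounded_iff)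
  have iter: "f (q ^ n * w) = \<gamma> ^ n * f w" if "w \<noteq> 0" for n w
  proof (induction n)
    case (Suc n)
    thus ?case using f_mult[of "q ^ n * w"] that by (simp add: mult_ac)
  qed simp
  have bd: "norm (f u) \<le> B" if u: "0 < norm u" "norm u \<le> 1" for u
  proof -
    obtain n w where w: "u = q ^ n * w" "norm q \<le> norm w" "norm w \<le> 1"
      using annulus_reduction[OF u] by blast
    have "w \<noteq> 0" using w(1) u by auto
    have "norm (f u) = norm \<gamma> ^ n * norm (f w)"
      unfolding w(1) iter[OF \<open>w \<noteq> 0\<close>] by (simp add: norm_mult norm_power)
    also have "\<dots> \<le> 1 * norm (f w)"
      using m by (intro mult_right_mono power_le_one) (auto simp: \<gamma>_def norm_mult norm_power)
    also have "\<dots> \<le> B" using B[of w] w by (simp add: K_def)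
    finally show ?thesis .
  qed
  have "\<forall>\<^sub>F u in at 0. norm (f u) \<le> B"
    unfolding eventually_at by (intro exI[of _ 1]) (use bd in auto)
  moreover have "f holomorphic_on UNIV - {0}" using f_hol by (simp add: Compl_eq_Diff_UNIV)
  ultimately obtain F where F: "F holomorphic_on UNIV" "\<And>u. u \<noteq> 0 \<Longrightarrow> F u = f u"
    using holomorphic_on_extend_bounded[of f UNIV 0] by auto
  have "isCont F 0"
    using holomorphic_on_imp_continuous_on[OF F(1)] continuous_on_eq_continuous_at by blast
  have lim: "(\<lambda>n. F (q ^ n * w)) \<longlonglongrightarrow> F 0" for w
  proof -
    have "(\<lambda>n. q ^ n * w) \<longlonglongrightarrow> 0" using mult_q_power_tendsto_0[of w] by (simp add: mult.commute)
    thus ?thesis by (rule isCont_tendsto_compose[OF \<open>isCont F 0\<close>])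
  qed
  \<comment> \<open>The extension agrees with \<open>f\<close> only off 0, so the functional
    equation at 0 itself is obtained as a limit along q^n.\<close>
  have "F 0 = \<gamma> * F 0"
  proof (rule LIMSEQ_unique)
    show "(\<lambda>n. F (q ^ Suc n * 1)) \<longlonglongrightarrow> F 0" by (rule LIMSEQ_Suc[OF lim])
    have "F (q ^ Suc n * 1) = \<gamma> * F (q ^ n * 1)" for n
      using F(2)[of "q ^ n"] F(2)[of "q * q ^ n"] f_mult[of "q ^ n"] by simp
    thus "(\<lambda>n. F (q ^ Suc n * 1)) \<longlonglongrightarrow> \<gamma> * F 0"
      by (simp only:) (intro tendsto_mult_left lim)
  qed
  hence FG: "F (q * w) = \<gamma> * F w" for w
    using F(2)[of w] F(2)[of "q * w"] f_mult[of w] by (cases "w = 0") auto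
  have "(deriv ^^ n) F 0 = 0" for n
  proof -
    have "(deriv ^^ n) (\<lambda>w. F (q * w)) 0 = q ^ n * (deriv ^^ n) F (q * 0)"
      by (rule higher_deriv_compose_linear[OF F(1), of UNIV]) auto
    hence "(deriv ^^ n) (\<lambda>w. \<gamma> * F w) 0 = q ^ n * (deriv ^^ n) F 0"
      by (simp only: FG mult_zero_right)
    moreover have "(deriv ^^ n) (\<lambda>w. \<gamma> * F w) 0 = \<gamma> * (deriv ^^ n) F 0"
      by (rule higher_deriv_cmult[OF F(1)]) auto
    ultimately have "(\<gamma> - q ^ n) * (deriv ^^ n) F 0 = 0"
      by (simp add: left_diff_distrib)
    moreover have "\<gamma> \<noteq> q ^ n"
    proof
      assume "\<gamma> = q ^ n"
      hence "c = q ^ n * (1 / q ^ m)" by (simp add: \<gamma>_def field_simps)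
      thus False using c q_lattice_mult[OF q_power_in_lattice(1)[of n] q_power_in_lattice(2)[of m]] by simp
    qed
    ultimately show ?thesis by simp
  qed
  hence "F w = 0" for w
    by (intro holomorphic_fun_eq_0_on_connected[OF F(1)]) auto
  thus ?thesis using F(2)[OF u] u by (simp add: f_def)
qed


lemma q_lattice_cases:
  assumes "w \<in> q_lattice"
  obtains n where "w = q ^ n" | n where "w = 1 / q ^ n"
proof -
  obtain k :: int where "w = q powi k" using assms by (auto simp: q_lattice_def)
  thus ?thesis using that by (cases "k \<ge> 0") (auto simp: power_int_def inverse_eq_divide power_one_over)
qed

text \<open>A nonzero function of this type has two zeros modulo \<open>q\<^sup>\<int>\<close>, with product \<open>\<mu>\<close>; the product of the
  zeros \<open>p\<close> and \<open>1\<close> is different.\<close>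

lemma quadratic_multiplier_eq_0:
  assumes hol: "M holomorphic_on - {0}"
    and mult: "\<And>u. u \<noteq> 0 \<Longrightarrow> M (q * u) = \<mu> / u^2 * M u"
    and "\<mu> \<noteq> 0" "p \<noteq> 0" "M p = 0" "M 1 = 0" "p \<notin> q_lattice" "\<mu> / p \<notin> q_lattice" "u \<noteq> 0"
  shows "M u = 0"
proof -
  have lat: "M (w * v) = 0" if "M v = 0" "v \<noteq> 0" and w: "w \<in> q_lattice" for v w
  proof -
    have "M (q ^ n * v) = 0" for n
    proof (induction n)
      case (Suc n)
      thus ?case using mult[of "q ^ n * v"] that by (simp add: mult.assoc)
    qed (use that in simp)
    moreover have "M (1 / q ^ n * v) = 0" for n
    proof (induction n)
      case (Suc n)
      have "q * (1 / q ^ Suc n * v) = 1 / q ^ n * v" by simp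
      thus ?case using mult[of "1 / q ^ Suc n * v"] that Suc \<open>\<mu> \<noteq> 0\<close> by (simp del: power_Suc)
    qed (use that in simp)
    ultimately show ?thesis by (cases rule: q_lattice_cases[OF w]) simp_all
  qed
  have "M (p * w) = 0" if "w \<in> q_lattice" for w
    using lat[OF \<open>M p = 0\<close> \<open>p \<noteq> 0\<close> that] by (simp add: mult.commute)
  from theta_factor[OF hol \<open>p \<noteq> 0\<close> this] obtain N where
    N: "N holomorphic_on - {0}" "\<And>u. u \<noteq> 0 \<Longrightarrow> M u = theta (u / p) * N u" by blast
  have "N (1 * w) = 0" if w: "w \<in> q_lattice" for w
  proof -
    have "w \<noteq> 0" using w zero_notin_lattice by metis
    \<comment> \<open>Since \<open>p\<close> is off the lattice, the first theta factor is nonzero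
      at lattice points; the zeros of \<open>M\<close> there pass to \<open>N\<close>.\<close>
    have "w / p \<notin> q_lattice"
    proof
      assume "w / p \<in> q_lattice"
      from q_lattice_mult[OF q_lattice_inverse[OF this] w] show False
        using \<open>p \<noteq> 0\<close> \<open>w \<noteq> 0\<close> \<open>p \<notin> q_lattice\<close> by simp
    qed
    hence "theta (w / p) \<noteq> 0" using \<open>p \<noteq> 0\<close> \<open>w \<noteq> 0\<close> by (intro theta_nonzero) auto
    moreover have "M w = 0" using lat[of 1 w] w \<open>M 1 = 0\<close> by simp
    ultimately show ?thesis using N(2)[OF \<open>w \<noteq> 0\<close>] by simp
  qed
  from theta_factor[OF N(1) one_neq_zero this] obtain E where
    E: "E holomorphic_on - {0}" "\<And>u. u \<noteq> 0 \<Longrightarrow> N u = theta (u / 1) * E u" by blast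
  have ME: "M u = theta (u / p) * (theta u * E u)" if "u \<noteq> 0" for u
    using N(2)[OF that] E(2)[OF that] by simp
  \<comment> \<open>On \<open>W\<close> both theta factors can be cancelled, which leaves the
    constant multiplier \<mu>/p. As their zeros are countable, \<open>W\<close> is nonempty, and the
    identity theorem extends the relation to all nonzero u.\<close>
  define W where "W = (- {0}) \<inter> (\<lambda>u. theta (u / p) * theta u) -` (- {0})"
  have E_mult_W: "E (q * u) = \<mu> / p * E u" if "u \<in> W" for u
  proof -
    have u: "u \<noteq> 0" "theta (u / p) \<noteq> 0" "theta u \<noteq> 0" using that by (auto simp: W_def)
    have "theta (q * u / p) = - theta (u / p) / (u / p)"
      using theta_shift[of "u / p"] u \<open>p \<noteq> 0\<close> by simp
    hence "theta (u / p) * theta u * (p / u^2 * E (q * u)) = M (q * u)"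
      using ME[of "q * u"] theta_shift[OF u(1)] u \<open>p \<noteq> 0\<close> by (simp add: power2_eq_square)
    also have "\<dots> = theta (u / p) * theta u * (\<mu> / u^2 * E u)"
      using mult[OF u(1)] ME[OF u(1)] by simp
    finally have "p / u^2 * E (q * u) = \<mu> / u^2 * E u" using u by simp
    thus ?thesis using u \<open>p \<noteq> 0\<close> by (simp add: field_simps)
  qed
  have E_mult: "E (q * u) = \<mu> / p * E u" if "u \<noteq> 0" for u
  proof (rule analytic_continuation_open[where s = W and s' = "- {0}" and f = "\<lambda>u. E (q * u)"])
    show "open W"
      unfolding W_def
    proof (intro continuous_open_preimage holomorphic_on_imp_continuous_on holomorphic_on_mult)
      show "(\<lambda>u. theta (u / p)) holomorphic_on - {0}"
        using \<open>p \<noteq> 0\<close>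
        by (intro holomorphic_on_compose_gen[OF _ theta_holomorphic, unfolded o_def] holomorphic_intros) auto
      show "theta holomorphic_on - {0}" by (rule theta_holomorphic)
    qed auto
    show "W \<noteq> {}"
    proof -
      have "countable q_lattice" unfolding q_lattice_def by simp
      hence "countable (q_lattice \<union> (\<lambda>w. p * w) ` q_lattice \<union> {0})" by auto
      hence "q_lattice \<union> (\<lambda>w. p * w) ` q_lattice \<union> {0} \<noteq> UNIV"
        using uncountable_UNIV_complex by metis
      then obtain u where u: "u \<notin> q_lattice" "u \<notin> (\<lambda>w. p * w) ` q_lattice" "u \<noteq> 0" by blast
      have "u / p \<notin> q_lattice"
      proof
        assume "u / p \<in> q_lattice"
        hence "p * (u / p) \<in> (\<lambda>w. p * w) ` q_lattice" by (rule imageI)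
        thus False using u \<open>p \<noteq> 0\<close> by simp
      qed
      hence "u \<in> W" using u \<open>p \<noteq> 0\<close> theta_nonzero[of u] theta_nonzero[of "u / p"] by (simp add: W_def)
      thus ?thesis by blast
    qed
    show "connected (- {0} :: complex set)"
      by (rule connected_punctured_universe) simp
    show "(\<lambda>u. E (q * u)) holomorphic_on - {0}"
      by (intro holomorphic_on_compose_gen[OF _ E(1), unfolded o_def] holomorphic_intros) auto
    show "(\<lambda>u. \<mu> / p * E u) holomorphic_on - {0}" by (intro holomorphic_intros E(1))
  qed (use E_mult_W that in \<open>auto simp: W_def\<close>)
  have "E u = 0"
    by (rule multiplicative_eq_0[OF E(1) E_mult \<open>\<mu> / p \<notin> q_lattice\<close> \<open>u \<noteq> 0\<close>])
  thus ?thesis using ME[OF \<open>u \<noteq> 0\<close>] by simp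
qed

subsection \<open>Solutions analytic at \<open>n = -\<infinity>\<close>\<close>

text \<open>With \<open>v = q\<^sup>-\<^sup>n\<close>, the sequence \<open>X\<^sub>n = q\<^bsup>n(n-1)\<^esup> k(q\<^sup>-\<^sup>n)\<close> solves the recurrence if \<open>k\<close> solves the
  following equation.\<close>

definition inf_sol ::
  "complex \<Rightarrow> complex \<Rightarrow> complex \<Rightarrow> complex \<Rightarrow> complex \<Rightarrow> (complex \<Rightarrow> complex) \<Rightarrow> bool" where
  "inf_sol A B C D z k \<longleftrightarrow> k holomorphic_on UNIV \<and>
     (\<forall>v. k (v / q) - (z * v^2 - (1/A + 1/B + 1/C + 1/D) * v + (1 + q) / q) * k v
       + (1 - q * v/A) * (1 - q * v/B) * (1 - q * v/C) * (1 - q * v/D) / q * k (q * v) = 0)"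

text \<open>With v = q^(-n), the arguments v and q v belong to the indices n and n - 1.\<close>

definition casorati :: "(complex \<Rightarrow> complex) \<Rightarrow> (complex \<Rightarrow> complex) \<Rightarrow> complex \<Rightarrow> complex" where
  "casorati k l v = k v * l (q * v) - k (q * v) * l v"

text \<open>Multiplied by v, this product solves the first-order equation of
  \<open>casorati_step\<close>.\<close>

definition inf_theta :: "complex \<Rightarrow> complex \<Rightarrow> complex \<Rightarrow> complex \<Rightarrow> complex \<Rightarrow> complex" where
  "inf_theta A B C D v = qinf (q^2 * v/A) * qinf (q^2 * v/B) * qinf (q^2 * v/C) * qinf (q^2 * v/D)"

lemma casorati_step:
  assumes "inf_sol A B C D z k" "inf_sol A B C D z l"
  shows "q * casorati k l v =
    (1 - q^2 * v/A) * (1 - q^2 * v/B) * (1 - q^2 * v/C) * (1 - q^2 * v/D) * casorati k l (q * v)"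
proof -
  define T where "T = z * (q * v)^2 - (1/A + 1/B + 1/C + 1/D) * (q * v) + (1 + q) / q"
  define S where "S = (1 - q^2 * v/A) * (1 - q^2 * v/B) * (1 - q^2 * v/C) * (1 - q^2 * v/D)"
  have "k v - T * k (q * v) + S / q * k (q * (q * v)) = 0"
    "l v - T * l (q * v) + S / q * l (q * (q * v)) = 0"
    using assms[unfolded inf_sol_def, THEN conjunct2, THEN spec[of _ "q * v"]]
    by (simp_all add: T_def S_def power2_eq_square mult.assoc)
  hence eqs: "k v = T * k (q * v) - S / q * k (q * (q * v))"
    "l v = T * l (q * v) - S / q * l (q * (q * v))"
    by (simp_all add: algebra_simps)
  have "casorati k l v = S / q * casorati k l (q * v)"
    unfolding casorati_def eqs by (simp add: algebra_simps)
  thus ?thesis by (simp add: S_def)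
qed

lemma inf_theta_step:
  "inf_theta A B C D v =
    (1 - q^2 * v/A) * (1 - q^2 * v/B) * (1 - q^2 * v/C) * (1 - q^2 * v/D) * inf_theta A B C D (q * v)"
proof -
  have *: "qinf (q^2 * v/P) = (1 - q^2 * v/P) * qinf (q^2*(q * v)/P)" for P
    using qinf_step[of "q^2 * v/P"] by (simp add: mult_ac)
  show ?thesis unfolding inf_theta_def *[of A] *[of B] *[of C] *[of D] by (simp only: mult_ac)
qed

text \<open>Iterating the common first-order equation moves v to 0, where the Casoratian divided by
  v tends to its derivative and \<open>inf_theta\<close> tends to 1. So \<kappa> is the derivative
  of the Casoratian at 0.\<close>

lemma casorati_eq:
  assumes "inf_sol A B C D z k" "inf_sol A B C D z l"
  obtains \<kappa> where "\<And>v. casorati k l v = \<kappa> * v * inf_theta A B C D v"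
proof -
  define W where "W = casorati k l"
  define \<Theta> where "\<Theta> = inf_theta A B C D"
  have hol: "k holomorphic_on UNIV" "l holomorphic_on UNIV" using assms by (auto simp: inf_sol_def)
  have hol_q: "(\<lambda>v. f (q * v)) holomorphic_on UNIV" if "f holomorphic_on UNIV" for f :: "complex \<Rightarrow> complex"
    by (intro holomorphic_on_compose_gen[OF _ that, unfolded o_def] holomorphic_intros) auto
  have "W holomorphic_on UNIV"
    unfolding W_def casorati_def by (intro holomorphic_intros hol hol_q)
  then obtain \<kappa> where \<kappa>: "(W has_field_derivative \<kappa>) (at 0)"
    using holomorphic_on_imp_differentiable_at[of W UNIV 0] by (auto simp: field_differentiable_def)
  have W0: "W 0 = 0" by (simp add: W_def casorati_def)
  have "\<Theta> holomorphic_on UNIV"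
    unfolding \<Theta>_def inf_theta_def divide_inverse by (intro holomorphic_intros)
  hence cont: "isCont \<Theta> 0"
    using holomorphic_on_imp_continuous_on continuous_on_eq_continuous_at by blast
  have \<Theta>0: "\<Theta> 0 = 1" by (simp add: \<Theta>_def inf_theta_def)
  define S where "S v = (1 - q^2 * v/A) * (1 - q^2 * v/B) * (1 - q^2 * v/C) * (1 - q^2 * v/D)" for v
  have iter: "q ^ n * W v = (\<Prod>j<n. S (q ^ j * v)) * W (q ^ n * v)" for n v
  proof (induction n)
    case (Suc n)
    have "q * W (q ^ n * v) = S (q ^ n * v) * W (q ^ Suc n * v)"
      using casorati_step[OF assms, of "q ^ n * v"] by (simp add: W_def S_def mult.assoc)
    hence "(\<Prod>j<n. S (q ^ j * v)) * (q * W (q ^ n * v)) =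
        (\<Prod>j<Suc n. S (q ^ j * v)) * W (q ^ Suc n * v)"
      by (simp only: prod.lessThan_Suc mult.assoc)
    moreover have "q ^ Suc n * W v = (\<Prod>j<n. S (q ^ j * v)) * (q * W (q ^ n * v))"
      using Suc by (simp add: mult_ac)
    ultimately show ?case by (simp only:)
  qed simp
  have iter': "\<Theta> v = (\<Prod>j<n. S (q ^ j * v)) * \<Theta> (q ^ n * v)" for n v
  proof (induction n)
    case (Suc n)
    have "\<Theta> (q ^ n * v) = S (q ^ n * v) * \<Theta> (q ^ Suc n * v)"
      using inf_theta_step[of A B C D "q ^ n * v"] by (simp add: \<Theta>_def S_def mult.assoc)
    with Suc show ?case by (simp add: mult.assoc)
  qed simp
  have "W v = \<kappa> * v * \<Theta> v" for v
  proof (cases "v = 0")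
    case False
    have lim0: "(\<lambda>n. q ^ n * v) \<longlonglongrightarrow> 0"
      using mult_q_power_tendsto_0[of v] by (simp add: mult.commute)
    have "(\<lambda>n. \<Theta> (q ^ n * v)) \<longlonglongrightarrow> 1"
      using isCont_tendsto_compose[OF cont lim0] \<Theta>0 by simp
    hence lim1: "(\<lambda>n. W v * \<Theta> (q ^ n * v)) \<longlonglongrightarrow> W v * 1"
      by (rule tendsto_mult_left)
    have "((\<lambda>w. W w / w) \<longlongrightarrow> \<kappa>) (at 0)"
      using \<kappa> by (simp add: has_field_derivative_iff W0)
    moreover have "filterlim (\<lambda>n. q ^ n * v) (at 0) sequentially"
      using lim0 False by (simp add: filterlim_at)
    ultimately have "(\<lambda>n. W (q ^ n * v) / (q ^ n * v)) \<longlonglongrightarrow> \<kappa>"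
      by (rule filterlim_compose)
    hence "(\<lambda>n. \<Theta> v * v * (W (q ^ n * v) / (q ^ n * v))) \<longlonglongrightarrow> \<Theta> v * v * \<kappa>"
      by (rule tendsto_mult_left)
    moreover have "\<Theta> v * v * (W (q ^ n * v) / (q ^ n * v)) = W v * \<Theta> (q ^ n * v)" for n
    proof -
      have "q ^ n * (W v * \<Theta> (q ^ n * v)) = \<Theta> v * W (q ^ n * v)"
        using iter[of n v] iter'[of v n] by (simp add: mult_ac)
      thus ?thesis using False by (simp add: field_simps)
    qed
    ultimately have "(\<lambda>n. W v * \<Theta> (q ^ n * v)) \<longlonglongrightarrow> \<Theta> v * v * \<kappa>" by simp
    from LIMSEQ_unique[OF lim1 this] show ?thesis by (simp add: mult_ac)
  qed (simp add: W0)
  thus ?thesis by (intro that[of \<kappa>]) (simp add: W_def \<Theta>_def)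
qed

lemma casorati_eq_0:
  assumes "inf_sol A B C D z k" "inf_sol A B C D z l"
    and "casorati k l w = 0" "w \<noteq> 0" "inf_theta A B C D w \<noteq> 0"
  shows "casorati k l v = 0"
  using casorati_eq[OF assms(1,2)] assms(3-5) by (metis mult_eq_0_iff)

lemma inf_sol_diff:
  assumes "inf_sol A B C D z k" "inf_sol A B C D z l"
  shows "inf_sol A B C D z (\<lambda>v. k v - c * l v)"
proof -
  have lin: "(k0 - c * l0) - T * (k1 - c * l1) + S * (k2 - c * l2) = 0"
    if "k0 - T * k1 + S * k2 = 0" "l0 - T * l1 + S * l2 = 0" for k0 k1 k2 l0 l1 l2 T S :: complex
    using that by algebra
  show ?thesis
    unfolding inf_sol_def
  proof (intro conjI allI lin)
    show "(\<lambda>v. k v - c * l v) holomorphic_on UNIV"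
      using assms by (auto simp: inf_sol_def intro!: holomorphic_intros)
  qed (use assms in \<open>unfold inf_sol_def, blast+\<close>)
qed

text \<open>The difference m = k - c l is made to vanish at a point \<open>v0\<close>; the
  Casoratian yields a second zero at q v0, and the equation propagates zeros to all q^n v0, which
  accumulate at 0. Choosing \<open>v0\<close> small keeps the coefficient \<open>S\<close> of the
  next value away from 0.\<close>

lemma inf_sol_proportional:
  assumes k: "inf_sol A B C D z k" and l: "inf_sol A B C D z l"
    and nz: "A \<noteq> 0" "B \<noteq> 0" "C \<noteq> 0" "D \<noteq> 0"
    and W: "\<And>v. casorati k l v = 0" and w: "l w \<noteq> 0" "w \<noteq> 0"
  obtains c where "\<And>v. k v = c * l v"
proof -
  have hol: "k holomorphic_on UNIV" "l holomorphic_on UNIV" using k l by (auto simp: inf_sol_def)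
  define S where "S v = (1 - q * v/A) * (1 - q * v/B) * (1 - q * v/C) * (1 - q * v/D)" for v
  have "isCont S 0" unfolding S_def by (intro continuous_intros) (use nz in auto)
  moreover have "S 0 \<noteq> 0" by (simp add: S_def)
  ultimately have "\<forall>\<^sub>F v in nhds 0. S v \<noteq> 0"
    by (intro tendsto_imp_eventually_ne) (simp_all add: isCont_def tendsto_nhds_iff)
  then obtain r where r: "r > 0" "\<And>v. norm v < r \<Longrightarrow> S v \<noteq> 0"
    by (auto simp: eventually_nhds_metric dist_norm)
  have "\<exists>v0. norm v0 < r \<and> v0 \<noteq> 0 \<and> l v0 \<noteq> 0"
  proof (rule ccontr)
    assume "\<not> ?thesis"
    hence *: "l v * v = 0" if "norm v < r" for v using that by auto
    have "(\<lambda>v. l v * v) holomorphic_on UNIV" using hol by (intro holomorphic_intros)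
    hence "l w * w = 0"
      by (rule entire_eqI[where f = "\<lambda>v. l v * v" and g = "\<lambda>_. 0", OF _ _ r(1)]) (auto simp: *)
    thus False using w by simp
  qed
  then obtain v0 where v0: "norm v0 < r" "v0 \<noteq> 0" "l v0 \<noteq> 0" by blast
  define c where "c = k v0 / l v0"
  define m where "m v = k v - c * l v" for v
  have m: "inf_sol A B C D z m" unfolding m_def by (rule inf_sol_diff[OF k l])
  have m0: "m v0 = 0" using v0 by (simp add: m_def c_def)
  have "casorati m l v0 = casorati k l v0" by (simp add: casorati_def m_def algebra_simps)
  hence m1: "m (q * v0) = 0" using W[of v0] m0 v0 by (simp add: casorati_def)
  have "m (q ^ n * v0) = 0 \<and> m (q ^ Suc n * v0) = 0" for n
  proof (induction n)
    case (Suc n)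
    define v where "v = q ^ Suc n * v0"
    have "norm q ^ Suc n \<le> 1" using q_less by (intro power_le_one) auto
    hence "norm v \<le> norm v0" unfolding v_def norm_mult norm_power by (simp add: mult_left_le_one_le)
    hence "S v \<noteq> 0" using r(2) v0(1) by simp
    moreover have "v / q = q ^ n * v0" by (simp add: v_def)
    moreover have "m (v / q) - (z * v^2 - (1/A + 1/B + 1/C + 1/D) * v + (1 + q) / q) * m v
       + S v / q * m (q * v) = 0"
      using m unfolding inf_sol_def S_def by blast
    ultimately have "m (q * v) = 0" using Suc by (simp add: v_def)
    thus ?case using Suc by (simp add: v_def mult.assoc)
  qed (use m0 m1 in simp)
  hence zero: "m v = 0" if "v \<in> range (\<lambda>n. q ^ n * v0)" for v using that by auto
  have "0 islimpt range (\<lambda>n. q ^ n * v0)"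
    unfolding islimpt_sequential
  proof (intro exI[of _ "\<lambda>n. q ^ n * v0"] conjI allI)
    show "(\<lambda>n. q ^ n * v0) \<longlonglongrightarrow> 0" using mult_q_power_tendsto_0[of v0] by (simp add: mult.commute)
  qed (use v0 in auto)
  hence "m v = 0" for v
    using m zero by (intro analytic_continuation[of m UNIV "range (\<lambda>n. q ^ n * v0)" 0 v])
      (auto simp: inf_sol_def)
  hence "k v = c * l v" for v by (simp add: m_def)
  thus ?thesis by (rule that)
qed


section \<open>The entire solutions attached to the parameters\<close>

lemma inf_sol_permute:
  "inf_sol A B C D z k \<longleftrightarrow> inf_sol B A C D z k"
  "inf_sol A B C D z k \<longleftrightarrow> inf_sol A C B D z k"
  "inf_sol A B C D z k \<longleftrightarrow> inf_sol A B D C z k"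
  by (simp_all add: inf_sol_def mult_ac add_ac)

definition rfun ::
  "complex \<Rightarrow> complex \<Rightarrow> complex \<Rightarrow> complex \<Rightarrow> complex \<Rightarrow> complex \<Rightarrow> complex \<Rightarrow> complex" where
  "rfun P Q R S l l' v = psi (P*Q*l) (P*Q*l') (P*q/R) (P*q/S) (q * v / Q) (q*P/Q)"

text \<open>P is the parameter to which the solution is attached and Q its partner. The factor (q
  v/P)_inf, which stems from (P)_n by reversal, makes the equation symmetric in the four parameters
  and creates the zero at P/q.\<close>

definition kfun ::
  "complex \<Rightarrow> complex \<Rightarrow> complex \<Rightarrow> complex \<Rightarrow> complex \<Rightarrow> complex \<Rightarrow> complex \<Rightarrow> complex" where
  "kfun P Q R S l l' v = qinf (q * v / P) * rfun P Q R S l l' v"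

text \<open>\<open>psi_x_relation\<close> with X = v/Q and Y = P/Q; its balancing condition becomes
  the hypothesis on l l'.\<close>

lemma rfun_relation:
  assumes nz: "P \<noteq> 0" "Q \<noteq> 0" "R \<noteq> 0" "S \<noteq> 0" and ll: "l * l' = q / (P*Q*R*S)"
  shows "(1 - v/P) * rfun P Q R S l l' (v/q)
    - ((l + l') * v^2 - (1/P + 1/Q + 1/R + 1/S) * v + (1 + q)/q) * rfun P Q R S l l' v
    + (1 - q * v / Q) * (1 - q * v / R) * (1 - q * v / S) / q * rfun P Q R S l l' (q * v) = 0"
proof -
  define X Y b c d e where "X = v/Q" "Y = P/Q" "b = P*Q*l" "c = P*Q*l'" "d = P*q/R" "e = P*q/S"
  note defs = this
  have "b * c * q * Y = P^3 * Q * q * (l * l')"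
    using nz by (simp add: defs power3_eq_cube)
  also have "\<dots> = d * e"
    unfolding ll using nz by (simp add: defs power3_eq_cube)
  finally have de: "d * e = b * c * q * Y" ..
  have Y: "Y \<noteq> 0" using nz by (simp add: defs)
  have 1: "rfun P Q R S l l' (v/q) = psi b c d e X (Y * q)" "rfun P Q R S l l' v = psi b c d e (X * q) (Y * q)"
    "rfun P Q R S l l' (q * v) = psi b c d e (X * q^2) (Y * q)"
    by (simp_all add: rfun_def defs power2_eq_square mult_ac)
  have 2: "1 - v/P = 1 - X/Y" "1 - q * v / Q = 1 - X * q"
    "1 - q * v / R = 1 - d * X / Y" "1 - q * v / S = 1 - e * X / Y"
    using nz by (simp_all add: defs mult_ac)
  have "(b + c) * X^2 / Y = (l + l') * v^2" "X * (1 + 1/Y + (d + e) / (q * Y)) = (1/P + 1/Q + 1/R + 1/S) * v"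
    using nz by (simp_all add: defs field_simps power2_eq_square)
  hence 3: "(l + l') * v^2 - (1/P + 1/Q + 1/R + 1/S) * v + (1 + q)/q =
      (b + c) * X^2 / Y - X * (1 + 1/Y + (d + e) / (q * Y)) + (1 + q)/q" by simp
  show ?thesis unfolding 1 2 3 using psi_x_relation[OF Y de, of X] .
qed

lemma inf_sol_kfun:
  assumes nz: "P \<noteq> 0" "Q \<noteq> 0" "R \<noteq> 0" "S \<noteq> 0" and ll: "l * l' = q / (P*Q*R*S)"
  shows "inf_sol P Q R S (l + l') (kfun P Q R S l l')"
  unfolding inf_sol_def
proof (intro conjI allI)
  show "kfun P Q R S l l' holomorphic_on UNIV"
    unfolding kfun_def rfun_def divide_inverse by (intro holomorphic_intros) auto
  fix v
  define r where "r = rfun P Q R S l l'"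
  have q1: "qinf (q * (v/q) / P) = (1 - v/P) * qinf (q * v / P)"
    using qinf_step[of "v/P"] by (simp add: mult_ac)
  have q2: "qinf (q * v / P) = (1 - q * v / P) * qinf (q * (q * v) / P)"
    using qinf_step[of "q * v / P"] by (simp add: mult_ac)
  have alg: "a * (w * g) * r0 - T * ((w * g) * r1) + w * s1 * s2 * s3 / q * (g * r2) =
      w * g * (a * r0 - T * r1 + s1 * s2 * s3 / q * r2)" for a w g r0 r1 r2 T s1 s2 s3 :: complex
    by (simp add: algebra_simps)
  show "kfun P Q R S l l' (v / q)
     - ((l + l') * v^2 - (1/P + 1/Q + 1/R + 1/S) * v + (1 + q) / q) * kfun P Q R S l l' v
     + (1 - q * v/P) * (1 - q * v/Q) * (1 - q * v/R) * (1 - q * v/S) / q * kfun P Q R S l l' (q * v) = 0"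
    unfolding kfun_def q1 unfolding q2 alg rfun_relation[OF assms] by simp
qed

lemma kfun_zero: "P \<noteq> 0 \<Longrightarrow> kfun P Q R S l l' (P / q) = 0"
  by (simp add: kfun_def)

text \<open>At v = P both coordinates of \<open>psi\<close> are q P/Q. The value serves to show that
  the solution is not identically 0.\<close>

lemma kfun_own:
  "P \<noteq> 0 \<Longrightarrow> kfun P Q R S l l' P =
     qinf q * (qinf (q*P/Q) * (qinf (P*q/R) * qinf (P*q/S)))"
  by (simp add: kfun_def rfun_def psi_same)

text \<open>At v = Q/q the argument is 1, the first pole of the continued series, where
  \<open>psi_at_1\<close> applies.\<close>

lemma kfun_partner:
  "Q \<noteq> 0 \<Longrightarrow> kfun P Q R S l l' (Q / q) =
     qinf (Q/P) * (qinf (q*P/Q) * qinf (P*Q*l) * qinf (P*Q*l'))"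
  by (simp add: kfun_def rfun_def psi_at_1)

text \<open>General position of a set rather than of a list, hence stable under the permutations of
  the parameters that the solutions use.\<close>

definition generic :: "complex \<Rightarrow> complex \<Rightarrow> complex set \<Rightarrow> bool" where
  "generic l l' T \<longleftrightarrow> l / l' \<notin> q_lattice \<and>
     (\<forall>P\<in>T. P \<noteq> 0 \<and> P \<notin> q_lattice \<and> P * l \<notin> q_lattice \<and> P * l' \<notin> q_lattice) \<and>
     (\<forall>P\<in>T. \<forall>Q\<in>T. P \<noteq> Q \<longrightarrow>
        P / Q \<notin> q_lattice \<and> P * Q * l \<notin> q_lattice \<and> P * Q * l' \<notin> q_lattice)"

lemma q_mult_lattice_iff [simp]: "q * a \<in> q_lattice \<longleftrightarrow> a \<in> q_lattice" "a * q \<in> q_lattice \<longleftrightarrow> a \<in> q_lattice"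
proof -
  show "q * a \<in> q_lattice \<longleftrightarrow> a \<in> q_lattice"
    using q_lattice_mult[of q a] q_lattice_mult[of "1 / q" "q * a"] q_lattice_inverse[of q] by auto
  thus "a * q \<in> q_lattice \<longleftrightarrow> a \<in> q_lattice" by (simp add: mult.commute)
qed

lemma generic_ratio:
  assumes "generic l l' T" "P \<in> T" "Q \<in> T" "P \<noteq> Q"
  shows "qinf (P / Q) \<noteq> 0" "qinf (q * P / Q) \<noteq> 0" "qinf (P * q / Q) \<noteq> 0"
proof -
  have r: "P / Q \<notin> q_lattice" using assms by (auto simp: generic_def)
  hence "q * (P / Q) \<notin> q_lattice" by (simp only: q_mult_lattice_iff not_False_eq_True)
  moreover have "q * P / Q = q * (P / Q)" "P * q / Q = q * (P / Q)" by simp_all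
  ultimately show "qinf (P / Q) \<noteq> 0" "qinf (q * P / Q) \<noteq> 0" "qinf (P * q / Q) \<noteq> 0"
    using r by (simp_all only: qinf_nonzero not_False_eq_True)
qed

lemma kfun_own_nonzero:
  assumes "generic l l' T" "P \<in> T" "Q \<in> T" "R \<in> T" "S \<in> T" "P \<noteq> Q" "P \<noteq> R" "P \<noteq> S"
  shows "kfun P Q R S l l' P \<noteq> 0"
  using assms generic_ratio[OF assms(1)] by (subst kfun_own) (auto simp: generic_def)

lemma kfun_partner_nonzero:
  assumes "generic l l' T" "P \<in> T" "Q \<in> T" "P \<noteq> Q"
  shows "kfun P Q R S l l' (Q / q) \<noteq> 0"
  using assms generic_ratio[OF assms(1)] qinf_nonzero[of "P*Q*l"] qinf_nonzero[of "P*Q*l'"]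
  by (subst kfun_partner) (auto simp: generic_def)

lemma inf_theta_own_nonzero:
  assumes "generic l l' T" "P \<in> T" "Q \<in> T" "R \<in> T" "S \<in> T" "P \<noteq> Q" "P \<noteq> R" "P \<noteq> S"
  shows "inf_theta P Q R S (P / q) \<noteq> 0"
proof -
  have *: "q^2 * (P / q) / Y = q * P / Y" for Y by (simp add: power2_eq_square)
  have "P \<noteq> 0" using assms by (auto simp: generic_def)
  thus ?thesis unfolding inf_theta_def *
    using assms generic_ratio[OF assms(1)] by auto
qed

text \<open>The space of solutions vanishing at \<open>P/q\<close> is one-dimensional, so replacing the partner \<open>Q\<close> of \<open>P\<close>
  by another parameter changes \<open>kfun\<close> only by a factor.\<close>

lemma kfun_swap_nonzero:
  assumes g: "generic l l' T" and T: "P \<in> T" "Q \<in> T" "R \<in> T" "S \<in> T"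
    and ne: "P \<noteq> Q" "P \<noteq> R" "P \<noteq> S" and ll: "l * l' = q / (P*Q*R*S)"
    and k': "inf_sol P Q R S (l + l') k'" "k' (P / q) = 0" "k' w \<noteq> 0"
  shows "kfun P Q R S l l' w \<noteq> 0"
proof -
  define k where "k = kfun P Q R S l l'"
  have nz: "P \<noteq> 0" "Q \<noteq> 0" "R \<noteq> 0" "S \<noteq> 0" using g T by (auto simp: generic_def)
  have k: "inf_sol P Q R S (l + l') k" unfolding k_def by (rule inf_sol_kfun[OF nz ll])
  have "k (P / q) = 0" unfolding k_def by (rule kfun_zero[OF nz(1)])
  hence "casorati k' k (P / q) = 0"
    unfolding casorati_def k'(2) by (simp only: mult_zero_left mult_zero_right diff_self)
  hence "casorati k' k v = 0" for v
    by (rule casorati_eq_0[OF k'(1) k _ _ inf_theta_own_nonzero[OF g T ne]]) (use nz(1) in auto)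
  moreover have "k P \<noteq> 0" unfolding k_def by (rule kfun_own_nonzero[OF g T ne])
  ultimately obtain c where "\<And>v. k' v = c * k v"
    using inf_sol_proportional[OF k'(1) k nz] nz(1) by metis
  thus ?thesis using k'(3) by (auto simp: k_def)
qed

text \<open>An explicit value is known only at the partner. At R and S the partner is exchanged,
  which \<open>kfun_swap_nonzero\<close> permits.\<close>

lemma kfun_other_nonzero:
  assumes g: "generic l l' T" and T: "P \<in> T" "Q \<in> T" "R \<in> T" "S \<in> T"
    and ne: "P \<noteq> Q" "P \<noteq> R" "P \<noteq> S" and ll: "l * l' = q / (P*Q*R*S)"
    and w: "w \<in> {Q, R, S}"
  shows "kfun P Q R S l l' (w / q) \<noteq> 0"
proof -
  have nz: "P \<noteq> 0" "Q \<noteq> 0" "R \<noteq> 0" "S \<noteq> 0" using g T by (auto simp: generic_def)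
  consider "w = Q" | "w = R" | "w = S" using w by blast
  thus ?thesis
  proof cases
    case 1
    thus ?thesis using kfun_partner_nonzero[OF g T(1,2) ne(1)] by simp
  next
    case 2
    have "inf_sol P R Q S (l + l') (kfun P R Q S l l')"
      using nz ll by (intro inf_sol_kfun) (simp_all add: mult_ac)
    hence "inf_sol P Q R S (l + l') (kfun P R Q S l l')" by (simp only: inf_sol_permute(2))
    moreover have "kfun P R Q S l l' (w / q) \<noteq> 0"
      unfolding 2 by (rule kfun_partner_nonzero[OF g T(1,3) ne(2)])
    ultimately show ?thesis
      using kfun_zero[OF nz(1)] by (intro kfun_swap_nonzero[OF g T ne ll]) auto
  next
    case 3
    have "inf_sol P S R Q (l + l') (kfun P S R Q l l')"
      using nz ll by (intro inf_sol_kfun) (simp_all add: mult_ac)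
    hence "inf_sol P Q R S (l + l') (kfun P S R Q l l')"
      by (metis inf_sol_permute(2) inf_sol_permute(3))
    moreover have "kfun P S R Q l l' (w / q) \<noteq> 0"
      unfolding 3 by (rule kfun_partner_nonzero[OF g T(1,4) ne(3)])
    ultimately show ?thesis
      using kfun_zero[OF nz(1)] by (intro kfun_swap_nonzero[OF g T ne ll]) auto
  qed
qed

text \<open>The point 1/q stands for the indices 1 and 0. Parameters off the lattice make
  \<open>inf_theta\<close> nonzero there, so a zero of the Casoratian would make it vanish
  identically; then \<open>m\<close> would be a multiple of \<open>k\<close>, contrary to their
  values at \<open>w\<close>.\<close>

lemma casorati_kfun_nonzero:
  assumes g: "generic l l' {A, B, C, D}"
    and k: "inf_sol A B C D z k" and m: "inf_sol A B C D z m"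
    and w: "k w = 0" "m w \<noteq> 0" "w \<noteq> 0" and kv: "k v \<noteq> 0" "v \<noteq> 0"
  shows "casorati k m (1 / q) \<noteq> 0"
proof
  assume c: "casorati k m (1 / q) = 0"
  have nz: "A \<noteq> 0" "B \<noteq> 0" "C \<noteq> 0" "D \<noteq> 0" using g by (auto simp: generic_def)
  have "qinf (q^2 * (1 / q) / P) \<noteq> 0" if "P \<in> {A, B, C, D}" for P
  proof (rule qinf_nonzero)
    have "P \<notin> q_lattice" using g that by (auto simp: generic_def)
    hence "1 / P \<notin> q_lattice" using q_lattice_inverse[of "1 / P"] by auto
    thus "q^2 * (1 / q) / P \<notin> q_lattice"
      using q_mult_lattice_iff(1)[of "1 / P"] by (simp add: power2_eq_square)
  qed
  hence "inf_theta A B C D (1 / q) \<noteq> 0" by (simp add: inf_theta_def)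
  hence all: "casorati k m v = 0" for v
    using casorati_eq_0[OF k m c] by simp
  have "casorati m k v = 0" for v
    using all[of v] by (simp add: casorati_def algebra_simps)
  then obtain c where "\<And>v. m v = c * k v"
    using inf_sol_proportional[OF m k nz, of v] kv by metis
  thus False using w by simp
qed

subsection \<open>Solutions analytic at \<open>n = \<infinity>\<close>\<close>

text \<open>The function \<open>psi\<close> belonging to \<open>X1\<close>, with u in place of q^n.
  The last coordinate is BCl times ADl, so neither argument depends on u, and u = 0 is the confluent
  case.\<close>

definition gfun ::
  "complex \<Rightarrow> complex \<Rightarrow> complex \<Rightarrow> complex \<Rightarrow> complex \<Rightarrow> complex \<Rightarrow> complex" where
  "gfun A B C D l u = psi (B*u) (C*u) (B*C*D*l*u) (A*B*C*l*u) (A*D*l) (A*B*C*D*l^2)"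

lemma gfun_holomorphic: "gfun A B C D l holomorphic_on UNIV"
  unfolding gfun_def by (intro holomorphic_intros) auto

lemma gfun_0: "gfun A B C D l 0 = qinf (A*B*C*D*l^2)"
  by (simp add: gfun_def psi_confluent)

lemma gfun_at_B: "B \<noteq> 0 \<Longrightarrow> gfun A B C D l (1/B) = qinf (A*D*l) * (qinf (C*D*l) * qinf (A*C*l))"
  by (simp add: gfun_def psi_1_left mult_ac)

lemma gfun_at_C: "C \<noteq> 0 \<Longrightarrow> gfun A B C D l (1/C) = qinf (A*D*l) * (qinf (B*D*l) * qinf (A*B*l))"
  by (subst gfun_def, subst psi_commute) (simp add: psi_1_left mult_ac)

text \<open>This is \<open>psi_bc_relation\<close> times \<open>l'\<close>. In the substitution
  \<beta>, \<gamma> carry the factor u and \<alpha>, \<delta> the factor 1/u, so that y is free of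
  u.\<close>

lemma gfun_relation:
  assumes nz: "A \<noteq> 0" "B \<noteq> 0" "C \<noteq> 0" "D \<noteq> 0" "u \<noteq> 0" and ll: "l * l' = q / (A*B*C*D)"
  shows "l * (1 - A*u) * (1 - B*u) * (1 - C*u) * (1 - D*u) * gfun A B C D l (q*u)
    + l' * gfun A B C D l (u/q)
    - (l + l' - (1/A + 1/B + 1/C + 1/D) * u + (1 + q) * u^2 / q) * gfun A B C D l u = 0"
proof -
  have l: "l \<noteq> 0" "l' \<noteq> 0" using ll nz by auto
  have l': "l' = q / (A*B*C*D*l)" using ll l nz by (simp add: field_simps)
  define \<beta> \<gamma> \<alpha> \<delta> x y where "\<beta> = B*u/q" "\<gamma> = C*u/q" "\<alpha> = A*l/u" "\<delta> = D*l/u" "x = A*D*l" "y = A*B*C*D*l^2"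
  note defs = this
  have 0: "y = q^2*\<beta>*\<gamma>*\<alpha>*\<delta>" using nz by (simp add: defs power2_eq_square)
  have 1: "gfun A B C D l (q*u) = psi (q*\<beta>*q) (q*\<gamma>*q) (q^2*\<beta>*\<gamma>*\<delta>*q) (q^2*\<beta>*\<gamma>*\<alpha>*q) x y"
    "gfun A B C D l (u/q) = psi \<beta> \<gamma> (q*\<beta>*\<gamma>*\<delta>) (q*\<beta>*\<gamma>*\<alpha>) x y"
    "gfun A B C D l u = psi (q*\<beta>) (q*\<gamma>) (q^2*\<beta>*\<gamma>*\<delta>) (q^2*\<beta>*\<gamma>*\<alpha>) x y"
    unfolding gfun_def using nz by (simp_all add: defs power2_eq_square mult_ac)
  have K: "l' * (q*\<beta>*\<gamma>*(\<alpha>*\<delta> - x*\<alpha> - x*\<delta> + x^2)*(1-q*\<beta>)*(1-q*\<gamma>)) =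
     l * (1 - A*u) * (1 - B*u) * (1 - C*u) * (1 - D*u)"
  proof -
    have 1: "\<alpha>*\<delta> - x*\<alpha> - x*\<delta> + x^2 = A*D*l^2/u^2 * ((1 - A*u) * (1 - D*u))"
      using nz by (simp add: defs field_simps power2_eq_square)
    have 2: "l' * (q*\<beta>*\<gamma>) * (A*D*l^2/u^2) = l"
      using nz l by (simp add: l' defs field_simps power2_eq_square)
    have 3: "1 - q*\<beta> = 1 - B*u" "1 - q*\<gamma> = 1 - C*u" by (simp_all add: defs)
    have "m * (t * (k * (a * d)) * b * c) = (m * t * k) * a * b * c * d" for m t k a b c d :: complex
      by (simp only: mult_ac)
    thus ?thesis unfolding 1 3 by (simp only: 2)
  qed
  have T: "l' * (q*\<beta>*\<gamma>*\<alpha>*\<delta> + 1 - q*\<beta>*\<gamma>*(\<alpha>+\<delta>) - x*(\<beta>+\<gamma>) + x*\<beta>*\<gamma>*(1+q)) =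
     l + l' - (1/A + 1/B + 1/C + 1/D) * u + (1 + q) * u^2 / q"
    using nz l by (simp add: l' defs field_simps power2_eq_square)
  have "l' * (k * g0 + g1 - t * g2) = l' * k * g0 + l' * g1 - (l' * t) * g2" for k g0 g1 g2 t
    by (simp add: algebra_simps)
  from this[symmetric] show ?thesis
    unfolding K[symmetric] T[symmetric] 1 using psi_bc_relation[OF 0, of x] by simp
qed

text \<open>The Casoratian \<open>M\<close> of the two kinds of solutions has the multiplier l'/u^2
  and the zero 1/P. A further zero at u = 1 would make it vanish identically, because P l' is off
  the lattice. But at u = 1/w one of its two terms drops out and the other is nonzero;
  \<open>w\<close> is B or C since \<open>gfun\<close> is explicit at 1/B and 1/C.\<close>

lemma connection_nonzero:
  assumes nz: "A \<noteq> 0" "B \<noteq> 0" "C \<noteq> 0" "D \<noteq> 0" and ll: "l * l' = q / (A*B*C*D)"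
    and g: "generic l l' {A, B, C, D}"
    and ne: "A \<noteq> B" "A \<noteq> C" "A \<noteq> D" "B \<noteq> C" "B \<noteq> D" "C \<noteq> D"
    and k: "inf_sol A B C D (l + l') k" and P: "P \<in> {A, B, C, D}" "k (P / q) = 0"
    and w: "w \<in> {B, C}" "k (w / q) \<noteq> 0"
  shows "gfun A B C D l 1 * k (1 / q) - l * (1 - A) * (1 - B) * (1 - C) * (1 - D) * gfun A B C D l q * k 1 \<noteq> 0"
proof
  assume eq0: "gfun A B C D l 1 * k (1 / q) - l * (1 - A) * (1 - B) * (1 - C) * (1 - D) * gfun A B C D l q * k 1 = 0"
  define h where "h = gfun A B C D l"
  define PP where "PP u = (1 - A*u) * (1 - B*u) * (1 - C*u) * (1 - D*u)" for u
  \<comment> \<open>Common factors of the Casoratian are divided out: u^2 is the quotient of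
    q^(n(n-1)) at n + 1 and at n, and \<open>l * PP u\<close> is the corresponding quotient of the
    prefactors of \<open>X1\<close>.\<close>
  define M where "M u = h u * k (1 / (q*u)) * u^2 - l * PP u * h (q*u) * k (1/u)" for u
  have l: "l \<noteq> 0" "l' \<noteq> 0" using ll nz by auto
  have kh: "k holomorphic_on UNIV" using k by (simp add: inf_sol_def)
  have hh: "h holomorphic_on UNIV" unfolding h_def by (rule gfun_holomorphic)
  have hol: "M holomorphic_on - {0}"
    unfolding M_def PP_def
    by (intro holomorphic_intros holomorphic_on_compose_gen[OF _ kh, unfolded o_def]
      holomorphic_on_compose_gen[OF _ hh, unfolded o_def] holomorphic_on_subset[OF hh]) auto
  have mult: "M (q * u) = l' / u^2 * M u" if u: "u \<noteq> 0" for u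
  proof -
    define T where "T = (l + l') * (1/(q*u))^2 - (1/A + 1/B + 1/C + 1/D) * (1/(q*u)) + (1 + q) / q"
    define PP' where "PP' = (1 - q * (1/(q*u))/A) * (1 - q * (1/(q*u))/B) * (1 - q * (1/(q*u))/C) * (1 - q * (1/(q*u))/D)"
    have "k (1/(q*u) / q) - T * k (1/(q*u)) + PP' / q * k (q * (1/(q*u))) = 0"
      using k unfolding inf_sol_def T_def PP'_def by blast
    moreover have "1/(q*u)/q = 1/(q*(q*u))" "q * (1/(q*u)) = 1/u" using u by simp_all
    ultimately have k1: "k (1/(q*(q*u))) = T * k (1/(q*u)) - PP' / q * k (1/u)"
      by (simp add: algebra_simps)
    have "l * PP (q*u) * h (q*(q*u)) + l' * h u
      - (l + l' - (1/A + 1/B + 1/C + 1/D) * (q*u) + (1 + q) * (q*u)^2 / q) * h (q*u) = 0"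
      using gfun_relation[OF nz _ ll, of "q*u"] u by (simp add: h_def PP_def mult.assoc)
    moreover have "l + l' - (1/A + 1/B + 1/C + 1/D) * (q*u) + (1 + q) * (q*u)^2 / q = (q*u)^2 * T"
    proof -
      have "a - e * w + b * w^2 / q = w^2 * (a * (1/w)^2 - e * (1/w) + b / q)" if "w \<noteq> 0" for a b e w
        using that by (simp add: field_simps power2_eq_square)
      thus ?thesis unfolding T_def using u by simp
    qed
    ultimately have "l * PP (q*u) * h (q*(q*u)) + l' * h u - (q*u)^2 * T * h (q*u) = 0"
      by (simp only:)
    hence h1: "l * PP (q*u) * h (q*(q*u)) = (q*u)^2 * T * h (q*u) - l' * h u"
      by (simp add: algebra_simps)
    have P': "q * u^2 * PP' = l' / u^2 * (l * PP u)"
    proof -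
      have *: "1 - q * (1/(q*u))/P = - (1 - P*u) / (P*u)" if "P \<noteq> 0" for P
        using u that by (simp add: field_simps)
      have "PP' = PP u / (A*B*C*D*u^4)"
      proof -
        have "(- a / w) * (- b / x) * (- c / y) * (- d / t) = a * b * c * d / (w * x * y * t)"
          for a b c d w x y t :: complex by simp
        moreover have "(A*u) * (B*u) * (C*u) * (D*u) = A*B*C*D*u^4"
          by (simp add: power4_eq_xxxx mult_ac)
        ultimately show ?thesis
          unfolding PP'_def *[OF nz(1)] *[OF nz(2)] *[OF nz(3)] *[OF nz(4)] PP_def by (simp only:)
      qed
      hence "q * u^2 * PP' = q / (A*B*C*D) * PP u / u^2"
        using u nz by (simp add: power4_eq_xxxx power2_eq_square)
      thus ?thesis unfolding ll[symmetric] by (simp add: mult_ac)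
    qed
    have "M (q*u) = h (q*u) * (T * k (1/(q*u)) - PP' / q * k (1/u)) * (q*u)^2
        - ((q*u)^2 * T * h (q*u) - l' * h u) * k (1/(q*u))"
      unfolding M_def k1 h1[symmetric] by (simp add: mult_ac)
    also have "\<dots> = l' * h u * k (1/(q*u)) - (q * u^2 * PP') * h (q*u) * k (1/u)"
      by (simp add: algebra_simps power2_eq_square)
    also have "\<dots> = l' / u^2 * M u"
      unfolding P' M_def using u by (simp add: algebra_simps)
    finally show ?thesis .
  qed
  have Pnz: "P \<noteq> 0" "P \<notin> q_lattice" "P * l' \<notin> q_lattice" using P g by (auto simp: generic_def)
  have "M (1/w) = 0"
  proof (rule quadratic_multiplier_eq_0[OF hol mult l(2), of "1/P"])
    show "M (1/P) = 0"
      using P Pnz nz by (auto simp: M_def PP_def)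
    show "M 1 = 0" using eq0 by (simp add: M_def PP_def h_def mult_ac)
    show "1/P \<notin> q_lattice" using q_lattice_inverse[of "1/P"] Pnz by auto
    show "l' / (1/P) \<notin> q_lattice" using Pnz by (simp add: mult.commute)
  qed (use Pnz w nz in auto)
  moreover have "M (1/w) = h (1/w) * k (w/q) / w^2"
    using w(1) nz by (auto simp: M_def PP_def power_divide)
  ultimately have "h (1/w) = 0" using w nz by auto
  moreover have "h (1/w) \<noteq> 0"
    using w(1) nz g ne by (auto simp: h_def gfun_at_B gfun_at_C generic_def qinf_nonzero)
  ultimately show False by simp
qed

end

subsection \<open>Solutions of the recurrence\<close>

lemma is_solution_permute:
  "is_solution q A B C D z X \<longleftrightarrow> is_solution q B A C D z X"
  "is_solution q A B C D z X \<longleftrightarrow> is_solution q A C B D z X"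
  "is_solution q A B C D z X \<longleftrightarrow> is_solution q A B D C z X"
  by (simp_all add: is_solution_def rec_a_def rec_b2_def mult_ac add_ac)

lemma is_solution_linear:
  assumes "is_solution q A B C D z X" "is_solution q A B C D z Y"
  shows "is_solution q A B C D z (\<lambda>n. c * X n + d * Y n)"
proof -
  have lin: "(c * x2 + d * y2) - t * (c * x1 + d * y1) + b * (c * x0 + d * y0) = 0"
    if "x2 - t * x1 + b * x0 = 0" "y2 - t * y1 + b * y0 = 0" for x0 x1 x2 y0 y1 y2 t b :: complex
    using that by algebra
  show ?thesis
    unfolding is_solution_def
  proof (intro allI impI lin)
    fix n :: nat assume "1 \<le> n"
    thus "X (n + 1) - (z - rec_a q A B C D n) * X n + rec_b2 q A B C D n * X (n - 1) = 0"
      "Y (n + 1) - (z - rec_a q A B C D n) * Y n + rec_b2 q A B C D n * Y (n - 1) = 0"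
      using assms unfolding is_solution_def by blast+
  qed
qed

lemma is_solution_eq_0:
  assumes "is_solution q A B C D z X" "X 0 = 0" "X 1 = 0"
  shows "X n = 0"
proof -
  have "X n = 0 \<and> X (Suc n) = 0"
  proof (induction n)
    case (Suc n)
    have "X (Suc n + 1) - (z - rec_a q A B C D (Suc n)) * X (Suc n)
        + rec_b2 q A B C D (Suc n) * X (Suc n - 1) = 0"
      using assms(1) unfolding is_solution_def by (metis le_add1 plus_1_eq_Suc)
    thus ?case using Suc by simp
  qed (use assms in auto)
  thus ?thesis ..
qed

lemma lin_indep2I:
  assumes "X 0 * Y 1 - X 1 * Y 0 \<noteq> 0"
  shows "lin_indep2 X Y"
  unfolding lin_indep2_def
proof (intro allI impI)
  fix c d assume h: "\<forall>n. c * X n + d * Y n = 0"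
  have e0: "c * X 0 + d * Y 0 = 0" and e1: "c * X 1 + d * Y 1 = 0" using h by blast+
  have "c * (X 0 * Y 1 - X 1 * Y 0) = 0" "d * (X 0 * Y 1 - X 1 * Y 0) = 0"
    using e0 e1 by algebra+
  thus "c = 0 \<and> d = 0" using assms by simp
qed

lemma lin_indep2_sym: "lin_indep2 X Y \<Longrightarrow> lin_indep2 Y X"
  unfolding lin_indep2_def by (metis add.commute)

lemma lin_indep2_casoratian:
  assumes X: "is_solution q A B C D z X" and Y: "is_solution q A B C D z Y" and "lin_indep2 X Y"
  shows "X 0 * Y 1 - X 1 * Y 0 \<noteq> 0"
proof
  assume W: "X 0 * Y 1 - X 1 * Y 0 = 0"
  have dep: "c = 0 \<and> d = 0" if "c * X 0 + d * Y 0 = 0" "c * X 1 + d * Y 1 = 0" for c d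
  proof -
    define Z where "Z = (\<lambda>n. c * X n + d * Y n)"
    have "is_solution q A B C D z Z" unfolding Z_def by (rule is_solution_linear[OF X Y])
    hence "Z n = 0" for n
      by (rule is_solution_eq_0) (simp_all only: Z_def that)
    hence "\<forall>n. c * X n + d * Y n = 0" by (simp add: Z_def)
    thus ?thesis using \<open>lin_indep2 X Y\<close> unfolding lin_indep2_def by blast
  qed
  \<comment> \<open>A vanishing Casoratian makes (Y 0, - X 0) and (Y 1, - X 1) coefficients of
    vanishing combinations. Independence annihilates all four values, and then (1, 0) is such a pair
    of coefficients too.\<close>
  have "Y 0 = 0 \<and> - X 0 = 0" using W by (intro dep) (auto simp: algebra_simps)
  moreover have "Y 1 = 0 \<and> - X 1 = 0" using W by (intro dep) (auto simp: algebra_simps)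
  ultimately have "(1::complex) = 0 \<and> (0::complex) = 0" by (intro dep) auto
  thus False by simp
qed

text \<open>Once the perturbation is below r (1 - |\<kappa>|)/2, its accumulated effect is at most
  r/2, and the contribution of the initial value decays geometrically.\<close>

lemma contraction_tendsto_0:
  fixes D \<epsilon> :: "nat \<Rightarrow> complex"
  assumes rec: "\<And>n. n \<ge> N \<Longrightarrow> D (Suc n) = \<kappa> * D n + \<epsilon> n" and \<kappa>: "norm \<kappa> < 1" and \<epsilon>: "\<epsilon> \<longlonglongrightarrow> 0"
  shows "D \<longlonglongrightarrow> 0"
proof (rule LIMSEQ_I)
  fix r :: real assume r: "r > 0"
  have "r * (1 - norm \<kappa>) / 2 > 0" using r \<kappa> by simp
  from LIMSEQ_D[OF \<epsilon> this] obtain M where M: "\<And>n. n \<ge> M \<Longrightarrow> norm (\<epsilon> n) < r * (1 - norm \<kappa>) / 2"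
    by auto
  define K where "K = max M N"
  have bd: "norm (D (K + j)) \<le> norm \<kappa> ^ j * norm (D K) + r / 2" for j
  proof (induction j)
    case (Suc j)
    have "norm (D (K + Suc j)) \<le> norm \<kappa> * norm (D (K + j)) + norm (\<epsilon> (K + j))"
      using rec[of "K + j"] norm_triangle_ineq[of "\<kappa> * D (K + j)" "\<epsilon> (K + j)"]
      by (simp add: K_def norm_mult)
    also have "\<dots> \<le> norm \<kappa> * (norm \<kappa> ^ j * norm (D K) + r / 2) + r * (1 - norm \<kappa>) / 2"
      using Suc less_imp_le[OF M[of "K + j"]] by (intro add_mono mult_left_mono) (simp_all add: K_def)
    also have "\<dots> = norm \<kappa> ^ Suc j * norm (D K) + r / 2" by (simp add: field_simps)
    finally show ?case .
  qed (use r in simp)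
  have "(\<lambda>j. norm \<kappa> ^ j * norm (D K)) \<longlonglongrightarrow> 0 * norm (D K)"
    using \<kappa> by (intro tendsto_mult_right LIMSEQ_power_zero) auto
  hence "\<forall>\<^sub>F j in sequentially. norm \<kappa> ^ j * norm (D K) < r / 2"
    by (rule order_tendstoD) (use r in simp)
  then obtain J where J: "\<And>j. j \<ge> J \<Longrightarrow> norm \<kappa> ^ j * norm (D K) < r / 2"
    by (auto simp: eventually_sequentially)
  show "\<exists>n0. \<forall>n\<ge>n0. norm (D n - 0) < r"
  proof (intro exI[of _ "K + J"] allI impI)
    fix n assume n: "n \<ge> K + J"
    hence "J \<le> n - K" "K + (n - K) = n" by linarith+
    thus "norm (D n - 0) < r"
      using bd[of "n - K"] J[of "n - K"] by simp
  qed
qed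

context q_base
begin

section \<open>From the entire solutions to the sequences\<close>

lemma rec_b2_Suc:
  "rec_b2 q A B C D (Suc m) =
     q / (A*B*C*D) * ((1 - A * q^m) * (1 - B * q^m) * (1 - C * q^m) * (1 - D * q^m))"
  by (simp add: rec_b2_def)

lemma rec_a_eq:
  "rec_a q A B C D n = (1/A + 1/B + 1/C + 1/D) * q ^ n - (1 + q) * (q ^ n)^2 / q"
proof -
  have "q powi (2 * int n - 1) = q powi (int (2 * n)) / q"
    by (subst power_int_diff) simp_all
  also have "\<dots> = (q ^ n)^2 / q" by (simp only: power_int_of_nat power_mult[symmetric] mult.commute)
  finally show ?thesis by (simp add: rec_a_def)
qed

lemma is_solutionI:
  assumes "\<And>m. X (Suc (Suc m)) - (z - (1/A + 1/B + 1/C + 1/D) * q ^ Suc m + (1 + q) * (q ^ Suc m)^2 / q) * X (Suc m)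
    + q / (A*B*C*D) * ((1 - A * q^m) * (1 - B * q^m) * (1 - C * q^m) * (1 - D * q^m)) * X m = 0"
  shows "is_solution q A B C D z X"
  unfolding is_solution_def
proof (intro allI impI)
  fix n :: nat assume "1 \<le> n"
  then obtain m where "n = Suc m" by (cases n) auto
  moreover have "z - rec_a q A B C D n = z - (1/A + 1/B + 1/C + 1/D) * q ^ n + (1 + q) * (q ^ n)^2 / q"
    by (simp add: rec_a_eq)
  ultimately show "X (n + 1) - (z - rec_a q A B C D n) * X n + rec_b2 q A B C D n * X (n - 1) = 0"
    using assms[of m] rec_b2_Suc[of A B C D m] by (simp only: Suc_eq_plus1 diff_add_inverse2)
qed

text \<open>What remains of \<open>X1\<close> without the power of l. The finite products in its
  denominator have merged into infinite ones, so that a limit in n exists.\<close>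

definition X1_amp :: "complex \<Rightarrow> complex \<Rightarrow> complex \<Rightarrow> complex \<Rightarrow> complex \<Rightarrow> nat \<Rightarrow> complex" where
  "X1_amp A B C D l n = qpoch q A n * qpoch q B n * qpoch q C n * qpoch q D n *
     gfun A B C D l (q ^ n) / (qinf (B*C*D*l) * qinf (A*B*C*l) * qinf (A*D*l))"

lemma X1_eq:
  assumes "X1_defined q A B C D l"
  shows "X1 q A B C D l n = l ^ n * X1_amp A B C D l n"
proof -
  have h: "B*C*D*l * q^n \<notin> q_poles q" "A*B*C*l * q^n \<notin> q_poles q" "A*D*l \<notin> q_poles q" for n
    using assms by (auto simp: X1_defined_def phi32_defined_def)
  have p: "phi32 q (B*C*l) (B * q^n) (C * q^n) (B*C*D*l * q^n) (A*B*C*l * q^n) (A*D*l) =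
      gfun A B C D l (q ^ n) / (qinf (B*C*D*l * q^n) * qinf (A*B*C*l * q^n) * qinf (A*D*l))"
  proof -
    have "(B*C*l) * (A*D*l) = A*B*C*D*l^2" by (simp add: power2_eq_square mult_ac)
    thus ?thesis by (simp only: phi32_eq_psi[OF h] gfun_def)
  qed
  show ?thesis
    unfolding X1_def p X1_amp_def qinf_eq_qpoch[of "B*C*D*l" n] qinf_eq_qpoch[of "A*B*C*l" n]
    by (simp add: mult_ac)
qed

lemma X1_defined_nonzero:
  assumes "X1_defined q A B C D l"
  shows "qinf (B*C*D*l) * qinf (A*B*C*l) * qinf (A*D*l) \<noteq> 0"
proof -
  have "phi32_defined q (B*C*D*l * q^0) (A*B*C*l * q^0) (A*D*l)"
    using assms unfolding X1_defined_def by blast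
  thus ?thesis by (simp add: phi32_defined_def qinf_eq_0_iff)
qed

lemma X1_solution:
  assumes nz: "A \<noteq> 0" "B \<noteq> 0" "C \<noteq> 0" "D \<noteq> 0" and ll: "l * l' = q / (A*B*C*D)"
    and def: "X1_defined q A B C D l"
  shows "is_solution q A B C D (l + l') (X1 q A B C D l)"
proof (rule is_solutionI)
  fix m
  define u where "u = q ^ Suc m"
  define g where "g = gfun A B C D l"
  define T where "T = l + l' - (1/A + 1/B + 1/C + 1/D) * u + (1 + q) * u^2 / q"
  define c where "c = 1 / (qinf (B*C*D*l) * qinf (A*B*C*l) * qinf (A*D*l))"
  define F where "F = c * qpoch q A m * qpoch q B m * qpoch q C m * qpoch q D m * l ^ m"
  define b where "b = (1 - A * q^m) * (1 - B * q^m) * (1 - C * q^m) * (1 - D * q^m)"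
  have X0: "X1 q A B C D l m = F * g (u / q)"
    by (simp add: X1_eq[OF def] X1_amp_def F_def c_def g_def u_def)
  have X1': "X1 q A B C D l (Suc m) = F * b * l * g u"
    by (simp add: X1_eq[OF def] X1_amp_def F_def c_def g_def u_def qpoch_Suc b_def mult_ac)
  have X2': "X1 q A B C D l (Suc (Suc m)) =
      F * b * l * (l * (1 - A*u) * (1 - B*u) * (1 - C*u) * (1 - D*u) * g (q*u))"
    unfolding X1_eq[OF def] X1_amp_def qpoch_Suc
    by (simp add: F_def c_def g_def b_def u_def mult_ac)
  have "F * b * l * (w * g2) - T * (F * b * l * g1) + (l * l') * b * (F * g0) =
      F * b * l * (w * g2 + l' * g0 - T * g1)" for w g0 g1 g2 by (simp add: algebra_simps)
  moreover have "l * (1 - A*u) * (1 - B*u) * (1 - C*u) * (1 - D*u) * g (q*u) + l' * g (u/q) - T * g u = 0"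
    unfolding g_def T_def using nz ll by (intro gfun_relation) (auto simp: u_def)
  ultimately show "X1 q A B C D l (Suc (Suc m)) -
    (l + l' - (1/A + 1/B + 1/C + 1/D) * q ^ Suc m + (1 + q) * (q ^ Suc m)^2 / q) * X1 q A B C D l (Suc m)
    + q / (A*B*C*D) * ((1 - A * q^m) * (1 - B * q^m) * (1 - C * q^m) * (1 - D * q^m)) * X1 q A B C D l m = 0"
    unfolding X0 X1' X2' u_def[symmetric] T_def[symmetric] b_def[symmetric] ll[symmetric]
    by (metis mult_zero_right)
qed

text \<open>The common form of \<open>X2\<close>, ..., \<open>X5\<close>: attached to P, with
  partner Q.\<close>

definition XP ::
  "complex \<Rightarrow> complex \<Rightarrow> complex \<Rightarrow> complex \<Rightarrow> complex \<Rightarrow> complex \<Rightarrow> nat \<Rightarrow> complex" where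
  "XP P Q R S l l' n = (qpoch q P n * qpoch q Q n) / (P*Q) ^ n *
     phi32 q (P * q^n) (P*Q*l) (P*Q*l') (P*q/R) (P*q/S) (q powi (1 - int n) / Q)"

definition XP_defined :: "complex \<Rightarrow> complex \<Rightarrow> complex \<Rightarrow> complex \<Rightarrow> bool" where
  "XP_defined P Q R S \<longleftrightarrow> (\<forall>n::nat. phi32_defined q (P*q/R) (P*q/S) (q powi (1 - int n) / Q))"

text \<open>The product equals (-1)^n q^(n(n-1)/2).\<close>

definition tri :: "nat \<Rightarrow> complex" where
  "tri n = (\<Prod>j<n. - (q ^ j))"

text \<open>Reversal of the finite product. It is stated multiplied out because (q/P)_inf may
  vanish.\<close>

lemma qpoch_reflect:
  assumes "P \<noteq> 0"
  shows "qpoch q P n * qinf (q / P) = P ^ n * tri n * qinf (q / (P * q ^ n))"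
proof (induction n)
  case (Suc n)
  have *: "qinf (q / (P * q ^ Suc n)) = (1 - 1 / (P * q ^ n)) * qinf (q / (P * q ^ n))"
    using qinf_step[of "1 / (P * q ^ n)"] by (simp add: mult_ac)
  have "P ^ Suc n * tri (Suc n) * qinf (q / (P * q ^ Suc n)) =
      (P * (- (q ^ n)) * (1 - 1 / (P * q ^ n))) * (P ^ n * tri n * qinf (q / (P * q ^ n)))"
    unfolding * by (simp add: tri_def mult_ac)
  also have "P * (- (q ^ n)) * (1 - 1 / (P * q ^ n)) = 1 - P * q ^ n"
    using assms by (simp add: field_simps)
  also have "(1 - P * q ^ n) * (P ^ n * tri n * qinf (q / (P * q ^ n))) =
      qpoch q P (Suc n) * qinf (q / P)"
    unfolding Suc[symmetric] by (simp add: qpoch_Suc mult_ac)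
  finally show ?case ..
qed (simp add: qpoch_def tri_def)

text \<open>Reversing (Q)_n cancels the factor (q^(1-n)/Q)_inf in the denominator of the continued
  series. The product (P)_n is kept as it is: reversing it would introduce a division by (q/P)_inf,
  which may be 0 here.\<close>

lemma XP_eq:
  assumes nz: "P \<noteq> 0" "Q \<noteq> 0" and def: "XP_defined P Q R S"
  shows "XP P Q R S l l' n = 1 / (qinf (P*q/R) * qinf (P*q/S) * qinf (q/Q)) *
     (qpoch q P n / P ^ n * tri n * rfun P Q R S l l' (1 / q ^ n))"
proof -
  have h: "P*q/R \<notin> q_poles q" "P*q/S \<notin> q_poles q" "q powi (1 - int n) / Q \<notin> q_poles q" for n
    using def by (auto simp: XP_defined_def phi32_defined_def)
  have pw: "q powi (1 - int n) / Q = q / (Q * q ^ n)" for n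
    by (simp add: power_int_diff)
  have w: "q * (1 / q ^ n) / Q = q / (Q * q ^ n)" by simp
  have a: "P * q ^ n * (q / (Q * q ^ n)) = q * P / Q" by simp
  have p: "phi32 q (P * q^n) (P*Q*l) (P*Q*l') (P*q/R) (P*q/S) (q / (Q * q ^ n)) =
      rfun P Q R S l l' (1 / q ^ n) / (qinf (P*q/R) * qinf (P*q/S) * qinf (q / (Q * q ^ n)))"
    unfolding rfun_def w by (simp only: phi32_eq_psi[OF h(1,2) h(3)[of n, unfolded pw]] a)
  have n0: "qinf (q / (Q * q ^ n)) \<noteq> 0" "qinf (q / Q) \<noteq> 0"
    using h(3)[of n] h(3)[of 0] unfolding pw by (simp_all add: qinf_eq_0_iff)
  have Q: "qpoch q Q n = Q ^ n * tri n * qinf (q / (Q * q ^ n)) / qinf (q / Q)"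
    using qpoch_reflect[OF nz(2), of n] n0 by (simp add: field_simps)
  show ?thesis
    unfolding XP_def pw p Q using nz n0 by (simp add: power_mult_distrib) (simp add: mult_ac)
qed

lemma XP_solution:
  assumes nz: "P \<noteq> 0" "Q \<noteq> 0" "R \<noteq> 0" "S \<noteq> 0" and ll: "l * l' = q / (P*Q*R*S)"
    and def: "XP_defined P Q R S"
  shows "is_solution q P Q R S (l + l') (XP P Q R S l l')"
proof (rule is_solutionI)
  fix m
  define u where "u = q ^ Suc m"
  have u: "u \<noteq> 0" "q ^ m = u / q" by (simp_all add: u_def)
  define r where "r = rfun P Q R S l l'"
  define e where "e = 1/P + 1/Q + 1/R + 1/S"
  define F where "F = 1 / (qinf (P*q/R) * qinf (P*q/S) * qinf (q/Q)) * (qpoch q P m / P ^ m * tri m)"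
  have X0: "XP P Q R S l l' m = F * r (q * (1/u))"
    by (simp add: XP_eq[OF nz(1,2) def] F_def r_def u_def)
  have X1': "XP P Q R S l l' (Suc m) = F * (- (u/q) * (1 - P*(u/q)) / P) * r (1/u)"
    by (simp add: XP_eq[OF nz(1,2) def] F_def r_def u_def qpoch_Suc tri_def mult_ac)
  have X2': "XP P Q R S l l' (Suc (Suc m)) =
      F * (u/q * u * (1 - P*(u/q)) * (1 - P*u) / P^2) * r (1/u/q)"
    unfolding XP_eq[OF nz(1,2) def] qpoch_Suc
    by (simp add: F_def r_def u_def tri_def power2_eq_square mult_ac)
  \<comment> \<open>The factor by which \<open>rfun_relation\<close> at v = 1/u has to be
    multiplied, as found from the middle coefficient; \<open>c2\<close> and \<open>c0\<close>
    confirm it for the outer ones.\<close>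
  define K where "K = F * (1 - P*(u/q)) * (- (u^3) / (q*P))"
  have rel: "(1 - (1/u)/P) * r (1/u/q) - ((l + l') * (1/u)^2 - e * (1/u) + (1 + q)/q) * r (1/u)
    + (1 - q * (1/u)/Q) * (1 - q * (1/u)/R) * (1 - q * (1/u)/S) / q * r (q * (1/u)) = 0"
    unfolding r_def e_def by (rule rfun_relation[OF nz ll])
  have c2: "F * (u/q * u * (1 - P*(u/q)) * (1 - P*u) / P^2) = K * (1 - (1/u)/P)"
    using u(1) nz by (simp add: K_def field_simps power2_eq_square power3_eq_cube)
  have c1: "(l + l' - e * u + (1 + q) * u^2 / q) * (F * (- (u/q) * (1 - P*(u/q)) / P)) =
     K * ((l + l') * (1/u)^2 - e * (1/u) + (1 + q)/q)"
  proof -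
    have "l + l' - e * u + (1 + q) * u^2 / q = u^2 * ((l + l') * (1/u)^2 - e * (1/u) + (1 + q)/q)"
      using u(1) by (simp add: field_simps power2_eq_square)
    thus ?thesis by (simp add: K_def power2_eq_square power3_eq_cube mult_ac)
  qed
  have c0: "q / (P*Q*R*S) * ((1 - P*(u/q)) * (1 - Q*(u/q)) * (1 - R*(u/q)) * (1 - S*(u/q))) * F =
     K * ((1 - q * (1/u)/Q) * (1 - q * (1/u)/R) * (1 - q * (1/u)/S) / q)"
  proof -
    have *: "1 - q * (1/u)/Y = - q / (u * Y) * (1 - Y*(u/q))" if "Y \<noteq> 0" for Y
      using u(1) that by (simp add: field_simps)
    show ?thesis
      unfolding *[OF nz(2)] *[OF nz(3)] *[OF nz(4)] K_def
      using u(1) nz by (simp add: power3_eq_cube mult_ac)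
  qed
  have "K * k2 * x2 - K * k1 * x1 + K * k0 * x0 = K * (k2 * x2 - k1 * x1 + k0 * x0)" for k0 k1 k2 x0 x1 x2
    by (simp add: algebra_simps)
  from this[of "1 - (1/u)/P" "r (1/u/q)"] show
    "XP P Q R S l l' (Suc (Suc m)) -
    (l + l' - (1/P + 1/Q + 1/R + 1/S) * q ^ Suc m + (1 + q) * (q ^ Suc m)^2 / q) * XP P Q R S l l' (Suc m)
    + q / (P*Q*R*S) * ((1 - P * q^m) * (1 - Q * q^m) * (1 - R * q^m) * (1 - S * q^m)) * XP P Q R S l l' m = 0"
    unfolding X0 X1' X2' u_def[symmetric] u(2) e_def[symmetric]
    using c0 c1 c2 rel by (metis (no_types, lifting) mult.assoc mult_zero_right)
qed


lemma X2_eq_XP: "X2 q A B C D lp lm = XP A B C D lp lm"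
  by (simp add: fun_eq_iff X2_def XP_def)

lemma X3_eq_XP: "X3 q A B C D lp lm = XP B A C D lp lm"
  by (simp add: fun_eq_iff X3_def XP_def mult_ac)

lemma X4_eq_XP: "X4 q A B C D lp lm = XP C B A D lp lm"
  by (simp add: fun_eq_iff X4_def XP_def mult_ac)

lemma X5_eq_XP: "X5 q A B C D lp lm = XP D B C A lp lm"
  by (simp add: fun_eq_iff X5_def XP_def mult_ac)

lemma X2345_defined:
  "X2_defined q A B C D \<longleftrightarrow> XP_defined A B C D" "X3_defined q A B C D \<longleftrightarrow> XP_defined B A C D"
  "X4_defined q A B C D \<longleftrightarrow> XP_defined C B A D" "X5_defined q A B C D \<longleftrightarrow> XP_defined D B C A"
  by (simp_all add: X2_defined_def X3_defined_def X4_defined_def X5_defined_def XP_defined_def)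

lemma all_solutions:
  assumes nz: "A \<noteq> 0" "B \<noteq> 0" "C \<noteq> 0" "D \<noteq> 0"
    and z: "lp + lm = z" and ll: "lp * lm = q / (A*B*C*D)"
  shows "X1_defined q A B C D lp \<longrightarrow> is_solution q A B C D z (X1 q A B C D lp)"
    and "X1_defined q A B C D lm \<longrightarrow> is_solution q A B C D z (X1 q A B C D lm)"
    and "X2_defined q A B C D \<longrightarrow> is_solution q A B C D z (X2 q A B C D lp lm)"
    and "X3_defined q A B C D \<longrightarrow> is_solution q A B C D z (X3 q A B C D lp lm)"
    and "X4_defined q A B C D \<longrightarrow> is_solution q A B C D z (X4 q A B C D lp lm)"
    and "X5_defined q A B C D \<longrightarrow> is_solution q A B C D z (X5 q A B C D lp lm)"
proof -
  show "X1_defined q A B C D lp \<longrightarrow> is_solution q A B C D z (X1 q A B C D lp)"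
    using X1_solution[OF nz ll] z by simp
  have "lm * lp = q / (A*B*C*D)" using ll by (simp add: mult.commute)
  from X1_solution[OF nz this] z
  show "X1_defined q A B C D lm \<longrightarrow> is_solution q A B C D z (X1 q A B C D lm)"
    by (simp add: add.commute)
  show "X2_defined q A B C D \<longrightarrow> is_solution q A B C D z (X2 q A B C D lp lm)"
    using XP_solution[OF nz ll] z by (simp add: X2345_defined X2_eq_XP)
  have "XP_defined B A C D \<longrightarrow> is_solution q B A C D z (XP B A C D lp lm)"
    using XP_solution[of B A C D lp lm] nz ll z by (simp add: mult_ac)
  thus "X3_defined q A B C D \<longrightarrow> is_solution q A B C D z (X3 q A B C D lp lm)"
    unfolding X2345_defined X3_eq_XP using is_solution_permute(1) by blast
  have "XP_defined C B A D \<longrightarrow> is_solution q C B A D z (XP C B A D lp lm)"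
    using XP_solution[of C B A D lp lm] nz ll z by (simp add: mult_ac)
  thus "X4_defined q A B C D \<longrightarrow> is_solution q A B C D z (X4 q A B C D lp lm)"
    unfolding X2345_defined X4_eq_XP using is_solution_permute(1,2) by blast
  have "XP_defined D B C A \<longrightarrow> is_solution q D B C A z (XP D B C A lp lm)"
    using XP_solution[of D B C A lp lm] nz ll z by (simp add: mult_ac)
  thus "X5_defined q A B C D \<longrightarrow> is_solution q A B C D z (X5 q A B C D lp lm)"
    unfolding X2345_defined X5_eq_XP
    using is_solution_permute(1)[of q D B C A] is_solution_permute(2)[of q B D C A]
      is_solution_permute(3)[of q B C D A] is_solution_permute(2)[of q B C A D]
      is_solution_permute(1)[of q B A C D] by blast
qed

subsection \<open>Pairwise independence\<close>

lemma q_lattice_shift: "a * q ^ n \<in> q_lattice \<longleftrightarrow> a \<in> q_lattice"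
  using q_lattice_mult[of a "q ^ n"] q_lattice_mult[of "a * q ^ n" "1 / q ^ n"] by auto

lemma not_in_q_poles: "a \<notin> q_lattice \<Longrightarrow> a \<notin> q_poles q"
  using q_poles_subset_lattice by blast

lemma generic_sym: "generic l l' T \<Longrightarrow> generic l' l T"
  using q_lattice_inverse[of "l' / l"] by (auto simp: generic_def)

text \<open>Distinctness follows because equal parameters have quotient 1, which lies in the
  lattice.\<close>

lemma general_position_generic:
  assumes nz: "A \<noteq> 0" "B \<noteq> 0" "C \<noteq> 0" "D \<noteq> 0" and gp: "general_position q A B C D lp lm"
  shows "generic lp lm {A, B, C, D}" "distinct [A, B, C, D]"
proof -
  define P where "P = [A, B, C, D]"
  have 1: "lp / lm \<notin> q_lattice"
    and 2: "\<And>i. i < 4 \<Longrightarrow> P!i \<notin> q_lattice \<and> P!i * lp \<notin> q_lattice \<and> P!i * lm \<notin> q_lattice"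
    and 3: "\<And>i j. i < 4 \<Longrightarrow> j < 4 \<Longrightarrow> i \<noteq> j \<Longrightarrow>
      P!i / P!j \<notin> q_lattice \<and> P!i * P!j * lp \<notin> q_lattice \<and> P!i * P!j * lm \<notin> q_lattice"
    using gp unfolding general_position_def Let_def q_lattice_def P_def by blast+
  have set: "set P = {A, B, C, D}" "length P = 4" by (auto simp: P_def)
  have Pnz: "x \<noteq> 0" if "x \<in> set P" for x using that nz by (auto simp: P_def)
  show "distinct [A, B, C, D]"
    unfolding P_def[symmetric] distinct_conv_nth
  proof (intro allI impI)
    fix i j assume ij: "i < length P" "j < length P" "i \<noteq> j"
    have "P!i / P!j \<notin> q_lattice" using 3[of i j] ij set(2) by simp
    moreover have "P!i / P!i = 1" using Pnz[OF nth_mem[OF ij(1)]] by simp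
    ultimately show "P!i \<noteq> P!j" by (metis q_in_lattice(2))
  qed
  have "X \<noteq> 0 \<and> X \<notin> q_lattice \<and> X * lp \<notin> q_lattice \<and> X * lm \<notin> q_lattice" if "X \<in> set P" for X
    using that 2 Pnz[OF that] set(2) by (metis in_set_conv_nth)
  moreover have "X / Y \<notin> q_lattice \<and> X * Y * lp \<notin> q_lattice \<and> X * Y * lm \<notin> q_lattice"
    if XY: "X \<in> set P" "Y \<in> set P" "X \<noteq> Y" for X Y
  proof -
    obtain i j where "X = P!i" "Y = P!j" "i < 4" "j < 4"
      using XY(1,2) set(2) by (metis in_set_conv_nth)
    thus ?thesis using 3[of i j] XY(3) by auto
  qed
  ultimately show "generic lp lm {A, B, C, D}"
    unfolding generic_def set(1)[symmetric] using 1 by blast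
qed

text \<open>The lower parameters equal q/(A l') and q/(D l'), so the conditions on the other root
  keep them off the lattice.\<close>

lemma generic_X1_defined:
  assumes g: "generic l l' {A, B, C, D}" and ne: "A \<noteq> D" and ll: "l * l' = q / (A*B*C*D)"
  shows "X1_defined q A B C D l"
proof -
  have nz: "A \<noteq> 0" "B \<noteq> 0" "C \<noteq> 0" "D \<noteq> 0" using g by (auto simp: generic_def)
  have l: "l \<noteq> 0" "l' \<noteq> 0" using ll nz by auto
  have inv: "q / a \<notin> q_lattice" if "a \<notin> q_lattice" for a
    using that q_lattice_inverse[of "q / a"] q_mult_lattice_iff(1)[of "1 / a"] q_lattice_inverse[of "1 / a"]
    by auto
  have "B*C*D*l = q / (A * l')" "A*B*C*l = q / (D * l')"
    using ll l nz by (simp_all add: field_simps)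
  hence "B*C*D*l \<notin> q_lattice" "A*B*C*l \<notin> q_lattice"
    using inv[of "A * l'"] inv[of "D * l'"] g by (simp_all add: generic_def)
  moreover have "A*D*l \<notin> q_lattice" using g ne by (auto simp: generic_def)
  ultimately show ?thesis
    unfolding X1_defined_def phi32_defined_def
    by (auto intro!: not_in_q_poles simp: q_lattice_shift)
qed

lemma generic_XP_defined:
  assumes g: "generic l l' {P, Q, R, S}" and ne: "P \<noteq> R" "P \<noteq> S"
  shows "XP_defined P Q R S"
proof -
  have "P/R \<notin> q_lattice" "P/S \<notin> q_lattice" "Q \<notin> q_lattice" "Q \<noteq> 0"
    using g ne by (auto simp: generic_def)
  moreover have "P*q/R = q * (P/R)" "P*q/S = q * (P/S)" by simp_all
  moreover have "q powi (1 - int n) / Q \<notin> q_lattice" for n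
  proof
    have eq: "q powi (1 - int n) / Q = q / (Q * q ^ n)" by (simp add: power_int_diff)
    assume "q powi (1 - int n) / Q \<in> q_lattice"
    from q_lattice_inverse[OF this] have "(Q * q ^ n) / q \<in> q_lattice" unfolding eq by simp
    from q_lattice_mult[OF q_in_lattice(1) this] have "Q * q ^ n \<in> q_lattice" by simp
    thus False using \<open>Q \<notin> q_lattice\<close> by (simp add: q_lattice_shift)
  qed
  ultimately show ?thesis
    unfolding XP_defined_def phi32_defined_def
    by (simp only: not_in_q_poles q_mult_lattice_iff simp_thms)
qed

text \<open>Only the terms 0 and 1 are recorded, as they determine the initial Casoratian; at both
  indices the power q^(n(n-1)) is 1. The zeros tell the four solutions apart.\<close>

definition attached ::
  "complex \<Rightarrow> complex \<Rightarrow> complex \<Rightarrow> complex \<Rightarrow> complex \<Rightarrow> complex \<Rightarrow> (nat \<Rightarrow> complex) \<Rightarrow> bool" where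
  "attached A B C D z P X \<longleftrightarrow> (\<exists>k c. inf_sol A B C D z k \<and> c \<noteq> 0 \<and>
     X 0 = c * k 1 \<and> X 1 = c * k (1/q) \<and> k (P/q) = 0 \<and> (\<forall>Q\<in>{A, B, C, D} - {P}. k (Q/q) \<noteq> 0))"

lemma attached_permute:
  "attached A B C D z P X \<longleftrightarrow> attached B A C D z P X"
  "attached A B C D z P X \<longleftrightarrow> attached A C B D z P X"
  "attached A B C D z P X \<longleftrightarrow> attached A B D C z P X"
proof -
  have "{A, B, C, D} = {B, A, C, D}" "{A, B, C, D} = {A, C, B, D}" "{A, B, C, D} = {A, B, D, C}"
    by blast+
  note set = this
  show "attached A B C D z P X \<longleftrightarrow> attached B A C D z P X"
    by (simp only: attached_def inf_sol_permute(1)[of A B C D] set(1))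
  show "attached A B C D z P X \<longleftrightarrow> attached A C B D z P X"
    by (simp only: attached_def inf_sol_permute(2)[of A B C D] set(2))
  show "attached A B C D z P X \<longleftrightarrow> attached A B D C z P X"
    by (simp only: attached_def inf_sol_permute(3)[of A B C D] set(3))
qed

lemma XP_attached:
  assumes g: "generic l l' {P, Q, R, S}" and ne: "distinct [P, Q, R, S]" and ll: "l * l' = q / (P*Q*R*S)"
  shows "attached P Q R S (l + l') P (XP P Q R S l l')"
proof -
  have nz: "P \<noteq> 0" "Q \<noteq> 0" "R \<noteq> 0" "S \<noteq> 0" using g by (auto simp: generic_def)
  define k where "k = kfun P Q R S l l'"
  have ne': "P \<noteq> Q" "P \<noteq> R" "P \<noteq> S" using ne by auto
  have def: "XP_defined P Q R S" by (rule generic_XP_defined[OF g ne'(2,3)])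
  have inv: "qinf (q / a) \<noteq> 0" if "a \<notin> q_lattice" for a
    using that q_lattice_inverse[of "1 / a"] q_mult_lattice_iff(1)[of "1 / a"]
    by (intro qinf_nonzero) auto
  have qP: "qinf (q / P) \<noteq> 0" "qinf (q / Q) \<noteq> 0" using inv g by (auto simp: generic_def)
  \<comment> \<open>The extra division by (q/P)_inf passes from \<open>rfun\<close> to
    \<open>kfun\<close>.\<close>
  define c where "c = 1 / (qinf (P*q/R) * qinf (P*q/S) * qinf (q/Q)) / qinf (q / P)"
  have "c \<noteq> 0"
    using generic_ratio(3)[OF g _ _ ne'(2)] generic_ratio(3)[OF g _ _ ne'(3)] qP by (simp add: c_def)
  moreover have "XP P Q R S l l' 0 = c * k 1"
    using qP(1) unfolding XP_eq[OF nz(1,2) def] by (simp add: c_def k_def kfun_def tri_def qpoch_def)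
  moreover have "XP P Q R S l l' 1 = c * k (1/q)"
  proof -
    have 1: "qinf (1 / P) = (1 - 1 / P) * qinf (q / P)"
      using qinf_step[of "1 / P"] by simp
    have 2: "qpoch q P 1 / P ^ 1 * tri 1 = 1 - 1 / P"
      using nz by (simp add: qpoch_def tri_def field_simps)
    show ?thesis
      unfolding XP_eq[OF nz(1,2) def] 2 using qP(1) 1
      by (simp add: c_def k_def kfun_def mult_ac)
  qed
  moreover have "inf_sol P Q R S (l + l') k" unfolding k_def by (rule inf_sol_kfun[OF nz ll])
  moreover have "k (P/q) = 0" unfolding k_def by (rule kfun_zero[OF nz(1)])
  moreover have "k (w/q) \<noteq> 0" if "w \<in> {P, Q, R, S} - {P}" for w
    unfolding k_def using that by (intro kfun_other_nonzero[OF g _ _ _ _ ne' ll]) auto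
  ultimately show ?thesis unfolding attached_def by blast
qed

lemma attached_independent:
  assumes g: "generic l l' {A, B, C, D}" and X: "attached A B C D z P X" and Y: "attached A B C D z Q Y"
    and PQ: "P \<in> {A, B, C, D}" "Q \<in> {A, B, C, D}" "P \<noteq> Q"
  shows "lin_indep2 X Y"
proof -
  obtain k c where k: "inf_sol A B C D z k" "c \<noteq> 0" "X 0 = c * k 1" "X 1 = c * k (1/q)" "k (P/q) = 0"
     "\<And>Q. Q \<in> {A, B, C, D} - {P} \<Longrightarrow> k (Q/q) \<noteq> 0" using X unfolding attached_def by blast
  obtain m d where m: "inf_sol A B C D z m" "d \<noteq> 0" "Y 0 = d * m 1" "Y 1 = d * m (1/q)"
     "\<And>P. P \<in> {A, B, C, D} - {Q} \<Longrightarrow> m (P/q) \<noteq> 0" using Y unfolding attached_def by blast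
  have nz: "P \<noteq> 0" "Q \<noteq> 0" using g PQ by (auto simp: generic_def)
  have "casorati k m (1/q) \<noteq> 0"
    by (rule casorati_kfun_nonzero[OF g k(1) m(1), of "P/q" "Q/q"]) (use k(5,6) m(5) PQ nz in auto)
  moreover have "X 0 * Y 1 - X 1 * Y 0 = - c * d * casorati k m (1/q)"
    unfolding k m casorati_def by (simp add: algebra_simps)
  ultimately show ?thesis using k m by (intro lin_indep2I) simp
qed

lemma X1_attached_independent:
  assumes g: "generic l l' {A, B, C, D}" and ne: "distinct [A, B, C, D]" and ll: "l * l' = q / (A*B*C*D)"
    and Y: "attached A B C D (l + l') P Y" and P: "P \<in> {A, B, C, D}"
  shows "lin_indep2 (X1 q A B C D l) Y"
proof -
  have nz: "A \<noteq> 0" "B \<noteq> 0" "C \<noteq> 0" "D \<noteq> 0" using g by (auto simp: generic_def)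
  have def: "X1_defined q A B C D l" using ne by (intro generic_X1_defined[OF g _ ll]) auto
  obtain k c where k: "inf_sol A B C D (l + l') k" "c \<noteq> 0" "Y 0 = c * k 1" "Y 1 = c * k (1/q)" "k (P/q) = 0"
     "\<And>Q. Q \<in> {A, B, C, D} - {P} \<Longrightarrow> k (Q/q) \<noteq> 0" using Y unfolding attached_def by blast
  \<comment> \<open>As B and C differ, at least one of them is not P; there \<open>k\<close> is
    nonzero and \<open>gfun\<close> is explicit.\<close>
  obtain w where w: "w \<in> {B, C}" "w \<noteq> P" using ne by auto
  define a where "a = 1 / (qinf (B*C*D*l) * qinf (A*B*C*l) * qinf (A*D*l))"
  have a: "a \<noteq> 0" using X1_defined_nonzero[OF def] by (simp add: a_def)
  define M where "M = gfun A B C D l 1 * k (1 / q)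
    - l * (1 - A) * (1 - B) * (1 - C) * (1 - D) * gfun A B C D l q * k 1"
  have "M \<noteq> 0" unfolding M_def
    by (rule connection_nonzero[OF nz ll g _ _ _ _ _ _ k(1) P k(5) w(1)]) (use ne k(6) w in auto)
  moreover have "X1 q A B C D l 0 * Y 1 - X1 q A B C D l 1 * Y 0 = a * c * M"
  proof -
    define W where "W = l * (1 - A) * (1 - B) * (1 - C) * (1 - D)"
    have "X1 q A B C D l 0 = a * gfun A B C D l 1" "X1 q A B C D l 1 = a * (W * gfun A B C D l q)"
      unfolding X1_eq[OF def] X1_amp_def a_def W_def by (simp_all add: qpoch_def mult_ac)
    thus ?thesis unfolding M_def W_def[symmetric] k(3,4) by (simp add: algebra_simps)
  qed
  ultimately show ?thesis using a k(2) by (intro lin_indep2I) simp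
qed

lemma X1_amp_tendsto:
  "X1_amp A B C D l \<longlonglongrightarrow> qinf A * qinf B * qinf C * qinf D * qinf (A*B*C*D*l^2)
     / (qinf (B*C*D*l) * qinf (A*B*C*l) * qinf (A*D*l))" if "X1_defined q A B C D l"
proof -
  have "isCont (gfun A B C D l) 0"
    using holomorphic_on_imp_continuous_on[OF gfun_holomorphic] continuous_on_eq_continuous_at by blast
  from isCont_tendsto_compose[OF this q_power_tendsto_0]
  have "(\<lambda>n. gfun A B C D l (q ^ n)) \<longlonglongrightarrow> qinf (A*B*C*D*l^2)" by (simp only: gfun_0)
  thus ?thesis
    unfolding X1_amp_def using X1_defined_nonzero[OF that]
    by (intro tendsto_divide tendsto_mult qpoch_tendsto tendsto_const) auto
qed

text \<open>General position makes both limit amplitudes nonzero. If c \<noteq> 0 in a vanishing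
  combination, then (l/l')^n converges; its limit is fixed by multiplication with l/l' \<noteq> 1,
  hence is 0, so d = 0, and the first amplitude would have to vanish. No comparison of |l| and |l'|
  enters.\<close>

lemma X1_pair_independent:
  assumes g: "generic l l' {A, B, C, D}" and ne: "distinct [A, B, C, D]" and ll: "l * l' = q / (A*B*C*D)"
  shows "lin_indep2 (X1 q A B C D l) (X1 q A B C D l')"
proof -
  have nz: "A \<noteq> 0" "B \<noteq> 0" "C \<noteq> 0" "D \<noteq> 0" using g by (auto simp: generic_def)
  have l: "l \<noteq> 0" "l' \<noteq> 0" using ll nz by auto
  have ll': "l' * l = q / (A*B*C*D)" using ll by (simp add: mult.commute)
  have def: "X1_defined q A B C D l" "X1_defined q A B C D l'"
    using ne by (auto intro!: generic_X1_defined[OF g _ ll] generic_X1_defined[OF generic_sym[OF g] _ ll'])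
  have P0: "qinf P \<noteq> 0" if "P \<in> {A, B, C, D}" for P
    using that g by (intro qinf_nonzero) (auto simp: generic_def)
  have sq: "A*B*C*D*l^2 = q * (l / l')" "A*B*C*D*l'^2 = q * (l' / l)"
    using ll l nz by (simp_all add: field_simps power2_eq_square)
  have r: "l / l' \<notin> q_lattice" "l' / l \<notin> q_lattice" using g generic_sym[OF g] by (auto simp: generic_def)
  hence sq0: "qinf (A*B*C*D*l^2) \<noteq> 0" "qinf (A*B*C*D*l'^2) \<noteq> 0"
    unfolding sq by (auto intro!: qinf_nonzero simp del: times_divide_eq_right)
  define G where "G = X1_amp A B C D l"
  define G' where "G' = X1_amp A B C D l'"
  obtain L where L: "G \<longlonglongrightarrow> L" "L \<noteq> 0"
    using X1_amp_tendsto[OF def(1)] X1_defined_nonzero[OF def(1)] P0 sq0 unfolding G_def by auto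
  obtain L' where L': "G' \<longlonglongrightarrow> L'" "L' \<noteq> 0"
    using X1_amp_tendsto[OF def(2)] X1_defined_nonzero[OF def(2)] P0 sq0 unfolding G'_def by auto
  show ?thesis
    unfolding lin_indep2_def
  proof (intro allI impI)
    fix c d assume "\<forall>n. c * X1 q A B C D l n + d * X1 q A B C D l' n = 0"
    hence h: "c * (l ^ n * G n) + d * (l' ^ n * G' n) = 0" for n
      by (simp only: X1_eq[OF def(1)] X1_eq[OF def(2)] G_def G'_def)
    obtain N where N: "G' N \<noteq> 0"
      using tendsto_imp_eventually_ne[OF L'] by (auto simp: eventually_sequentially)
    have rho: "(l / l') ^ n * (c * G n) = - d * G' n" for n
    proof -
      have "l ^ n * (c * G n) = l' ^ n * (- d * G' n)"
        using h[of n] by (simp add: add_eq_0_iff mult_ac)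
      thus ?thesis using l by (simp add: power_divide field_simps)
    qed
    have "c * L = 0"
    proof (rule ccontr)
      assume c: "c * L \<noteq> 0"
      have lim: "(\<lambda>n. c * G n) \<longlonglongrightarrow> c * L" by (intro tendsto_mult_left L)
      hence "\<forall>\<^sub>F n in sequentially. c * G n \<noteq> 0" using c by (rule tendsto_imp_eventually_ne)
      hence ev: "\<forall>\<^sub>F n in sequentially. - d * G' n / (c * G n) = (l / l') ^ n"
        by eventually_elim (use rho in \<open>simp add: field_simps\<close>)
      have "(\<lambda>n. - d * G' n / (c * G n)) \<longlonglongrightarrow> - d * L' / (c * L)"
        by (intro tendsto_divide tendsto_mult tendsto_const L' L c)
      from Lim_transform_eventually[OF this ev]
      have p: "(\<lambda>n. (l / l') ^ n) \<longlonglongrightarrow> - d * L' / (c * L)" .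
      have "(\<lambda>n. (l / l') ^ Suc n) \<longlonglongrightarrow> - d * L' / (c * L)" by (rule LIMSEQ_Suc[OF p])
      moreover have "(\<lambda>n. (l / l') ^ Suc n) \<longlonglongrightarrow> (l / l') * (- d * L' / (c * L))"
        unfolding power_Suc by (intro tendsto_mult_left p)
      ultimately have fixed: "- d * L' / (c * L) = (l / l') * (- d * L' / (c * L))"
        by (rule LIMSEQ_unique)
      have "(r - 1) * x = 0" if "x = r * x" for r x :: complex
        using that by (simp add: left_diff_distrib)
      from this[OF fixed] have "(l / l' - 1) * (- d * L' / (c * L)) = 0" .
      moreover have "l / l' \<noteq> 1" using r(1) q_in_lattice(2) by metis
      ultimately have "d = 0" using L'(2) c l by auto
      hence "c * G n = 0" for n using rho[of n] l by auto
      with lim have "(\<lambda>n::nat. 0) \<longlonglongrightarrow> c * L" by (simp only:)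
      with c show False by (simp only: LIMSEQ_const_iff)
    qed
    hence "c = 0" using L(2) by simp
    thus "c = 0 \<and> d = 0" using rho[of N] N by simp
  qed
qed


subsection \<open>The minimal solution\<close>

text \<open>The discrete Abel formula: each step multiplies the Casoratian by b_n^2.\<close>

lemma casoratian_eq:
  assumes X: "is_solution q A B C D z X" and Y: "is_solution q A B C D z Y"
    and ll: "l * l' = q / (A*B*C*D)"
  shows "X n * Y (Suc n) - X (Suc n) * Y n =
    (l * l') ^ n * (qpoch q A n * qpoch q B n * qpoch q C n * qpoch q D n) * (X 0 * Y 1 - X 1 * Y 0)"
proof (induction n)
  case (Suc n)
  define b where "b = rec_b2 q A B C D (Suc n)"
  define t where "t = z - rec_a q A B C D (Suc n)"
  have "X (Suc n + 1) - t * X (Suc n) + b * X (Suc n - 1) = 0"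
    "Y (Suc n + 1) - t * Y (Suc n) + b * Y (Suc n - 1) = 0"
    using X Y unfolding is_solution_def t_def b_def by (metis le_add1 plus_1_eq_Suc)+
  hence "X (Suc (Suc n)) - t * X (Suc n) + b * X n = 0" "Y (Suc (Suc n)) - t * Y (Suc n) + b * Y n = 0"
    by simp_all
  hence "X (Suc n) * Y (Suc (Suc n)) - X (Suc (Suc n)) * Y (Suc n) = b * (X n * Y (Suc n) - X (Suc n) * Y n)"
    by algebra
  also have "b = l * l' * ((1 - A * q^n) * (1 - B * q^n) * (1 - C * q^n) * (1 - D * q^n))"
    unfolding b_def rec_b2_Suc ll ..
  finally show ?case unfolding Suc by (simp add: qpoch_Suc mult_ac)
qed (simp add: qpoch_def)

text \<open>Reduction of order. The increments of Y_n/X_n are given by the Casoratian and grow like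
  (l'/l)^n; after rescaling by (l/l')^n they form a contraction with convergent perturbation, whose
  limit is nonzero.\<close>

lemma X1_minimal:
  assumes nz: "A \<noteq> 0" "B \<noteq> 0" "C \<noteq> 0" "D \<noteq> 0" and ll: "l * l' = q / (A*B*C*D)"
    and b2: "\<forall>n\<ge>1. rec_b2 q A B C D n \<noteq> 0"
    and def: "X1_defined q A B C D l" and less: "norm (l / l') < 1"
  shows "is_minimal q A B C D (l + l') (X1 q A B C D l)"
proof -
  define X where "X = X1 q A B C D l"
  define G where "G = X1_amp A B C D l"
  have l: "l \<noteq> 0" "l' \<noteq> 0" using ll nz by auto
  have XG: "X n = l ^ n * G n" for n unfolding X_def G_def by (rule X1_eq[OF def])
  \<comment> \<open>The condition b_n^2 \<noteq> 0 says that no factor of the infinite products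
    (A)_inf, ..., (D)_inf vanishes.\<close>
  have P0: "qinf P \<noteq> 0" if "P \<in> {A, B, C, D}" for P
  proof -
    have "P * q ^ k \<noteq> 1" for k
      using b2[rule_format, of "Suc k"] that unfolding rec_b2_Suc by auto
    thus ?thesis by (auto simp: qinf_eq_0_iff q_poles_def)
  qed
  have sol: "is_solution q A B C D (l + l') X" unfolding X_def by (rule X1_solution[OF nz ll def])
  \<comment> \<open>Nonvanishing comes from size here: the argument equals q l/l', which lies in the
    unit disc.\<close>
  have sq0: "qinf (A*B*C*D*l^2) \<noteq> 0"
  proof -
    have "A*B*C*D*l^2 = q * (l / l')" using ll l nz by (simp add: field_simps power2_eq_square)
    moreover have "norm (q * (l / l')) < 1"
      using mult_strict_mono[OF q_less less] by (simp only: norm_mult) simp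
    ultimately show ?thesis using norm_less_1_not_pole by (simp add: qinf_eq_0_iff)
  qed
  obtain L where L: "G \<longlonglongrightarrow> L" "L \<noteq> 0"
    using X1_amp_tendsto[OF def] X1_defined_nonzero[OF def] P0 sq0 unfolding G_def by auto
  obtain N where N: "\<And>n. n \<ge> N \<Longrightarrow> G n \<noteq> 0"
    using tendsto_imp_eventually_ne[OF L] by (auto simp: eventually_sequentially)
  have "X N \<noteq> 0" using N[of N] l by (simp add: XG)
  moreover have "(\<forall>\<^sub>F n in sequentially. Y n \<noteq> 0) \<and> (\<lambda>n. X n / Y n) \<longlonglongrightarrow> 0"
    if Y: "is_solution q A B C D (l + l') Y" "lin_indep2 X Y" for Y
  proof -
    define W where "W = X 0 * Y 1 - X 1 * Y 0"
    have "W \<noteq> 0" unfolding W_def by (rule lin_indep2_casoratian[OF sol Y])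
    define \<kappa> where "\<kappa> = l / l'"
    have \<kappa>: "norm \<kappa> < 1" "\<kappa> \<noteq> 0" "\<kappa> \<noteq> 1" using less l by (auto simp: \<kappa>_def)
    define \<Phi> where "\<Phi> n = qpoch q A n * qpoch q B n * qpoch q C n * qpoch q D n" for n
    define \<phi> where "\<phi> = qinf A * qinf B * qinf C * qinf D"
    define h where "h n = \<Phi> n * W / (l * G n * G (Suc n))" for n
    define h0 where "h0 = \<phi> * W / (l * L * L)"
    have "\<phi> \<noteq> 0" using P0 by (simp add: \<phi>_def)
    hence "h0 \<noteq> 0" using \<open>W \<noteq> 0\<close> l L by (simp add: h0_def)
    have h: "h \<longlonglongrightarrow> h0"
      unfolding h_def h0_def \<Phi>_def \<phi>_def
      by (intro tendsto_divide tendsto_mult tendsto_const qpoch_tendsto L LIMSEQ_Suc[OF L(1)])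
         (use l L in auto)
    define Z where "Z n = \<kappa> ^ n * (Y n / X n)" for n
    have Z_Suc: "Z (Suc n) = \<kappa> * Z n + \<kappa> * h n" if n: "n \<ge> N" for n
    proof -
      have G: "G n \<noteq> 0" "G (Suc n) \<noteq> 0" using N n by simp_all
      have Xn: "X n \<noteq> 0" "X (Suc n) \<noteq> 0" using G l by (simp_all add: XG)
      have "Y (Suc n) / X (Suc n) - Y n / X n = (X n * Y (Suc n) - X (Suc n) * Y n) / (X n * X (Suc n))"
        using Xn by (simp add: field_simps)
      also have "\<dots> = (l * l') ^ n * \<Phi> n * W / (X n * X (Suc n))"
        unfolding casoratian_eq[OF sol Y(1) ll] \<Phi>_def W_def ..
      also have "\<dots> = (l' / l) ^ n * h n"
        unfolding XG h_def using G l by (simp add: field_simps power_mult_distrib)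
      finally have "Y (Suc n) / X (Suc n) = Y n / X n + (l' / l) ^ n * h n"
        by (simp add: algebra_simps)
      moreover have "\<kappa> ^ n * (l' / l) ^ n = 1"
        using l by (simp add: \<kappa>_def power_mult_distrib[symmetric])
      ultimately have "Z (Suc n) = \<kappa> * (\<kappa> ^ n * (Y n / X n)) + \<kappa> * (\<kappa> ^ n * (l' / l) ^ n) * h n"
        unfolding Z_def by (simp add: algebra_simps)
      thus ?thesis using \<open>\<kappa> ^ n * (l' / l) ^ n = 1\<close> by (simp add: Z_def)
    qed
    \<comment> \<open>The fixed point of the limiting recursion Z = \<kappa> Z + \<kappa> h0. It is
      nonzero because the Casoratian \<open>W\<close> is.\<close>
    define \<zeta> where "\<zeta> = \<kappa> * h0 / (1 - \<kappa>)"
    have "\<zeta> \<noteq> 0" using \<kappa> \<open>h0 \<noteq> 0\<close> by (simp add: \<zeta>_def)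
    have "(\<lambda>n. Z n - \<zeta>) \<longlonglongrightarrow> 0"
    proof (rule contraction_tendsto_0[where N = N and \<kappa> = \<kappa> and \<epsilon> = "\<lambda>n. \<kappa> * (h n - h0)"])
      fix n assume n: "N \<le> n"
      have "\<zeta> = \<kappa> * \<zeta> + \<kappa> * h0" using \<kappa> by (simp add: \<zeta>_def field_simps)
      thus "Z (Suc n) - \<zeta> = \<kappa> * (Z n - \<zeta>) + \<kappa> * (h n - h0)"
        unfolding Z_Suc[OF n] by (simp add: algebra_simps)
    next
      show "(\<lambda>n. \<kappa> * (h n - h0)) \<longlonglongrightarrow> 0"
        using tendsto_mult_left[OF LIM_zero[OF h], of \<kappa>] by simp
    qed (rule \<kappa>(1))
    hence Z: "Z \<longlonglongrightarrow> \<zeta>" by (rule LIM_zero_cancel)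
    have Z0: "\<forall>\<^sub>F n in sequentially. Z n \<noteq> 0" using Z \<open>\<zeta> \<noteq> 0\<close> by (rule tendsto_imp_eventually_ne)
    have lim: "(\<lambda>n. \<kappa> ^ n / Z n) \<longlonglongrightarrow> 0 / \<zeta>"
      using \<kappa>(1) \<open>\<zeta> \<noteq> 0\<close> by (intro tendsto_divide LIMSEQ_power_zero Z)
    have "\<forall>\<^sub>F n in sequentially. \<kappa> ^ n / Z n = X n / Y n"
      using Z0 by eventually_elim (use \<kappa> in \<open>simp add: Z_def\<close>)
    from Lim_transform_eventually[OF lim this] have "(\<lambda>n. X n / Y n) \<longlonglongrightarrow> 0" by simp
    moreover have "\<forall>\<^sub>F n in sequentially. Y n \<noteq> 0"
      using Z0 by eventually_elim (simp add: Z_def)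
    ultimately show ?thesis by blast
  qed
  ultimately show ?thesis using sol unfolding is_minimal_def X_def by blast
qed

end

section \<open>Uniqueness of the minimal solution and choice of the branch\<close>

lemma minimal_scale:
  assumes X: "is_minimal q A B C D z X" and c: "c \<noteq> 0"
  shows "is_minimal q A B C D z (\<lambda>n. c * X n)"
  unfolding is_minimal_def
proof (intro conjI allI impI)
  have sol: "is_solution q A B C D z X" using X by (simp add: is_minimal_def)
  show "is_solution q A B C D z (\<lambda>n. c * X n)" using is_solution_linear[OF sol sol, of c 0] by simp
  show "\<exists>n. c * X n \<noteq> 0" using X c by (auto simp: is_minimal_def)
next
  fix Y assume Y: "is_solution q A B C D z Y \<and> lin_indep2 (\<lambda>n. c * X n) Y"
  have "lin_indep2 X Y"
    unfolding lin_indep2_def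
  proof (intro allI impI)
    fix a b assume ab: "\<forall>n. a * X n + b * Y n = 0"
    have "\<forall>n. (a / c) * (c * X n) + b * Y n = 0" using ab c by simp
    hence "a / c = 0 \<and> b = 0" using Y unfolding lin_indep2_def by blast
    thus "a = 0 \<and> b = 0" using c by simp
  qed
  hence Y': "\<forall>\<^sub>F n in sequentially. Y n \<noteq> 0" "(\<lambda>n. X n / Y n) \<longlonglongrightarrow> 0"
    using X Y by (auto simp: is_minimal_def)
  show "\<forall>\<^sub>F n in sequentially. Y n \<noteq> 0" by (rule Y')
  show "(\<lambda>n. c * X n / Y n) \<longlonglongrightarrow> 0"
    using tendsto_mult_left[OF Y'(2), of c] by simp
qed

text \<open>If two minimal solutions were independent, both quotients would tend to 0, although
  their product is eventually 1.\<close>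

lemma minimal_unique:
  assumes X: "is_minimal q A B C D z X" and Y: "is_minimal q A B C D z Y"
  obtains c where "c \<noteq> 0" "Y = (\<lambda>n. c * X n)"
proof -
  have "\<not> lin_indep2 Y X"
  proof
    assume YX: "lin_indep2 Y X"
    have l: "(\<lambda>n. Y n / X n) \<longlonglongrightarrow> 0" "\<forall>\<^sub>F n in sequentially. X n \<noteq> 0"
      using X Y YX by (auto simp: is_minimal_def)
    have l': "(\<lambda>n. X n / Y n) \<longlonglongrightarrow> 0" "\<forall>\<^sub>F n in sequentially. Y n \<noteq> 0"
      using X Y lin_indep2_sym[OF YX] by (auto simp: is_minimal_def)
    have "(\<lambda>n. (Y n / X n) * (X n / Y n)) \<longlonglongrightarrow> 0 * 0" by (intro tendsto_mult l l')
    moreover have "\<forall>\<^sub>F n in sequentially. (Y n / X n) * (X n / Y n) = 1"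
      using l(2) l'(2) by eventually_elim simp
    ultimately have "(\<lambda>n::nat. 1::complex) \<longlonglongrightarrow> 0 * 0" by (rule Lim_transform_eventually)
    thus False by (simp add: LIMSEQ_const_iff)
  qed
  then obtain a b where ab: "\<And>n. a * Y n + b * X n = 0" "\<not> (a = 0 \<and> b = 0)"
    unfolding lin_indep2_def by blast
  obtain n m where nm: "X n \<noteq> 0" "Y m \<noteq> 0" using X Y by (auto simp: is_minimal_def)
  have "a \<noteq> 0" using ab(1)[of n] ab(2) nm by auto
  have "b \<noteq> 0" using ab(1)[of m] ab(2) nm by auto
  have "Y k = (- b / a) * X k" for k
    using ab(1)[of k] \<open>a \<noteq> 0\<close> by (simp add: field_simps add_eq_0_iff)
  thus ?thesis using \<open>a \<noteq> 0\<close> \<open>b \<noteq> 0\<close> by (intro that[of "- b / a"]) auto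
qed

text \<open>Multiplied by 2\<alpha>, the two roots are reciprocal. Equal moduli would put them on
  the unit circle as complex conjugates, and their half sum x would lie in [-1, 1]. So the moduli
  differ, and the sign of s decides which root is the smaller one.\<close>

lemma ex_branch:
  fixes q A B C D z \<alpha> x :: complex
  assumes nz: "q \<noteq> 0" "A*B*C*D \<noteq> 0" and \<alpha>: "(2 * \<alpha>)^2 = A*B*C*D / q" "x = \<alpha> * z"
    and x: "x \<notin> complex_of_real ` {-1..1}"
  shows "\<exists>s. s^2 = z^2 - 4 * q / (A*B*C*D) \<and>
    (\<lambda>n. (lam_minus z s / lam_plus z s) ^ n) \<longlonglongrightarrow> 0"
proof -
  define s where "s = csqrt (z^2 - 4 * q / (A*B*C*D))"
  have s: "s^2 = z^2 - 4 * q / (A*B*C*D)" by (simp add: s_def)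
  define lp where "lp = lam_plus z s"
  define lm where "lm = lam_minus z s"
  have prod: "lp * lm = q / (A*B*C*D)"
    using s by (simp add: lp_def lm_def lam_plus_def lam_minus_def field_simps power2_eq_square)
  have sum: "lp + lm = z" by (simp add: lp_def lm_def lam_plus_def lam_minus_def field_simps)
  have ne: "norm lp \<noteq> norm lm"
  proof
    assume eq: "norm lp = norm lm"
    define \<mu> where "\<mu> = 2 * \<alpha> * lp"
    define \<nu> where "\<nu> = 2 * \<alpha> * lm"
    have "\<mu> * \<nu> = (2 * \<alpha>)^2 * (lp * lm)" by (simp add: \<mu>_def \<nu>_def power2_eq_square)
    hence 1: "\<mu> * \<nu> = 1" unfolding \<alpha> prod using nz by simp
    have "norm \<mu> = norm \<nu>" using eq by (simp add: \<mu>_def \<nu>_def norm_mult)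
    moreover have "norm \<mu> * norm \<nu> = 1" using 1 by (metis norm_mult norm_one)
    ultimately have "norm \<mu> = 1 \<or> norm \<mu> = - 1"
      by (simp add: power2_eq_1_iff flip: power2_eq_square)
    hence n: "norm \<mu> = 1" using norm_ge_zero[of \<mu>] by linarith
    have "\<mu> * cnj \<mu> = 1" using n complex_norm_square[of \<mu>] by simp
    hence "\<mu> * cnj \<mu> = \<mu> * \<nu>" using 1 by simp
    moreover have "\<mu> \<noteq> 0" using n by auto
    ultimately have "\<nu> = cnj \<mu>" by simp
    have "2 * x = \<mu> + \<nu>" by (simp add: \<mu>_def \<nu>_def \<alpha>(2) flip: sum) (simp add: algebra_simps)
    also have "\<dots> = complex_of_real (2 * Re \<mu>)" unfolding \<open>\<nu> = cnj \<mu>\<close> by (rule complex_add_cnj)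
    finally have "x = complex_of_real (Re \<mu>)" by simp
    moreover have "Re \<mu> \<in> {-1..1}" using abs_Re_le_cmod[of \<mu>] n by auto
    ultimately show False using x by blast
  qed
  have nzl: "lp \<noteq> 0" "lm \<noteq> 0" using prod nz by auto
  show ?thesis
  proof (cases "norm lm < norm lp")
    case True
    hence "norm (lm / lp) < 1" using nzl by (simp add: norm_divide)
    hence "(\<lambda>n. (lm / lp) ^ n) \<longlonglongrightarrow> 0" by (rule LIMSEQ_power_zero)
    thus ?thesis using s unfolding lp_def lm_def by blast
  next
    case False
    hence "norm (lp / lm) < 1" using ne nzl by (simp add: norm_divide)
    hence "(\<lambda>n. (lp / lm) ^ n) \<longlonglongrightarrow> 0" by (rule LIMSEQ_power_zero)
    moreover have "lp = lam_minus z (- s)" "lm = lam_plus z (- s)"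
      by (simp_all add: lp_def lm_def lam_plus_def lam_minus_def)
    moreover have "(- s)^2 = z^2 - 4 * q / (A*B*C*D)" using s by simp
    ultimately show ?thesis by metis
  qed
qed

lemma lam_sum: "lam_plus z s + lam_minus z s = z"
  by (simp add: lam_plus_def lam_minus_def field_simps)

lemma lam_prod:
  assumes "s^2 = z^2 - 4 * w"
  shows "lam_plus z s * lam_minus z s = w"
proof -
  have "lam_plus z s * lam_minus z s = (z^2 - s^2) / 4"
    by (simp add: lam_plus_def lam_minus_def power2_eq_square algebra_simps)
  thus ?thesis by (simp add: assms)
qed

lemma less_6_cases: "(i::nat) < 6 \<Longrightarrow> i = 0 \<or> i = 1 \<or> i = 2 \<or> i = 3 \<or> i = 4 \<or> i = 5"
  by linarith

lemma (in q_base) pairwise_independent: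
  assumes nz: "A \<noteq> 0" "B \<noteq> 0" "C \<noteq> 0" "D \<noteq> 0" and ll: "lp * lm = q / (A*B*C*D)"
    and gp: "general_position q A B C D lp lm" and ij: "i < 6" "j < 6" "i \<noteq> j"
  defines "X \<equiv> [X1 q A B C D lp, X1 q A B C D lm, X2 q A B C D lp lm,
                  X3 q A B C D lp lm, X4 q A B C D lp lm, X5 q A B C D lp lm]"
  shows "lin_indep2 (X!i) (X!j)"
proof -
  define z where "z = lp + lm"
  note g = general_position_generic(1)[OF nz gp] and ne = general_position_generic(2)[OF nz gp]
  have att: "attached A B C D z A (X2 q A B C D lp lm)" "attached A B C D z B (X3 q A B C D lp lm)"
    "attached A B C D z C (X4 q A B C D lp lm)" "attached A B C D z D (X5 q A B C D lp lm)"
  proof -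
    show "attached A B C D z A (X2 q A B C D lp lm)"
      unfolding X2_eq_XP z_def by (rule XP_attached[OF g ne ll])
    have "attached B A C D z B (XP B A C D lp lm)"
      unfolding z_def using g ne ll by (intro XP_attached) (auto simp: insert_commute mult_ac)
    thus "attached A B C D z B (X3 q A B C D lp lm)"
      unfolding X3_eq_XP using attached_permute(1) by blast
    have "attached C B A D z C (XP C B A D lp lm)"
      unfolding z_def using g ne ll by (intro XP_attached) (auto simp: insert_commute mult_ac)
    thus "attached A B C D z C (X4 q A B C D lp lm)"
      unfolding X4_eq_XP using attached_permute(1)[of C B A D] attached_permute(2)[of B C A D]
        attached_permute(1)[of B A C D] by blast
    have "attached D B C A z D (XP D B C A lp lm)"
      unfolding z_def using g ne ll by (intro XP_attached) (auto simp: insert_commute mult_ac)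
    thus "attached A B C D z D (X5 q A B C D lp lm)"
      unfolding X5_eq_XP using attached_permute(1)[of D B C A] attached_permute(2)[of B D C A]
        attached_permute(3)[of B C D A] attached_permute(2)[of B C A D]
        attached_permute(1)[of B A C D] by blast
  qed
  have ll': "lm * lp = q / (A*B*C*D)" using ll by (simp add: mult.commute)
  have z': "z = lm + lp" by (simp add: z_def)
  note plus = X1_attached_independent[OF g ne ll, folded z_def]
  note minus = X1_attached_independent[OF generic_sym[OF g] ne ll', folded z']
  note both = attached_independent[OF g]
  define indep where "indep i j = lin_indep2 (X!i) (X!j)" for i j :: nat
  have sym: "indep j i" if "indep i j" for i j
    using that unfolding indep_def by (rule lin_indep2_sym)
  have nth: "X!0 = X1 q A B C D lp" "X!1 = X1 q A B C D lm" "X!2 = X2 q A B C D lp lm"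
    "X!3 = X3 q A B C D lp lm" "X!4 = X4 q A B C D lp lm" "X!5 = X5 q A B C D lp lm"
    by (simp_all add: X_def)
  have mem: "A \<in> {A, B, C, D}" "B \<in> {A, B, C, D}" "C \<in> {A, B, C, D}" "D \<in> {A, B, C, D}" by simp_all
  have neq: "A \<noteq> B" "A \<noteq> C" "A \<noteq> D" "B \<noteq> C" "B \<noteq> D" "C \<noteq> D" using ne by auto
  have I: "indep 0 1" "indep 0 2" "indep 0 3" "indep 0 4" "indep 0 5"
    "indep 1 2" "indep 1 3" "indep 1 4" "indep 1 5"
    "indep 2 3" "indep 2 4" "indep 2 5" "indep 3 4" "indep 3 5" "indep 4 5"
    unfolding indep_def nth
    by (rule X1_pair_independent[OF g ne ll]
      plus[OF att(1) mem(1)] plus[OF att(2) mem(2)] plus[OF att(3) mem(3)] plus[OF att(4) mem(4)]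
      minus[OF att(1) mem(1)] minus[OF att(2) mem(2)] minus[OF att(3) mem(3)] minus[OF att(4) mem(4)]
      both[OF att(1,2) mem(1,2) neq(1)] both[OF att(1,3) mem(1,3) neq(2)]
      both[OF att(1,4) mem(1,4) neq(3)] both[OF att(2,3) mem(2,3) neq(4)]
      both[OF att(2,4) mem(2,4) neq(5)] both[OF att(3,4) mem(3,4) neq(6)])+
  have "indep i j"
    using less_6_cases[OF ij(1)] less_6_cases[OF ij(2)] ij(3)
    by (elim disjE) (simp_all only: I I[THEN sym] simp_thms)
  thus ?thesis by (simp only: indep_def)
qed

theorem theorem1:
  fixes q A B C D z :: complex
  assumes "0 < norm q" and "norm q < 1"
    and "A \<noteq> 0" and "B \<noteq> 0" and "C \<noteq> 0" and "D \<noteq> 0"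
    and "\<forall>n\<ge>1. rec_b2 q A B C D n \<noteq> 0"
  shows
    "(\<forall>s lp lm. s^2 = z^2 - 4 * q / (A*B*C*D) \<and> lp = lam_plus z s \<and> lm = lam_minus z s \<longrightarrow>
        (X1_defined q A B C D lp \<longrightarrow> is_solution q A B C D z (X1 q A B C D lp)) \<and>
        (X1_defined q A B C D lm \<longrightarrow> is_solution q A B C D z (X1 q A B C D lm)) \<and>
        (X2_defined q A B C D \<longrightarrow> is_solution q A B C D z (X2 q A B C D lp lm)) \<and>
        (X3_defined q A B C D \<longrightarrow> is_solution q A B C D z (X3 q A B C D lp lm)) \<and>
        (X4_defined q A B C D \<longrightarrow> is_solution q A B C D z (X4 q A B C D lp lm)) \<and>
        (X5_defined q A B C D \<longrightarrow> is_solution q A B C D z (X5 q A B C D lp lm)))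
     \<and>
     (\<forall>s lp lm. s^2 = z^2 - 4 * q / (A*B*C*D) \<and> lp = lam_plus z s \<and> lm = lam_minus z s \<and>
        general_position q A B C D lp lm \<longrightarrow>
        (let X = [X1 q A B C D lp, X1 q A B C D lm, X2 q A B C D lp lm,
                  X3 q A B C D lp lm, X4 q A B C D lp lm, X5 q A B C D lp lm]
         in \<forall>i<6. \<forall>j<6. i \<noteq> j \<longrightarrow> lin_indep2 (X!i) (X!j)))
     \<and>
     (\<forall>\<alpha> x. (2 * \<alpha>)^2 = A*B*C*D / q \<and> x = \<alpha> * z \<and> x \<notin> complex_of_real ` {-1..1} \<longrightarrow>
        (\<exists>s. s^2 = z^2 - 4 * q / (A*B*C*D) \<and>
             (\<lambda>n. (lam_minus z s / lam_plus z s) ^ n) \<longlonglongrightarrow> 0) \<and>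
        (\<forall>s. s^2 = z^2 - 4 * q / (A*B*C*D) \<and>
             (\<lambda>n. (lam_minus z s / lam_plus z s) ^ n) \<longlonglongrightarrow> 0 \<and>
             X1_defined q A B C D (lam_minus z s) \<longrightarrow>
             (\<forall>X. is_minimal q A B C D z X \<longleftrightarrow>
                  (\<exists>c. c \<noteq> 0 \<and> X = (\<lambda>n. c * X1 q A B C D (lam_minus z s) n)))))"
proof -
  interpret q_base q using assms(1,2) by unfold_locales
  note nz = assms(3-6)
  have q0: "q \<noteq> 0" using assms(1) by auto
  have ll: "lam_plus z s * lam_minus z s = q / (A*B*C*D)" if "s^2 = z^2 - 4 * q / (A*B*C*D)" for s
    using lam_prod[of s z "q / (A*B*C*D)"] that by simp
  show ?thesis
  proof (intro conjI)
    show "\<forall>s lp lm. s^2 = z^2 - 4 * q / (A*B*C*D) \<and> lp = lam_plus z s \<and> lm = lam_minus z s \<longrightarrow>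
        (X1_defined q A B C D lp \<longrightarrow> is_solution q A B C D z (X1 q A B C D lp)) \<and>
        (X1_defined q A B C D lm \<longrightarrow> is_solution q A B C D z (X1 q A B C D lm)) \<and>
        (X2_defined q A B C D \<longrightarrow> is_solution q A B C D z (X2 q A B C D lp lm)) \<and>
        (X3_defined q A B C D \<longrightarrow> is_solution q A B C D z (X3 q A B C D lp lm)) \<and>
        (X4_defined q A B C D \<longrightarrow> is_solution q A B C D z (X4 q A B C D lp lm)) \<and>
        (X5_defined q A B C D \<longrightarrow> is_solution q A B C D z (X5 q A B C D lp lm))"
    proof (intro allI impI)
      fix s lp lm
      assume h: "s^2 = z^2 - 4 * q / (A*B*C*D) \<and> lp = lam_plus z s \<and> lm = lam_minus z s"
      have "lp + lm = z" "lp * lm = q / (A*B*C*D)" using h lam_sum ll by auto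
      from all_solutions[OF nz this] show
        "(X1_defined q A B C D lp \<longrightarrow> is_solution q A B C D z (X1 q A B C D lp)) \<and>
        (X1_defined q A B C D lm \<longrightarrow> is_solution q A B C D z (X1 q A B C D lm)) \<and>
        (X2_defined q A B C D \<longrightarrow> is_solution q A B C D z (X2 q A B C D lp lm)) \<and>
        (X3_defined q A B C D \<longrightarrow> is_solution q A B C D z (X3 q A B C D lp lm)) \<and>
        (X4_defined q A B C D \<longrightarrow> is_solution q A B C D z (X4 q A B C D lp lm)) \<and>
        (X5_defined q A B C D \<longrightarrow> is_solution q A B C D z (X5 q A B C D lp lm))"
        by blast
    qed
    show "\<forall>s lp lm. s^2 = z^2 - 4 * q / (A*B*C*D) \<and> lp = lam_plus z s \<and> lm = lam_minus z s \<and>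
        general_position q A B C D lp lm \<longrightarrow>
        (let X = [X1 q A B C D lp, X1 q A B C D lm, X2 q A B C D lp lm,
                  X3 q A B C D lp lm, X4 q A B C D lp lm, X5 q A B C D lp lm]
         in \<forall>i<6. \<forall>j<6. i \<noteq> j \<longrightarrow> lin_indep2 (X!i) (X!j))"
      unfolding Let_def
    proof (intro allI impI, elim conjE)
      fix s lp lm and i j :: nat
      assume "s^2 = z^2 - 4 * q / (A*B*C*D)" "lp = lam_plus z s" "lm = lam_minus z s"
      hence prod: "lp * lm = q / (A*B*C*D)" using ll by simp
      assume "general_position q A B C D lp lm" "i < 6" "j < 6" "i \<noteq> j"
      from pairwise_independent[OF nz prod this]
      show "lin_indep2
        ([X1 q A B C D lp, X1 q A B C D lm, X2 q A B C D lp lm,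
                  X3 q A B C D lp lm, X4 q A B C D lp lm, X5 q A B C D lp lm]!i)
        ([X1 q A B C D lp, X1 q A B C D lm, X2 q A B C D lp lm,
                  X3 q A B C D lp lm, X4 q A B C D lp lm, X5 q A B C D lp lm]!j)" .
    qed
    show "\<forall>\<alpha> x. (2 * \<alpha>)^2 = A*B*C*D / q \<and> x = \<alpha> * z \<and> x \<notin> complex_of_real ` {-1..1} \<longrightarrow>
        (\<exists>s. s^2 = z^2 - 4 * q / (A*B*C*D) \<and>
             (\<lambda>n. (lam_minus z s / lam_plus z s) ^ n) \<longlonglongrightarrow> 0) \<and>
        (\<forall>s. s^2 = z^2 - 4 * q / (A*B*C*D) \<and>
             (\<lambda>n. (lam_minus z s / lam_plus z s) ^ n) \<longlonglongrightarrow> 0 \<and>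
             X1_defined q A B C D (lam_minus z s) \<longrightarrow>
             (\<forall>X. is_minimal q A B C D z X \<longleftrightarrow>
                  (\<exists>c. c \<noteq> 0 \<and> X = (\<lambda>n. c * X1 q A B C D (lam_minus z s) n))))"
    proof (intro allI impI, elim conjE, rule conjI)
      fix \<alpha> x
      assume "(2 * \<alpha>)^2 = A*B*C*D / q" "x = \<alpha> * z" "x \<notin> complex_of_real ` {-1..1}"
      thus "\<exists>s. s^2 = z^2 - 4 * q / (A*B*C*D) \<and> (\<lambda>n. (lam_minus z s / lam_plus z s) ^ n) \<longlonglongrightarrow> 0"
        using q0 nz by (intro ex_branch) auto
      show "\<forall>s. s^2 = z^2 - 4 * q / (A*B*C*D) \<and>
             (\<lambda>n. (lam_minus z s / lam_plus z s) ^ n) \<longlonglongrightarrow> 0 \<and>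
             X1_defined q A B C D (lam_minus z s) \<longrightarrow>
             (\<forall>X. is_minimal q A B C D z X \<longleftrightarrow>
                  (\<exists>c. c \<noteq> 0 \<and> X = (\<lambda>n. c * X1 q A B C D (lam_minus z s) n)))"
      proof (intro allI impI, elim conjE)
        fix s X
        assume s: "s^2 = z^2 - 4 * q / (A*B*C*D)"
          and lim: "(\<lambda>n. (lam_minus z s / lam_plus z s) ^ n) \<longlonglongrightarrow> 0"
          and def: "X1_defined q A B C D (lam_minus z s)"
        have prod: "lam_minus z s * lam_plus z s = q / (A*B*C*D)" using ll[OF s] by (simp add: mult.commute)
        \<comment> \<open>The branch is given through convergence of the powers, whereas
          \<open>X1_minimal\<close> asks for the modulus of the quotient.\<close>
        have "norm (lam_minus z s / lam_plus z s) < 1"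
        proof (rule ccontr)
          assume "\<not> ?thesis"
          hence "norm ((lam_minus z s / lam_plus z s) ^ n) \<ge> 1" for n
            by (simp only: norm_power one_le_power not_less)
          moreover have "\<forall>\<^sub>F n in sequentially. norm ((lam_minus z s / lam_plus z s) ^ n) < 1"
            using tendsto_norm[OF lim] by (rule order_tendstoD) simp
          ultimately show False by (auto simp: eventually_sequentially not_less[symmetric])
        qed
        from X1_minimal[OF nz prod assms(7) def this]
        have min: "is_minimal q A B C D z (X1 q A B C D (lam_minus z s))"
          using lam_sum[of z s] by (simp add: add.commute)
        show "is_minimal q A B C D z X \<longleftrightarrow>
                  (\<exists>c. c \<noteq> 0 \<and> X = (\<lambda>n. c * X1 q A B C D (lam_minus z s) n))"
          using minimal_unique[OF min] minimal_scale[OF min] by metis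
      qed
    qed
  qed
qed

end
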